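(* Let $n>25$, let $\mathcal{K}\subset\mathbb{R}^n$ be a bounded convex set with nonempty interior, and let $b>0$ satisfy $0\leq b\leq\frac{n}{2\log_2 n}$ and $\rho_{\mathcal{K}}(\mathbb{Z}^n)<n^b$. Let $\delta,\varepsilon\in(0,1)$ and $c_4=e\cdot2^{57}$. Let $p$ be a prime with $$\frac{2^{18}}{(\varepsilon^2\delta)^2}n^{3+2b}\leq p\leq\frac{2^{19}}{(\varepsilon^2\delta)^2}n^{3+2b},$$ and $r=3+\left\lceil\frac{n}{\log p}\left(b\log n+\log3\right)\right\rceil$. If $L$ is drawn from the random $(p,r)$ construction A ensemble, then $$\Pr\left(\Phi_{\mathcal{K},L}(\varepsilon)>c_4\left(\frac{1}{\varepsilon^2\delta}\right)^6 n^{9+6b}\right)\leq\delta.$$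
   Context: For a lattice $L\subset\mathbb{R}^n$, a bounded convex set $\mathcal{K}$ with nonempty interior and $x\in\mathbb{R}^n$, let $N(L,\mathcal{K},x)=|L\cap(\mathcal{K}+x)|$ and $\eta(\mathcal{K},L)=\sup_{x\in\mathbb{R}^n}\left|\frac{N(L,\mathcal{K},x)}{\mathrm{vol}(\mathcal{K})/\mathrm{covol}(L)}-1\right|$, and $\Phi_{\mathcal{K},L}(\varepsilon)=\sup\left\{\frac{\mathrm{vol}(\alpha\mathcal{K})}{\mathrm{covol}(L)}:\alpha>0,\ \eta(\alpha\mathcal{K},L)>\varepsilon\right\}$. $(L,\mathcal{K})$ is a covering if $L+\mathcal{K}=\mathbb{R}^n$ and a packing if the translates $\ell+\mathcal{K}$, $\ell\in L$, are pairwise disjoint; $\mathrm{r}_{\mathrm{cov},\mathcal{K}}(L)$ is the infimum of $\alpha>0$ with $(L,\alpha\mathcal{K})$ a covering, $\mathrm{r}_{\mathrm{pack},\mathcal{K}}(L)$ the supremum of $\alpha>0$ with $(L,\alpha\mathcal{K})$ a packing, and $\rho_{\mathcal{K}}(L)=\mathrm{r}_{\mathrm{cov},\mathcal{K}}(L)/\mathrm{r}_{\mathrm{pack},\mathcal{K}}(L)$. Random $(p,r)$ construction A ensemble: with $\pi_p:\mathbb{Z}^n\to\mathbb{F}_p^n$ coordinatewise reduction mod $p$, draw $S$ uniformly from the $r$-dimensional subspaces of $\mathbb{F}_p^n$ and set $L=\frac1p\pi_p^{-1}(S)$. Logarithms are natural. *)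

theory Defs
  imports "HOL-Probability.Probability" "Berlekamp_Zassenhaus.Finite_Field"
begin

definition int_lattice :: "(real ^ 'n) set"
  where "int_lattice = {x. \<forall>i. x $ i \<in> \<int>}"

text \<open>The columns of \<open>A\<close> are a basis of the (full-rank) lattice \<open>L\<close>.\<close>

definition lattice_basis :: "real ^ 'n ^ 'n \<Rightarrow> (real ^ 'n) set \<Rightarrow> bool"
  where "lattice_basis A L \<longleftrightarrow> invertible A \<and> L = (\<lambda>z. A *v z) ` int_lattice"

definition covol :: "(real ^ 'n) set \<Rightarrow> real"
  where "covol L = (THE v. \<exists>A. lattice_basis A L \<and> v = \<bar>det A\<bar>)"

lemma det_Ints:
  fixes U :: "real ^ 'n ^ 'n"
  assumes "\<And>i j. U $ i $ j \<in> \<int>"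
  shows "det U \<in> \<int>"
  unfolding det_def by (intro Ints_sum Ints_mult Ints_prod Ints_of_int assms)

lemma lattice_basis_change:
  fixes A B :: "real ^ 'n ^ 'n"
  assumes "lattice_basis A L" "lattice_basis B L"
  obtains U :: "real ^ 'n ^ 'n" where "B = A ** U" "det U \<in> \<int>"
proof -
  have "\<exists>u. u \<in> int_lattice \<and> A *v u = column j B" for j
  proof -
    have "axis j 1 \<in> (int_lattice :: (real ^ 'n) set)"
      by (auto simp: int_lattice_def axis_def)
    then have "B *v axis j 1 \<in> L"
      using assms(2) by (auto simp: lattice_basis_def)
    then show ?thesis
      using assms(1) by (auto simp: lattice_basis_def matrix_vector_mult_basis)
  qed
  then obtain u where u: "\<And>j. u j \<in> int_lattice" "\<And>j. A *v u j = column j B"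
    by metis
  define U :: "real ^ 'n ^ 'n" where "U = (\<chi> i j. u j $ i)"
  have "B = A ** U"
  proof -
    have "B $ i $ j = (A ** U) $ i $ j" for i j
      using arg_cong[OF u(2)[of j], of "\<lambda>x. x $ i"]
      by (simp add: U_def matrix_matrix_mult_def matrix_vector_mult_def column_def)
    then show ?thesis by (simp add: vec_eq_iff)
  qed
  moreover have "det U \<in> \<int>"
    by (rule det_Ints) (use u(1) in \<open>simp add: U_def int_lattice_def\<close>)
  ultimately show thesis by (rule that)
qed

lemma lattice_basis_det_le:
  fixes A B :: "real ^ 'n ^ 'n"
  assumes "lattice_basis A L" "lattice_basis B L"
  shows "\<bar>det A\<bar> \<le> \<bar>det B\<bar>"
proof -
  obtain U :: "real ^ 'n ^ 'n" where U: "B = A ** U" "det U \<in> \<int>"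
    using lattice_basis_change[OF assms] by blast
  have "det B \<noteq> 0"
    using assms(2) by (simp add: lattice_basis_def invertible_det_nz)
  then have "det U \<noteq> 0" using U(1) by (simp add: det_mul)
  then have "1 \<le> \<bar>det U\<bar>" using U(2) by (simp add: Ints_nonzero_abs_ge1)
  then have "\<bar>det A\<bar> * 1 \<le> \<bar>det A\<bar> * \<bar>det U\<bar>"
    by (intro mult_left_mono) auto
  then show ?thesis by (simp add: U(1) det_mul abs_mult)
qed

lemma covol_eq:
  assumes "lattice_basis A L"
  shows "covol L = \<bar>det A\<bar>"
  unfolding covol_def
  by (rule the_equality) (use assms lattice_basis_det_le in \<open>blast intro: order_antisym\<close>)+

text \<open>\<open>card\<close> is the true cardinality because a lattice meets a bounded set in a finite set.\<close>

definition N_points :: "(real ^ 'n) set \<Rightarrow> (real ^ 'n) set \<Rightarrow> real ^ 'n \<Rightarrow> nat"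
  where "N_points L K x = card (L \<inter> (+) x ` K)"

text \<open>Volumes are taken with respect to \<open>lebesgue\<close>, since a convex set need not be Borel. The
  suprema defining \<open>eta\<close> and \<open>Phi\<close> are taken in the extended reals.\<close>

definition eta :: "(real ^ 'n) set \<Rightarrow> (real ^ 'n) set \<Rightarrow> ereal"
  where "eta K L =
    (SUP x. ereal \<bar>real (N_points L K x) / (measure lebesgue K / covol L) - 1\<bar>)"

definition Phi :: "(real ^ 'n) set \<Rightarrow> (real ^ 'n) set \<Rightarrow> real \<Rightarrow> ereal"
  where "Phi K L \<epsilon> =
    Sup {ereal (measure lebesgue ((*\<^sub>R) \<alpha> ` K) / covol L) |\<alpha>.
      \<alpha> > 0 \<and> eta ((*\<^sub>R) \<alpha> ` K) L > ereal \<epsilon>}"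

definition is_covering :: "(real ^ 'n) set \<Rightarrow> (real ^ 'n) set \<Rightarrow> bool"
  where "is_covering L K \<longleftrightarrow> {l + k |l k. l \<in> L \<and> k \<in> K} = UNIV"

definition is_packing :: "(real ^ 'n) set \<Rightarrow> (real ^ 'n) set \<Rightarrow> bool"
  where "is_packing L K \<longleftrightarrow> disjoint_family_on (\<lambda>l. (+) l ` K) L"

text \<open>For a lattice and a bounded convex set with nonempty interior, the sets below are nonempty,
  bounded below and above respectively, and the packing radius is positive; so real-valued infimum,
  supremum and quotient are the intended ones.\<close>

definition r_cov :: "(real ^ 'n) set \<Rightarrow> (real ^ 'n) set \<Rightarrow> real"
  where "r_cov K L = Inf {\<alpha>. \<alpha> > 0 \<and> is_covering L ((*\<^sub>R) \<alpha> ` K)}"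

definition r_pack :: "(real ^ 'n) set \<Rightarrow> (real ^ 'n) set \<Rightarrow> real"
  where "r_pack K L = Sup {\<alpha>. \<alpha> > 0 \<and> is_packing L ((*\<^sub>R) \<alpha> ` K)}"

definition rho :: "(real ^ 'n) set \<Rightarrow> (real ^ 'n) set \<Rightarrow> real"
  where "rho K L = r_cov K L / r_pack K L"

text \<open>The field with \<open>p\<close> elements is \<open>'p mod_ring\<close>, where \<open>'p\<close> is a type with
  \<open>p = CARD('p)\<close> elements; class \<open>prime_card\<close> says that this number is prime.
  The ring homomorphism \<open>of_int\<close> into it is reduction mod \<open>p\<close>.\<close>

definition reduce_mod :: "int ^ 'n \<Rightarrow> ('p::prime_card) mod_ring ^ 'n"
  where "reduce_mod z = (\<chi> i. of_int (z $ i))"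

definition construction_A :: "(('p::prime_card) mod_ring ^ 'n) set \<Rightarrow> (real ^ 'n) set"
  where "construction_A S =
    {(1 / real CARD('p)) *\<^sub>R (\<chi> i. real_of_int (z $ i)) |z. z \<in> reduce_mod -` S}"

text \<open>The set of \<open>r\<close>-dimensional subspaces is finite, and nonempty as long as
  \<open>r \<le> CARD('n)\<close>; otherwise \<open>pmf_of_set\<close> is unspecified.\<close>

definition construction_A_ensemble :: "('p::prime_card) itself \<Rightarrow> nat \<Rightarrow> (real ^ 'n) set pmf"
  where "construction_A_ensemble _ r =
    map_pmf construction_A
      (pmf_of_set {S :: ('p mod_ring ^ 'n) set. vec.subspace S \<and> vec.dim S = r})"

end

theory Submission
  imports Defs
begin

text \<open>
The core is an equidistribution statement: for a function \<open>f \<ge> 0\<close> on \<open>F\<^sup>n\<close>, where \<open>F\<close> is a field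
with \<open>q\<close> elements, most \<open>r\<close>-dimensional subspaces \<open>S\<close> have the same \<open>f\<close>-mass, up to a factor
\<open>1 \<plusminus> \<epsilon>\<close>, in all their translates. It is proved by the method of multiplicities of the finite
field Kakeya problem. Let a polynomial \<open>P\<close> of degree \<open>d\<close> vanish at every point \<open>y\<close> to order about
\<open>s (1 + \<kappa> f y)\<close> with \<open>\<bar>\<kappa>\<bar> \<sim> \<epsilon> / n\<close>; the base multiplicity \<open>s\<close> makes the number of conditions linear
in \<open>f\<close> to first order. If some translate of \<open>S\<close> has deviating mass, then \<open>P\<close> and its derivatives
of low order vanish on that translate, so the leading form of \<open>P\<close> vanishes to high order at
\<open>\<Sum>l<r. t\<^sup>l w\<^sub>l \<in> F[t]\<^sup>n\<close> for every basis \<open>w\<close> of \<open>S\<close>. These points lie on a grid of side \<open>q\<^sup>r\<close>,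
and the Schwartz--Zippel bound on that grid shows that bad subspaces are rare.

For the lattice, the mass of \<open>S + v\<close> under the function counting the points of \<open>\<alpha>K \<inter> (1/p)\<int>\<^sup>n\<close>
by residue class is the number of points of \<open>L\<close> in a translate of \<open>\<alpha>K\<close> by a point of \<open>(1/p)\<int>\<^sup>n\<close>.
With \<open>c\<close> such that \<open>cK\<close> covers modulo \<open>\<int>\<^sup>n\<close>, the scales \<open>\<alpha> = jc/p\<close> sandwich all other \<open>\<alpha>\<close> and all
real translates, only \<open>O(np/\<epsilon>)\<close> of them matter, and a union bound over these \<open>j\<close> finishes the
proof.
\<close>

text \<open>A union bound over the translates of a subspace would cost a factor q^(n-r). The leading
  form avoids it: it does not see the base point of a flat, so one deviating translate, whichever it
  is, leaves its trace at the same point of F[t]^n. The size of \<kappa> balances two orders. With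
  \<open>A\<close> and \<open>Q\<close> the means of \<phi> and \<phi>^2, the number of conditions
  allows a degree of about \<open>s * q * (1 + A + n * Q)\<close>, so a flat is detected once its
  mean of \<phi> exceeds \<open>A + n * Q\<close> by a margin. For \<phi> = \<kappa> f with 0 \<le>
  f \<le> M and mean \<mu> the loss \<open>n * Q\<close> is at most n \<kappa>^2 M \<mu>; it stays
  below the deviation \<epsilon> \<kappa> \<mu> if \<kappa> is of size \<epsilon> / (n M). The
  failure probability is then of order n q M / (\<epsilon>^2 \<mu> q^r). The choice of r, at scales
  with at least p^3 expected points, gives p^3 M \<le> \<mu> p^r. One scale thus fails with
  probability O(n / (\<epsilon>^2 p^2)), all of them with O(n^2 / (\<epsilon>^3 p)), and the lower
  bound on p makes this at most \<delta>.\<close>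

hide_const (open) up_ring.coeff up_ring.monom Coset.order

section \<open>Polynomial functions\<close>

text \<open>\<open>polyfun I l h f\<close>: in the variables \<open>I\<close>, the function \<open>f\<close> is a combination of monomials of total
  degree between \<open>l\<close> and \<open>h\<close>. The zero function has every such degree range, including \<open>l > h\<close>.\<close>

inductive polyfun :: "'i set \<Rightarrow> nat \<Rightarrow> nat \<Rightarrow> (('i \<Rightarrow> 'r::idom) \<Rightarrow> 'r) \<Rightarrow> bool" for I where
  zero: "polyfun I l h (\<lambda>_. 0)"
| const: "polyfun I 0 0 (\<lambda>_. c)"
| var: "i \<in> I \<Longrightarrow> polyfun I 1 1 (\<lambda>x. x i)"
| add: "polyfun I l h f \<Longrightarrow> polyfun I l h g \<Longrightarrow> polyfun I l h (\<lambda>x. f x + g x)"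
| mult: "polyfun I l h f \<Longrightarrow> polyfun I l' h' g \<Longrightarrow> polyfun I (l + l') (h + h') (\<lambda>x. f x * g x)"
| weaken: "polyfun I l h f \<Longrightarrow> l' \<le> l \<Longrightarrow> h \<le> h' \<Longrightarrow> polyfun I l' h' f"

lemma polyfun_sum:
  assumes "\<And>a. a \<in> A \<Longrightarrow> polyfun I l h (f a)"
  shows "polyfun I l h (\<lambda>x. \<Sum>a\<in>A. f a x)"
  using assms by (induction A rule: infinite_finite_induct) (auto intro: polyfun.zero polyfun.add)

lemma polyfun_cmult: "polyfun I l h f \<Longrightarrow> polyfun I l h (\<lambda>x. c * f x)"
  using polyfun.mult[OF polyfun.const, of I l h f c] by simp

lemma polyfun_power: "polyfun I l h f \<Longrightarrow> polyfun I (k * l) (k * h) (\<lambda>x. f x ^ k)"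
  by (induction k) (use polyfun.const[of I 1] in \<open>auto dest: polyfun.mult\<close>)

lemma polyfun_prod:
  assumes "finite A" "\<And>a. a \<in> A \<Longrightarrow> polyfun I (l a) (h a) (f a)"
  shows "polyfun I (sum l A) (sum h A) (\<lambda>x. \<Prod>a\<in>A. f a x)"
  using assms by (induction A) (auto intro: polyfun.mult polyfun.const)

text \<open>\<open>e = 1\<close> is substitution of homogeneous linear forms, which preserves the
  lower degree bound and with it the order of vanishing at the origin; \<open>e = 0\<close> is
  affine substitution, after which only the upper bound is left.\<close>

lemma polyfun_subst:
  assumes "polyfun I l h f" "\<And>i. i \<in> I \<Longrightarrow> polyfun J e 1 (\<lambda>x. X x i)" "e \<le> 1"
  shows "polyfun J (e * l) h (\<lambda>x. f (X x))"
  using assms(1)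
proof induction
  case (var i)
  then show ?case using assms(2,3) by simp
next
  case (mult l h f l' h' g)
  from polyfun.mult[OF mult(3,4)] show ?case by (simp add: algebra_simps)
next
  case (weaken l h f l' h')
  from polyfun.weaken[OF weaken(4), of "e * l'" h'] weaken(2,3) show ?case by simp
qed (auto intro: polyfun.intros polyfun.weaken[OF polyfun.const])

lemma polyfun_cong:
  assumes "polyfun I l h f" "\<And>i. i \<in> I \<Longrightarrow> x i = y i"
  shows "f x = f y"
  using assms by induction auto

text \<open>The link between degrees and multiplicities: along lines through the origin a lower
  degree bound becomes divisibility by a power of \<open>u\<close>.\<close>

lemma polyfun_line:
  assumes "polyfun I l h f"
  shows "\<exists>p. (\<forall>u. f (\<lambda>i. u * z i) = poly p u) \<and> (\<forall>i. coeff p i \<noteq> 0 \<longrightarrow> l \<le> i \<and> i \<le> h)"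
  using assms
proof induction
  case (zero l h)
  show ?case by (rule exI[of _ 0]) simp
next
  case (const c)
  show ?case by (rule exI[of _ "[:c:]"]) (auto simp: coeff_pCons split: nat.splits)
next
  case (var i)
  show ?case by (rule exI[of _ "[:0, z i:]"]) (auto simp: coeff_pCons split: nat.splits)
next
  case (add l h f g)
  then obtain p q where *: "\<And>u. f (\<lambda>i. u * z i) = poly p u" "\<And>u. g (\<lambda>i. u * z i) = poly q u"
  and
    "\<And>i. coeff p i \<noteq> 0 \<Longrightarrow> l \<le> i \<and> i \<le> h" "\<And>i. coeff q i \<noteq> 0 \<Longrightarrow> l \<le> i \<and> i \<le> h" by blast
  from this(3,4) have "\<And>i. coeff (p + q) i \<noteq> 0 \<Longrightarrow> l \<le> i \<and> i \<le> h" by (metis add_0 coeff_add)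
  then show ?case by (intro exI[of _ "p + q"]) (auto simp: *)
next
  case (mult l h f l' h' g)
  then obtain p q where pq: "\<And>u. f (\<lambda>i. u * z i) = poly p u" "\<And>u. g (\<lambda>i. u * z i) = poly q u"
    "\<And>i. coeff p i \<noteq> 0 \<Longrightarrow> l \<le> i \<and> i \<le> h" "\<And>i. coeff q i \<noteq> 0 \<Longrightarrow> l' \<le> i \<and> i \<le> h'" by blast
  have "l + l' \<le> i \<and> i \<le> h + h'" if i: "coeff (p * q) i \<noteq> 0" for i
  proof -
    have "\<exists>j\<le>i. coeff p j * coeff q (i - j) \<noteq> 0"
    proof (rule ccontr)
      assume "\<not> ?thesis"
      then have "coeff (p * q) i = 0" unfolding coeff_mult by (intro sum.neutral) auto
      with i show False by simp
    qed
    then obtain j where "j \<le> i" "coeff p j * coeff q (i - j) \<noteq> 0" by blast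
    then show ?thesis using pq(3)[of j] pq(4)[of "i - j"] by auto
  qed
  then show ?case using pq by (intro exI[of _ "p * q"]) auto
next
  case (weaken l h f l' h')
  then show ?case by (meson order_trans)
qed

text \<open>The expansion in powers of the variable \<open>k\<close>. Subtraction is truncated: for
  \<open>j \<ge> l\<close> nothing is left of the lower bound. For \<open>j > h\<close> the degree
  bound \<open>h - j = 0\<close> would still admit constants; the last clause excludes them, and the
  product case relies on it.\<close>

lemma polyfun_slice:
  assumes "polyfun (insert k I) l h f" "k \<notin> I"
  shows "\<exists>g. (\<forall>x. f x = (\<Sum>j\<le>h. g j x * x k ^ j)) \<and> (\<forall>j. polyfun I (l - j) (h - j) (g j))
    \<and> (\<forall>j>h. g j = (\<lambda>_. 0))"
  using assms(1)
proof induction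
  case (zero l h)
  show ?case by (rule exI[of _ "\<lambda>_ _. 0"]) (auto intro: polyfun.zero)
next
  case (const c)
  show ?case by (rule exI[of _ "\<lambda>j _. if j = 0 then c else 0"]) (auto intro: polyfun.intros)
next
  case (var i)
  show ?case
  proof (cases "i = k")
    case True
    then show ?thesis
      by (intro exI[of _ "\<lambda>j _. if j = 1 then 1 else 0"]) (auto intro: polyfun.intros)
  next
    case False
    then have "polyfun I 1 1 (\<lambda>x. x i)" using var by (intro polyfun.var) auto
    then have "polyfun I (1 - j) (1 - j) (\<lambda>x. if j = 0 then x i else 0)" for j
      by (cases j) (auto intro: polyfun.zero)
    then show ?thesis
      by (intro exI[of _ "\<lambda>j x. if j = 0 then x i else 0"]) auto
  qed
next
  case (add l h f f')
  then obtain g g' where g: "\<And>x. f x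
    = (\<Sum>j\<le>h. g j x * x k ^ j)" "\<And>j. polyfun I (l - j) (h - j) (g j)"
      "\<And>j. j > h \<Longrightarrow> g j = (\<lambda>_. 0)"
    and g': "\<And>x. f' x = (\<Sum>j\<le>h. g' j x * x k ^ j)" "\<And>j. polyfun I (l - j) (h - j) (g' j)"
      "\<And>j. j > h \<Longrightarrow> g' j = (\<lambda>_. 0)" by blast
  show ?case
    by (rule exI[of _ "\<lambda>j x. g j x + g' j x"])
      (use g g' in \<open>auto intro: polyfun.add simp: sum.distrib distrib_right\<close>)
next
  case (mult l h f l' h' f')
  then obtain g g' where g: "\<And>x. f x
    = (\<Sum>j\<le>h. g j x * x k ^ j)" "\<And>j. polyfun I (l - j) (h - j) (g j)"
      "\<And>j. j > h \<Longrightarrow> g j = (\<lambda>_. 0)"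
    and g': "\<And>x. f' x = (\<Sum>j\<le>h'. g' j x * x k ^ j)" "\<And>j. polyfun I (l' - j) (h' - j) (g' j)"
      "\<And>j. j > h' \<Longrightarrow> g' j = (\<lambda>_. 0)" by blast
  define G where "G j x = (\<Sum>i\<le>j. g i x * g' (j - i) x)" for j x
  have "polyfun I (l + l' - j) (h + h' - j) (G j)" for j
    unfolding G_def
  proof (rule polyfun_sum)
    fix i assume i: "i \<in> {..j}"
    show "polyfun I (l + l' - j) (h + h' - j) (\<lambda>x. g i x * g' (j - i) x)"
    proof (cases "i \<le> h \<and> j - i \<le> h'")
      case True
      show ?thesis
        by (rule polyfun.weaken[OF polyfun.mult[OF g(2) g'(2)]]) (use True i in auto)
    next
      case False
      then show ?thesis using g(3)[of i] g'(3)[of "j - i"] by (auto intro: polyfun.zero)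
    qed
  qed
  moreover have "f x * f' x = (\<Sum>j\<le>h + h'. G j x * x k ^ j)" for x
  proof -
    \<comment> \<open>For fixed \<open>x\<close> the slices are packed into univariate polynomials,
      so that the convolution \<open>G\<close> is read off from the coefficients of their
      product.\<close>
    define p where "p = (\<Sum>j\<le>h. monom (g j x) j)"
    define p' where "p' = (\<Sum>j\<le>h'. monom (g' j x) j)"
    have c: "coeff p j = g j x" "coeff p' j = g' j x" for j
      using g(3)[of j] g'(3)[of j] by (auto simp: p_def p'_def coeff_sum not_le)
    have "degree p \<le> h" "degree p' \<le> h'"
      by (rule degree_le; simp add: c g(3) g'(3))+
    then have deg: "degree (p * p') \<le> h + h'"
      using degree_mult_le[of p p'] by linarith
    have "poly (p * p') (x k) = (\<Sum>j\<le>h + h'. coeff (p * p') j * x k ^ j)"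
      unfolding poly_altdef
      by (rule sum.mono_neutral_left) (use deg in \<open>auto simp: coeff_eq_0\<close>)
    moreover have "f x = poly p (x k)" "f' x = poly p' (x k)"
      by (auto simp: g(1) g'(1) p_def p'_def poly_sum poly_monom)
    ultimately show ?thesis by (simp add: coeff_mult c G_def)
  qed
  moreover have "G j = (\<lambda>_. 0)" if "j > h + h'" for j
  proof
    fix x
    have "g i x * g' (j - i) x = 0" if "i \<le> j" for i
      using g(3)[of i] g'(3)[of "j - i"] \<open>j > h + h'\<close> that
      by (cases "i > h") auto
    then show "G j x = 0" unfolding G_def by (intro sum.neutral) auto
  qed
  ultimately show ?case by (intro exI[of _ G] conjI allI impI)
next
  case (weaken l h f l' h')
  then obtain g where g: "\<And>x. f x = (\<Sum>j\<le>h. g j x * x k ^ j)" "\<And>j. polyfun I (l - j) (h - j) (g j)"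
      "\<And>j. j > h \<Longrightarrow> g j = (\<lambda>_. 0)" by blast
  have "(\<Sum>j\<le>h. g j x * x k ^ j) = (\<Sum>j\<le>h'. g j x * x k ^ j)" for x
    by (rule sum.mono_neutral_left) (use weaken g(3) in auto)
  moreover have "polyfun I (l' - j) (h' - j) (g j)" for j
    by (rule polyfun.weaken[OF g(2)]) (use weaken in auto)
  ultimately show ?case using g weaken by (intro exI[of _ g]) auto
qed

section \<open>The Schwartz--Zippel bound with multiplicities\<close>

text \<open>Multiplicity is tested along lines, which avoids Hasse derivatives; over an infinite domain it
  agrees with the usual notion.\<close>

definition vanishes_to :: "(('i \<Rightarrow> 'r::idom) \<Rightarrow> 'r) \<Rightarrow> ('i \<Rightarrow> 'r) \<Rightarrow> nat \<Rightarrow> bool"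
  where "vanishes_to f a m \<longleftrightarrow> (\<forall>z. \<exists>q. \<forall>u. f (\<lambda>i. a i + u * z i) = u ^ m * poly q u)"

lemma poly_eq_if_infinite:
  fixes p q :: "'r::idom poly"
  assumes "infinite (UNIV :: 'r set)" "\<And>u. poly p u = poly q u"
  shows "p = q"
proof (rule ccontr)
  assume "p \<noteq> q"
  then have "finite {u. poly (p - q) u = 0}" by (intro poly_roots_finite) simp
  moreover have "{u. poly (p - q) u = 0} = UNIV" using assms(2) by auto
  ultimately show False using assms(1) by simp
qed

lemma polyfun_affine_line:
  assumes "polyfun I l h f"
  shows "\<exists>p. \<forall>u. f (\<lambda>i. a i + u * z i) = poly p u"
proof -
  \<comment> \<open>The parameter of the line becomes the single variable of a one-element index
    type; evaluation in the constant direction \<open>1\<close> then yields the polynomial.\<close>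
  have "polyfun {()} 0 1 (\<lambda>x. a i + x () * z i)" for i
    using polyfun.add[OF polyfun.weaken[OF polyfun.const[of _ "a i"], of 0 1]
        polyfun.weaken[OF polyfun_cmult[OF polyfun.var[of "()" "{()}"], of "z i"], of 0 1]]
    by (simp add: mult.commute)
  from polyfun_subst[OF assms, of "{()}" 0 "\<lambda>x i. a i + x () * z i"] this
  have "polyfun {()} 0 h (\<lambda>x. f (\<lambda>i. a i + x () * z i))" by simp
  from polyfun_line[OF this, of "\<lambda>_. 1"] show ?thesis by auto
qed

text \<open>Over an infinite domain equal values force equal polynomials, so the factor
  \<open>u ^ m\<close> is visible in the coefficients.\<close>

lemma vanishes_to_iff_coeff:
  fixes f :: "('i \<Rightarrow> 'r::idom) \<Rightarrow> 'r"
  assumes "infinite (UNIV :: 'r set)" "\<And>z u. f (\<lambda>i. a i + u * z i) = poly (p z) u"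
  shows "vanishes_to f a m \<longleftrightarrow> (\<forall>z. \<forall>i<m. coeff (p z) i = 0)"
proof -
  have "(\<exists>q. \<forall>u. poly (p z) u = u ^ m * poly q u) \<longleftrightarrow> monom 1 m dvd p z" for z
  proof
    assume "\<exists>q. \<forall>u. poly (p z) u = u ^ m * poly q u"
    then obtain q where "\<And>u. poly (p z) u = poly (monom 1 m * q) u"
      by (auto simp: poly_monom)
    from poly_eq_if_infinite[OF assms(1) this] show "monom 1 m dvd p z" by simp
  next
    assume "monom 1 m dvd p z"
    then show "\<exists>q. \<forall>u. poly (p z) u = u ^ m * poly q u"
      by (auto simp: dvd_def poly_monom)
  qed
  then show ?thesis by (simp add: vanishes_to_def assms(2) monom_1_dvd_iff')
qed

lemma order_ge_if_shift:
  fixes U :: "'r::idom poly"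
  assumes "U \<noteq> 0" "\<And>i. i < k \<Longrightarrow> coeff (U \<circ>\<^sub>p [:\<beta>, 1:]) i = 0"
  shows "k \<le> order \<beta> U"
proof -
  obtain q where q: "U \<circ>\<^sub>p [:\<beta>, 1:] = monom 1 k * q"
    using assms(2) monom_1_dvd_iff'[of k "U \<circ>\<^sub>p [:\<beta>, 1:]"] by (auto simp: dvd_def)
  have "U = (U \<circ>\<^sub>p [:\<beta>, 1:]) \<circ>\<^sub>p [:- \<beta>, 1:]"
    by (simp add: pcompose_assoc[symmetric] pcompose_pCons)
  also have "\<dots> = [:- \<beta>, 1:] ^ k * (q \<circ>\<^sub>p [:- \<beta>, 1:])"
    by (simp add: q pcompose_mult monom_altdef pcompose_hom.hom_power pcompose_pCons)
  finally have "[:- \<beta>, 1:] ^ k dvd U" by (metis dvd_triv_left)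
  then show ?thesis using assms(1) by (simp add: order_divides)
qed

lemma sum_order_le:
  fixes U :: "'r::idom poly"
  assumes "U \<noteq> 0" "finite B"
  shows "(\<Sum>\<beta>\<in>B. order \<beta> U) \<le> degree U"
proof -
  have "(\<Sum>\<beta>\<in>B. order \<beta> U) = (\<Sum>\<beta>\<in>B \<inter> {x. poly U x = 0}. order \<beta> U)"
    using assms by (intro sum.mono_neutral_right) (auto simp: order_root)
  also have "\<dots> \<le> (\<Sum>\<beta> | poly U \<beta> = 0. order \<beta> U)"
    using assms by (intro sum_mono2) (auto intro: poly_roots_finite)
  also have "\<dots> \<le> degree U" using assms(1) by (rule sum_order_le_degree)
  finally show ?thesis .
qed

lemma sum_PiE_insert:
  assumes "k \<notin> I"
  shows "sum m (PiE (insert k I) (\<lambda>_. B)) = (\<Sum>a\<in>PiE I (\<lambda>_. B). \<Sum>\<beta>\<in>B. m (a(k := \<beta>)))"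
proof -
  have "sum m (PiE (insert k I) (\<lambda>_. B)) = (\<Sum>(\<beta>, a)\<in>B \<times> PiE I (\<lambda>_. B). m (a(k := \<beta>)))"
    unfolding PiE_insert_eq
    by (subst sum.reindex) (use assms inj_combinator[of k I "\<lambda>_. B"]
      in \<open>auto simp: case_prod_beta'\<close>)
  also have "\<dots> = (\<Sum>\<beta>\<in>B. \<Sum>a\<in>PiE I (\<lambda>_. B). m (a(k := \<beta>)))"
    by (rule sum.cartesian_product[symmetric])
  also have "\<dots> = (\<Sum>a\<in>PiE I (\<lambda>_. B). \<Sum>\<beta>\<in>B. m (a(k := \<beta>)))" by (rule sum.swap)
  finally show ?thesis .
qed

text \<open>The extra factor \<open>card B\<close> on both sides avoids the exponent
  \<open>card I - 1\<close>. In the induction step \<open>f\<close> is sliced by the variable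
  \<open>k\<close>, with top nonzero slice \<open>g t\<close>. At a grid point with coordinates
  \<open>a\<close> and \<open>\<beta>\<close> the multiplicity is at most
  \<open>\<mu> a + order \<beta> (U a)\<close>: the first term is controlled by the induction
  hypothesis for \<open>g t\<close>, of degree at most \<open>d - t\<close>, and the second sums to
  at most \<open>t\<close> over \<open>\<beta>\<close>.\<close>

theorem Schwartz_Zippel_multiplicity:
  fixes f :: "('i \<Rightarrow> 'r::idom) \<Rightarrow> 'r"
  assumes inf: "infinite (UNIV :: 'r set)" and "finite I" "finite B"
    and "polyfun I 0 d f" "f x0 \<noteq> 0"
    and "\<And>a. a \<in> PiE I (\<lambda>_. B) \<Longrightarrow> vanishes_to f a (m a)"
  shows "card B * sum m (PiE I (\<lambda>_. B)) \<le> d * card B ^ card I"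
  using assms(2,4,5,6)
proof (induction I arbitrary: f d m x0)
  case empty
  have "m (\<lambda>_. undefined) = 0"
  proof (rule ccontr)
    assume m: "m (\<lambda>_. undefined) \<noteq> 0"
    have "vanishes_to f (\<lambda>_. undefined) (m (\<lambda>_. undefined))" using empty(3) by simp
    from this[unfolded vanishes_to_def, THEN spec, of "\<lambda>_. 0"]
    obtain q where q: "\<And>u. f (\<lambda>i. undefined + u * 0) = u ^ m (\<lambda>_. undefined) * poly q u"
      by blast
    from q[of 0] m have "f (\<lambda>i. undefined) = 0" by (simp add: zero_power)
    moreover have "f (\<lambda>i. undefined) = f x0" by (rule polyfun_cong[OF empty(1)]) simp
    ultimately show False using empty(2) by simp
  qed
  then show ?case by simp
next
  case (insert k I)
  obtain g where g: "\<And>x. f x = (\<Sum>j\<le>d. g j x * x k ^ j)" "\<And>j. polyfun I 0 (d - j) (g j)"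
    "\<And>j. j > d \<Longrightarrow> g j = (\<lambda>_. 0)"
    using polyfun_slice[OF insert(4,2)] by auto
  define t where "t = Max {j. j \<le> d \<and> (\<exists>x. g j x \<noteq> 0)}"
  have ne: "{j. j \<le> d \<and> (\<exists>x. g j x \<noteq> 0)} \<noteq> {}"
  proof
    assume "{j. j \<le> d \<and> (\<exists>x. g j x \<noteq> 0)} = {}"
    then have "f x0 = 0" unfolding g by (intro sum.neutral) auto
    with insert(5) show False by simp
  qed
  have "t \<in> {j. j \<le> d \<and> (\<exists>x. g j x \<noteq> 0)}" unfolding t_def by (rule Max_in) (use ne in auto)
  then obtain x1 where t: "t \<le> d" "g t x1 \<noteq> 0" by auto
  have gt0: "g j x = 0" if "t < j" for j x
  proof (rule ccontr)
    assume "g j x \<noteq> 0"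
    moreover have "j \<le> d" using calculation g(3)[of j] by (cases "j \<le> d") auto
    ultimately have "j \<le> t" unfolding t_def by (intro Max_ge) auto
    with that show False by simp
  qed
  have f_eq: "f x = (\<Sum>j\<le>t. g j x * x k ^ j)" for x
    unfolding g(1) by (rule sum.mono_neutral_right) (use t gt0 in auto)
  have "\<forall>j a z. \<exists>p. \<forall>u. g j (\<lambda>i. a i + u * z i) = poly p u"
    using polyfun_affine_line[OF g(2)] by blast
  then obtain p where p: "\<And>j a z u. g j (\<lambda>i. a i + u * z i) = poly (p j a z) u"
    by metis
  \<comment> \<open>\<open>\<mu> a\<close> is the exact order of \<open>g t\<close> at
    \<open>a\<close>, taken over all directions; \<open>\<zeta> a\<close> below is a direction in
    which it is attained.\<close>
  define \<mu> where "\<mu> a = (LEAST i. \<exists>z. coeff (p t a z) i \<noteq> 0)" for a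
  have "\<exists>z. coeff (p t a z) (\<mu> a) \<noteq> 0" for a
  proof -
    have "poly (p t a (\<lambda>i. x1 i - a i)) 1 \<noteq> 0" using t(2) by (simp add: p[symmetric])
    then have "p t a (\<lambda>i. x1 i - a i) \<noteq> 0" by auto
    then have "\<exists>i z. coeff (p t a z) i \<noteq> 0" by (metis leading_coeff_0_iff)
    then show ?thesis unfolding \<mu>_def by (rule LeastI_ex)
  qed
  then obtain \<zeta> where \<zeta>: "\<And>a. coeff (p t a (\<zeta> a)) (\<mu> a) \<noteq> 0" by metis
  have below: "coeff (p t a z) i = 0" if "i < \<mu> a" for a z i
    using not_less_Least[OF that[unfolded \<mu>_def]] by blast
  have van: "vanishes_to (g t) a (\<mu> a)" for a
    using vanishes_to_iff_coeff[OF inf, of "g t" a "p t a"] p below by blast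
  have IH: "card B * sum \<mu> (PiE I (\<lambda>_. B)) \<le> (d - t) * card B ^ card I"
    by (rule insert.IH[OF g(2) t(2)]) (rule van)
  \<comment> \<open>\<open>U a\<close> collects from every slice the coefficient of order
    \<open>\<mu> a\<close> in direction \<open>\<zeta> a\<close>. Its coefficient at
    \<open>t\<close> comes from the top slice and is nonzero by the choice of
    \<open>\<zeta>\<close>.\<close>
  define U where "U a = (\<Sum>j\<le>t. monom (coeff (p j a (\<zeta> a)) (\<mu> a)) j)" for a
  have U: "coeff (U a) t \<noteq> 0" "degree (U a) \<le> t" for a
    using \<zeta> by (auto simp: U_def coeff_sum intro!: degree_le)
  then have U0: "U a \<noteq> 0" for a by (metis coeff_0)
  have Ucomp: "U a \<circ>\<^sub>p [:\<beta>, 1:]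
    = (\<Sum>j\<le>t. Polynomial.smult (coeff (p j a (\<zeta> a)) (\<mu> a)) ([:\<beta>, 1:] ^ j))" for a \<beta>
    by (rule poly_eq_if_infinite[OF inf]) (simp add: U_def poly_pcompose poly_sum poly_monom)
  have key: "m (a(k := \<beta>)) \<le> \<mu> a + order \<beta> (U a)" if a: "a \<in> PiE I (\<lambda>_. B)" and \<beta>: "\<beta> \<in> B" for a \<beta>
  proof (cases "m (a(k := \<beta>)) \<le> \<mu> a")
    case False
    let ?m = "m (a(k := \<beta>))"
    have coeff0: "(\<Sum>j\<le>t. coeff (p j a (\<zeta> a)) i * coeff ([:\<beta>, 1:] ^ j) (N - i)) = 0"
      if N: "N < ?m" "i \<le> N" for N i
    proof -
      \<comment> \<open>On the line that moves by \<open>c * \<zeta> a\<close> in the old variables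
        and by \<open>1\<close> in \<open>k\<close>, the coefficient of \<open>u ^ N\<close> is the
        polynomial \<open>Q\<close> in \<open>c\<close>. It vanishes for every \<open>c\<close>, so
        the contributions of different order \<open>i\<close> in the old variables vanish
        separately.\<close>
      define Q where "Q
        = (\<Sum>i\<le>N. monom (\<Sum>j\<le>t. coeff (p j a (\<zeta> a)) i * coeff ([:\<beta>, 1:] ^ j) (N - i)) i)"
      have "poly Q c = 0" for c
      proof -
        have "a(k := \<beta>) \<in> PiE (insert k I) (\<lambda>_. B)"
          using a \<beta> by (intro PiE_fun_upd)
        from insert.prems(3)[OF this, unfolded vanishes_to_def, THEN spec,
            of "\<lambda>i. if i = k then 1 else c * \<zeta> a i"]
        obtain q
          where q: "\<And>u. f (\<lambda>i. (a(k := \<beta>)) i + u * (if i = k then 1 else c * \<zeta> a i))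
            = u ^ ?m * poly q u"
          by blast
        have "poly (\<Sum>j\<le>t. (p j a (\<zeta> a) \<circ>\<^sub>p [:0, c:]) * [:\<beta>, 1:] ^ j) u
          = poly (monom 1 ?m * q) u" for u
        proof -
          have "poly (monom 1 ?m * q) u =
            (\<Sum>j\<le>t. g j (\<lambda>i. (a(k := \<beta>)) i + u * (if i = k then 1 else c * \<zeta> a i)) * (\<beta> + u) ^ j)"
            using q[of u] by (simp add: f_eq poly_monom)
          also have "\<dots> = (\<Sum>j\<le>t. g j (\<lambda>i. a i + (u * c) * \<zeta> a i) * (\<beta> + u) ^ j)"
          proof (rule sum.cong[OF refl], rule arg_cong2[of _ _ _ _ "(*)"])
            fix j
            show "g j (\<lambda>i. (a(k := \<beta>)) i + u * (if i = k then 1 else c * \<zeta> a i)) =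
                g j (\<lambda>i. a i + (u * c) * \<zeta> a i)"
              by (rule polyfun_cong[OF g(2)]) (use insert(2) in auto)
          qed simp
          finally show ?thesis by (simp add: p poly_sum poly_pcompose)
        qed
        then have "(\<Sum>j\<le>t. (p j a (\<zeta> a) \<circ>\<^sub>p [:0, c:]) * [:\<beta>, 1:] ^ j) = monom 1 ?m * q"
          by (rule poly_eq_if_infinite[OF inf])
        then have "coeff (\<Sum>j\<le>t. (p j a (\<zeta> a) \<circ>\<^sub>p [:0, c:]) * [:\<beta>, 1:] ^ j) N = 0"
          using N by (metis dvd_triv_left monom_1_dvd_iff')
        then have "(\<Sum>j\<le>t. \<Sum>i\<le>N. c ^ i * coeff (p j a (\<zeta> a)) i * coeff ([:\<beta>, 1:] ^ j) (N - i)) = 0"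
          by (simp add: coeff_sum coeff_mult coeff_pcompose_linear)
        then show ?thesis
          by (subst (asm) sum.swap)
             (simp add: Q_def poly_sum poly_monom sum_distrib_left sum_distrib_right mult_ac)
      qed
      then have "Q = 0" using poly_eq_if_infinite[OF inf, of Q 0] by simp
      then have "coeff Q i = 0" by simp
      then show ?thesis using N(2) by (simp add: Q_def coeff_sum)
    qed
    \<comment> \<open>The relations of order \<open>\<mu> a\<close>, with \<open>N\<close> running
      from \<open>\<mu> a\<close> to \<open>?m - 1\<close>, are the low coefficients of
      \<open>U a\<close> expanded at \<open>\<beta>\<close>.\<close>
    have "?m - \<mu> a \<le> order \<beta> (U a)"
    proof (rule order_ge_if_shift[OF U0])
      fix i assume "i < ?m - \<mu> a"
      then show "coeff (U a \<circ>\<^sub>p [:\<beta>, 1:]) i = 0"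
        using coeff0[of "\<mu> a + i" "\<mu> a"] by (simp add: Ucomp coeff_sum)
    qed
    then show ?thesis by simp
  qed simp
  have "sum m (PiE (insert k I) (\<lambda>_. B)) = (\<Sum>a\<in>PiE I (\<lambda>_. B). \<Sum>\<beta>\<in>B. m (a(k := \<beta>)))"
    by (rule sum_PiE_insert[OF insert(2)])
  also have "\<dots> \<le> (\<Sum>a\<in>PiE I (\<lambda>_. B). card B * \<mu> a + t)"
  proof (rule sum_mono)
    fix a assume a: "a \<in> PiE I (\<lambda>_. B)"
    have "(\<Sum>\<beta>\<in>B. m (a(k := \<beta>))) \<le> (\<Sum>\<beta>\<in>B. \<mu> a + order \<beta> (U a))"
      by (rule sum_mono) (rule key[OF a])
    also have "\<dots> = card B * \<mu> a + (\<Sum>\<beta>\<in>B. order \<beta> (U a))"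
      by (simp add: sum.distrib)
    also have "(\<Sum>\<beta>\<in>B. order \<beta> (U a)) \<le> t"
      using sum_order_le[OF U0 assms(3)] U(2) by (rule order_trans)
    finally show "(\<Sum>\<beta>\<in>B. m (a(k := \<beta>))) \<le> card B * \<mu> a + t" by simp
  qed
  also have "\<dots> = card B * sum \<mu> (PiE I (\<lambda>_. B)) + t * card B ^ card I"
    using insert(1) by (simp add: sum.distrib sum_distrib_left card_PiE)
  also have "\<dots> \<le> (d - t) * card B ^ card I + t * card B ^ card I" using IH by simp
  also have "\<dots> = d * card B ^ card I" using t(1) by (simp add: add_mult_distrib[symmetric])
  finally show ?case using insert(1,2) by (simp add: mult.commute mult.left_commute)
qed

section \<open>Vanishing of the leading form\<close>

text \<open>Coefficients lie in the finite field, arguments in its polynomial ring. The ring is an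
  infinite domain, so polynomials are determined by their values, and it has room to encode
  \<open>r\<close> vectors over the field as one point.\<close>

definition peval :: "(('n::finite \<Rightarrow> nat) \<Rightarrow> 'f::field) \<Rightarrow> ('n \<Rightarrow> nat) set \<Rightarrow> ('n \<Rightarrow> 'f poly) \<Rightarrow> 'f poly"
  where "peval c A x = (\<Sum>\<alpha>\<in>A. [:c \<alpha>:] * (\<Prod>i\<in>UNIV. x i ^ \<alpha> i))"

definition exps :: "nat \<Rightarrow> ('n::finite \<Rightarrow> nat) set"
  where "exps d = {\<alpha>. sum \<alpha> UNIV \<le> d}"

lemma finite_exps [simp]: "finite (exps d :: ('n::finite \<Rightarrow> nat) set)"
proof (rule finite_subset)
  have "\<alpha> i \<le> d" if "\<alpha> \<in> exps d" for \<alpha> and i :: 'n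
    using member_le_sum[of i UNIV \<alpha>] that by (simp add: exps_def)
  then show "(exps d :: ('n \<Rightarrow> nat) set) \<subseteq> PiE UNIV (\<lambda>_. {..d})" by (auto simp: PiE_iff)
qed (rule finite_PiE, auto)

lemma infinite_UNIV_poly: "infinite (UNIV :: 'f::field poly set)"
proof
  assume "finite (UNIV :: 'f poly set)"
  then have "finite (range (\<lambda>n. monom (1::'f) n))" by (rule finite_subset[rotated]) simp
  then have "finite (UNIV :: nat set)"
    by (rule finite_imageD) (auto simp: inj_on_def monom_eq_iff')
  then show False by simp
qed

lemma polyfun_monomial:
  "polyfun UNIV (sum \<alpha> UNIV) (sum \<alpha> UNIV) (\<lambda>x :: 'n::finite \<Rightarrow> 'r::idom. \<Prod>i\<in>UNIV. x i ^ \<alpha> i)"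
proof (rule polyfun_prod)
  show "polyfun UNIV (\<alpha> i) (\<alpha> i) (\<lambda>x :: 'n \<Rightarrow> 'r. x i ^ \<alpha> i)" for i
    using polyfun_power[OF polyfun.var[of i UNIV], of "\<alpha> i"] by simp
qed simp

lemma polyfun_peval:
  assumes "\<And>\<alpha>. \<alpha> \<in> A \<Longrightarrow> c \<alpha> \<noteq> 0 \<Longrightarrow> l \<le> sum \<alpha> UNIV \<and> sum \<alpha> UNIV \<le> h"
  shows "polyfun UNIV l h (peval c A)"
proof -
  have "polyfun UNIV l h (\<lambda>x. \<Sum>\<alpha>\<in>A. [:c \<alpha>:] * (\<Prod>i\<in>UNIV. x i ^ \<alpha> i))"
  proof (rule polyfun_sum)
    fix \<alpha> assume \<alpha>: "\<alpha> \<in> A"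
    show "polyfun UNIV l h (\<lambda>x. [:c \<alpha>:] * (\<Prod>i\<in>UNIV. x i ^ \<alpha> i))"
    proof (cases "c \<alpha> = 0")
      case False
      from assms[OF \<alpha> False] show ?thesis
        by (intro polyfun_cmult polyfun.weaken[OF polyfun_monomial[of \<alpha>]]) auto
    qed (simp add: polyfun.zero)
  qed
  then show ?thesis by (simp add: peval_def[abs_def])
qed

lemma coeff_prod_top:
  fixes p :: "'i \<Rightarrow> 'r::idom poly"
  assumes "finite A" "\<And>i. i \<in> A \<Longrightarrow> degree (p i) \<le> h i"
  shows "degree (prod p A) \<le> sum h A \<and> coeff (prod p A) (sum h A) = (\<Prod>i\<in>A. coeff (p i) (h i))"
  using assms
proof (induction A)
  case (insert a A)
  let ?p = "p a" and ?q = "prod p A"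
  have IH: "degree ?q \<le> sum h A" "coeff ?q (sum h A) = (\<Prod>i\<in>A. coeff (p i) (h i))"
    using insert.IH insert.prems by auto
  have d: "degree ?p \<le> h a" "degree ?q \<le> sum h A" using insert.prems IH by auto
  have "coeff (?p * ?q) (h a + sum h A) = coeff ?p (h a) * coeff ?q (sum h A)"
  proof -
    have "coeff (?p * ?q) (h a + sum h A)
      = (\<Sum>i\<in>{h a}. coeff ?p i * coeff ?q (h a + sum h A - i))"
      unfolding coeff_mult
    proof (rule sum.mono_neutral_right)
      show "\<forall>i\<in>{..h a + sum h A} - {h a}. coeff ?p i * coeff ?q (h a + sum h A - i) = 0"
      proof
        fix i assume "i \<in> {..h a + sum h A} - {h a}"
        then consider "i > h a" | "i < h a" by force
        then show "coeff ?p i * coeff ?q (h a + sum h A - i) = 0"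
          by cases (use d in \<open>auto simp: coeff_eq_0\<close>)
      qed
    qed auto
    then show ?thesis by simp
  qed
  moreover have "degree (?p * ?q) \<le> h a + sum h A"
    using degree_mult_le[of ?p ?q] d by linarith
  ultimately show ?case using insert.hyps IH by simp
qed simp

lemma coeff_prod_power_top:
  fixes x y :: "'n::finite \<Rightarrow> 'r::idom"
  defines "p \<equiv> \<lambda>\<alpha>. \<Prod>i\<in>UNIV. [:y i, x i:] ^ \<alpha> i"
  shows "degree (p \<alpha>) \<le> sum \<alpha> UNIV" "coeff (p \<alpha>) (sum \<alpha> UNIV) = (\<Prod>i\<in>UNIV. x i ^ \<alpha> i)"
proof -
  have 1: "degree ([:y i, x i:] ^ k) \<le> k \<and> coeff ([:y i, x i:] ^ k) k = x i ^ k" for i k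
    using coeff_prod_top[of "{..<k}" "\<lambda>_. [:y i, x i:]" "\<lambda>_. 1"] by (simp del: power_Suc)
  have "degree (p \<alpha>) \<le> sum \<alpha> UNIV \<and>
      coeff (p \<alpha>) (sum \<alpha> UNIV) = (\<Prod>i\<in>UNIV. coeff ([:y i, x i:] ^ \<alpha> i) (\<alpha> i))"
    unfolding p_def by (rule coeff_prod_top) (use 1 in auto)
  then show "degree (p \<alpha>) \<le> sum \<alpha> UNIV" "coeff (p \<alpha>) (sum \<alpha> UNIV) = (\<Prod>i\<in>UNIV. x i ^ \<alpha> i)"
    using 1 by auto
qed

text \<open>Passing to the coefficient of \<open>\<theta> ^ d\<close> keeps only the monomials of
  degree \<open>d\<close> and removes the base point \<open>y\<close>; this is what makes all
  translates of a flat equivalent for the argument.\<close>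

lemma peval_top_form:
  fixes c :: "('n::finite \<Rightarrow> nat) \<Rightarrow> 'f::field"
  shows "\<exists>p. (\<forall>\<theta>. peval c (exps d) (\<lambda>i. y i + \<theta> * x i) = poly p \<theta>) \<and>
     coeff p d = peval c {\<alpha>. sum \<alpha> UNIV = d} x"
proof -
  define q where "q \<alpha> = (\<Prod>i\<in>UNIV. [:y i, x i:] ^ \<alpha> i)" for \<alpha>
  define p where "p = (\<Sum>\<alpha>\<in>exps d. Polynomial.smult [:c \<alpha>:] (q \<alpha>))"
  have "peval c (exps d) (\<lambda>i. y i + \<theta> * x i) = poly p \<theta>" for \<theta>
    by (simp add: p_def q_def peval_def poly_sum poly_prod poly_power)
  moreover have "coeff p d = (\<Sum>\<alpha>\<in>exps d. [:c \<alpha>:] * coeff (q \<alpha>) d)"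
    by (simp add: p_def coeff_sum)
  moreover have "\<dots> = (\<Sum>\<alpha>\<in>{\<alpha>. sum \<alpha> UNIV = d}. [:c \<alpha>:] * coeff (q \<alpha>) d)"
  proof (rule sum.mono_neutral_right)
    show "\<forall>\<alpha>\<in>exps d - {\<alpha>. sum \<alpha> UNIV = d}. [:c \<alpha>:] * coeff (q \<alpha>) d = 0"
    proof
      fix \<alpha> :: "'n \<Rightarrow> nat" assume "\<alpha> \<in> exps d - {\<alpha>. sum \<alpha> UNIV = d}"
      then have "sum \<alpha> UNIV < d" by (auto simp: exps_def)
      then have "degree (q \<alpha>) < d" using coeff_prod_power_top(1)[of y x \<alpha>] unfolding q_def
        by linarith
      then show "[:c \<alpha>:] * coeff (q \<alpha>) d = 0" by (simp add: coeff_eq_0)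
    qed
  qed (simp, auto simp: exps_def)
  moreover have "\<dots> = peval c {\<alpha>. sum \<alpha> UNIV = d} x"
    unfolding peval_def q_def by (rule sum.cong) (auto simp: coeff_prod_power_top(2))
  ultimately show ?thesis by auto
qed

text \<open>Fix a direction \<open>z\<close> and restrict the polynomial to the flat through
  \<open>a\<close> thickened by \<open>z\<close>. The coefficient of the \<open>j\<close>th power of
  the extra variable has degree at most \<open>d - j\<close> in the \<open>r\<close> flat
  coordinates, and at each of the \<open>q ^ r\<close> points of the flat it vanishes to order
  \<open>m - j\<close>. By \<open>big\<close> and the Schwartz--Zippel bound on that small grid it
  is zero for \<open>j < s\<close>. On the thickened flat only powers at least \<open>s\<close>
  remain, and the leading form inherits this at the point with flat coordinates 1, t, t^2, and so
  on.\<close>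

lemma leading_form_vanishes:
  fixes c :: "('n::finite \<Rightarrow> nat) \<Rightarrow> 'f::{field,finite}" and m :: "('n \<Rightarrow> 'f) \<Rightarrow> nat"
    and w :: "nat \<Rightarrow> 'n \<Rightarrow> 'f" and a :: "'n \<Rightarrow> 'f" and r :: nat
  defines "q \<equiv> CARD('f)"
  defines "comb \<equiv> \<lambda>T i. a i + (\<Sum>l<r. T l * w l i)"
  assumes van: "\<And>y. polyfun UNIV (m y) d (\<lambda>x. peval c (exps d) (\<lambda>i. [:y i:] + x i))"
    and big: "d * q ^ r + s * q ^ (r + 1) < q * (\<Sum>T\<in>PiE {..<r} (\<lambda>_. UNIV). m (comb T))"
  shows "vanishes_to (peval c {\<alpha>. sum \<alpha> UNIV = d}) (\<lambda>i. \<Sum>l<r. monom (w l i) l) s"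
proof -
  note inf = infinite_UNIV_poly[where 'f = 'f]
  define P where "P = peval c (exps d)"
  define H where "H = peval c {\<alpha>. sum \<alpha> UNIV = d}"
  define b where "b i = (\<Sum>l<r. monom (w l i) l)" for i
  have "\<exists>q. \<forall>u. H (\<lambda>i. b i + u * z i) = u ^ s * poly q u" for z
  proof -
    define X where "X x i = (\<Sum>l<r. x l * [:w l i:]) + x r * z i" for x :: "nat \<Rightarrow> 'f poly" and i
    have lin: "polyfun {..r} 1 1 (\<lambda>x. X x i)" for i
      unfolding X_def
    proof (intro polyfun.add polyfun_sum)
      show "polyfun {..r} 1 1 (\<lambda>x. x l * [:w l i:])" if "l \<in> {..<r}" for l
        using polyfun_cmult[OF polyfun.var[of l "{..r}"], of "[:w l i:]"] that
        by (simp add: mult.commute)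
      show "polyfun {..r} 1 1 (\<lambda>x. x r * z i)"
        using polyfun_cmult[OF polyfun.var[of r "{..r}"], of "z i"] by (simp add: mult.commute)
    qed
    have subst: "polyfun (insert r {..<r}) (m y) d (\<lambda>x. P (\<lambda>i. [:y i:] + X x i))" for y
      using polyfun_subst[OF van[of y], of "{..r}" 1 X] lin
      by (simp add: P_def lessThan_Suc_atMost[symmetric] lessThan_Suc)
    obtain g where g: "\<And>x. P (\<lambda>i. [:a i:] + X x i) = (\<Sum>j\<le>d. g j x * x r ^ j)"
        "\<And>j. polyfun {..<r} 0 (d - j) (g j)"
      using polyfun_slice[OF polyfun.weaken[OF subst[of a], of 0 d]] by auto
    have g0: "g j x = 0" if j: "j < s" "j \<le> d" for j x
    proof (rule ccontr)
      assume nz: "g j x \<noteq> 0"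
      define B where "B = range (\<lambda>a :: 'f. [:a:])"
      have cardB: "card B = q" unfolding B_def q_def by (intro card_image) (auto simp: inj_on_def)
      \<comment> \<open>Taking the coefficient of the \<open>j\<close>th power of the extra variable
        lowers the order of vanishing by at most \<open>j\<close>.\<close>
      define m' where "m' T = m (comb (\<lambda>l. coeff (T l) 0)) - j" for T
      have "card B * sum m' (PiE {..<r} (\<lambda>_. B)) \<le> (d - j) * card B ^ card {..<r}"
      proof (rule Schwartz_Zippel_multiplicity[OF inf _ _ g(2) nz])
        fix T assume T: "T \<in> PiE {..<r} (\<lambda>_. B)"
        define y where "y = comb (\<lambda>l. coeff (T l) 0)"
        have Tl: "[:coeff (T l) 0:] = T l" if "l < r" for l
          using T that by (auto simp: B_def PiE_def Pi_def)
        obtain g' where g': "\<And>x. P (\<lambda>i. [:y i:] + X x i) = (\<Sum>j\<le>d. g' j x * x r ^ j)"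
            "\<And>j. polyfun {..<r} (m y - j) (d - j) (g' j)"
          using polyfun_slice[OF subst[of y]] by auto
        \<comment> \<open>\<open>g\<close> and \<open>g'\<close> slice the same polynomial with base
          points \<open>a\<close> and \<open>y\<close>. As \<open>y\<close> lies on the flat through
          \<open>a\<close>, they differ only by the shift \<open>T\<close> of the flat
          coordinates.\<close>
        have gg': "g j (\<lambda>l. T l + x l) = g' j x" for x
        proof -
          have "(\<Sum>j\<le>d. monom (g j (\<lambda>l. T l + x l)) j) = (\<Sum>j\<le>d. monom (g' j x) j)"
          proof (rule poly_eq_if_infinite[OF inf])
            fix v
            define x' where "x' = (\<lambda>l. T l + x l)(r := v)"
            have "(\<Sum>j\<le>d. g j (\<lambda>l. T l + x l) * v ^ j) = (\<Sum>j\<le>d. g j x' * x' r ^ j)"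
              by (intro sum.cong refl arg_cong2[of _ _ _ _ "(*)"] polyfun_cong[OF g(2)])
                (simp_all add: x'_def)
            also have "\<dots> = P (\<lambda>i. [:a i:] + X x' i)" by (simp add: g)
            also have "(\<lambda>i. [:a i:] + X x' i) = (\<lambda>i. [:y i:] + X (x(r := v)) i)"
            proof
              fix i
              have "(\<Sum>l<r. x' l * [:w l i:])
                = (\<Sum>l<r. [:coeff (T l) 0 * w l i:]) + (\<Sum>l<r. x l * [:w l i:])"
                unfolding sum.distrib[symmetric]
              proof (intro sum.cong refl)
                fix l assume "l \<in> {..<r}"
                then have "x' l = [:coeff (T l) 0:] + x l" using Tl by (simp add: x'_def)
                then show "x' l * [:w l i:] = [:coeff (T l) 0 * w l i:] + x l * [:w l i:]"
                  by (simp add: smult_add_right mult.commute)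
              qed
              moreover have "[:y i:] = [:a i:] + (\<Sum>l<r. [:coeff (T l) 0 * w l i:])"
                by (simp add: y_def comb_def sum_to_poly)
              ultimately show "[:a i:] + X x' i = [:y i:] + X (x(r := v)) i"
                by (simp add: X_def x'_def)
            qed
            also have "P \<dots> = (\<Sum>j\<le>d. g' j (x(r := v)) * v ^ j)" by (simp add: g')
            also have "\<dots> = (\<Sum>j\<le>d. g' j x * v ^ j)"
              by (intro sum.cong refl arg_cong2[of _ _ _ _ "(*)"] polyfun_cong[OF g'(2)]) auto
            finally show "poly (\<Sum>j\<le>d. monom (g j (\<lambda>l. T l + x l)) j) v
              = poly (\<Sum>j\<le>d. monom (g' j x) j) v"
              by (simp add: poly_sum poly_monom)
          qed
          then have "coeff (\<Sum>j\<le>d. monom (g j (\<lambda>l. T l + x l)) j) j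
            = coeff (\<Sum>j\<le>d. monom (g' j x) j) j"
            by simp
          then show ?thesis using j(2) by (simp add: coeff_sum)
        qed
        have "\<forall>z. \<exists>p. (\<forall>u. g' j (\<lambda>i. u * z i) = poly p u) \<and> (\<forall>i. coeff p i \<noteq> 0 \<longrightarrow> m y - j \<le> i \<and> i
          \<le> d - j)"
          using polyfun_line[OF g'(2)] by blast
        then obtain p where p: "\<And>z u. g' j (\<lambda>i. u * z i) = poly (p z) u"
          "\<And>z i. i < m y - j \<Longrightarrow> coeff (p z) i = 0" by (metis not_le)
        then show "vanishes_to (g j) T (m' T)"
          using vanishes_to_iff_coeff[OF inf, of "g j" T p "m' T"] by (simp add: gg' m'_def y_def)
      qed (auto simp: B_def)
      moreover have "sum m' (PiE {..<r} (\<lambda>_. B)) = (\<Sum>T\<in>PiE {..<r} (\<lambda>_. UNIV). m (comb T) - j)"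
      proof (rule sum.reindex_bij_witness[where i = "\<lambda>T. \<lambda>l\<in>{..<r}. [:T l:]" and j
        = "\<lambda>T. \<lambda>l\<in>{..<r}. coeff (T l) 0"])
        fix T assume T: "T \<in> PiE {..<r} (\<lambda>_. B)"
        have Tl: "[:coeff (T l) 0:] = T l" if "l < r" for l
          using T that by (auto simp: B_def PiE_def Pi_def)
        show "(\<lambda>l\<in>{..<r}. [:(\<lambda>l\<in>{..<r}. coeff (T l) 0) l:]) = T"
          using T Tl by (intro ext) (auto simp: restrict_def PiE_def extensional_def)
        show "m (comb (\<lambda>l\<in>{..<r}. coeff (T l) 0)) - j = m' T"
          by (simp add: m'_def comb_def)
      qed (auto simp: B_def restrict_def PiE_def extensional_def fun_eq_iff)
      ultimately have 1: "q * (\<Sum>T\<in>PiE {..<r} (\<lambda>_. UNIV). m (comb T) - j) \<le> (d - j) * q ^ r"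
        by (simp add: cardB)
      \<comment> \<open>Lowering each multiplicity by \<open>j\<close> loses at most
        \<open>j * q ^ r\<close> in total, which the term \<open>s * q ^ (r + 1)\<close> of
        \<open>big\<close> covers since \<open>j < s\<close>.\<close>
      have "(\<Sum>T\<in>PiE {..<r} (\<lambda>_. UNIV). m (comb T))
          \<le> (\<Sum>T\<in>PiE {..<r} (\<lambda>_. UNIV :: 'f set). (m (comb T) - j) + j)"
        by (rule sum_mono) simp
      also have "\<dots> = (\<Sum>T\<in>PiE {..<r} (\<lambda>_. UNIV). m (comb T) - j) + j * q ^ r"
        by (simp add: sum.distrib card_PiE q_def)
      finally have "q * (\<Sum>T\<in>PiE {..<r} (\<lambda>_. UNIV). m (comb T))
          \<le> q * ((\<Sum>T\<in>PiE {..<r} (\<lambda>_. UNIV). m (comb T) - j) + j * q ^ r)"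
        by (rule mult_le_mono2)
      also have "\<dots> \<le> (d - j) * q ^ r + q * (j * q ^ r)" using 1 by (simp add: distrib_left)
      also have "\<dots> \<le> d * q ^ r + s * q ^ (r + 1)"
      proof -
        have "q * (j * q ^ r) \<le> s * q ^ (r + 1)" using j(1) by simp
        moreover have "(d - j) * q ^ r \<le> d * q ^ r" by simp
        ultimately show ?thesis by linarith
      qed
      finally show False using big by simp
    qed
    \<comment> \<open>The flat coordinates of the encoding: the vector \<open>w l\<close> is
      multiplied by t^l.\<close>
    define x0 where "x0 = (\<lambda>l. monom (1 :: 'f) l)"
    have "\<forall>j. \<exists>p. (\<forall>u. g j (\<lambda>i. u * x0 i) = poly p u) \<and> (\<forall>i. coeff p i \<noteq> 0 \<longrightarrow> 0 \<le> i \<and> i \<le> d - j)"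
      using polyfun_line[OF g(2)] by blast
    then obtain p where p: "\<And>j u. g j (\<lambda>i. u * x0 i) = poly (p j) u"
      "\<And>j i. coeff (p j) i \<noteq> 0 \<Longrightarrow> i \<le> d - j" by metis
    have p0: "p j = 0" if "j < s" "j \<le> d" for j
      by (rule poly_eq_if_infinite[OF inf]) (simp add: p(1)[symmetric] g0[OF that])
    \<comment> \<open>The coefficient of \<open>\<theta> ^ d\<close> at flat coordinates
      \<open>\<theta> * x0 l\<close> and extra coordinate \<open>\<theta> * u\<close>: slice
      \<open>j\<close> contributes \<open>u ^ j\<close> times its own coefficient of degree
      \<open>d - j\<close>.\<close>
    define L where "L = (\<Sum>j\<le>d. monom (coeff (p j) (d - j)) j)"
    have "H (\<lambda>i. b i + u * z i) = poly L u" for u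
    proof -
      obtain h where h: "\<And>\<theta>. P (\<lambda>i. [:a i:] + \<theta> * (b i + u * z i)) = poly h \<theta>"
        "coeff h d = H (\<lambda>i. b i + u * z i)"
        unfolding P_def H_def
        using peval_top_form[of c d "\<lambda>i. [:a i:]" "\<lambda>i. b i + u * z i"] by blast
      have "h = (\<Sum>j\<le>d. p j * monom (u ^ j) j)"
      proof (rule poly_eq_if_infinite[OF inf])
        fix \<theta>
        define x where "x = (\<lambda>l. \<theta> * x0 l)(r := \<theta> * u)"
        have "X x i = \<theta> * (b i + u * z i)" for i
        proof -
          have "(\<Sum>l<r. x l * [:w l i:]) = \<theta> * b i"
            unfolding b_def sum_distrib_left
          proof (intro sum.cong refl)
            fix l assume "l \<in> {..<r}"
            then have "x l * [:w l i:] = Polynomial.smult (w l i) (\<theta> * monom 1 l)"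
              by (simp add: x_def x0_def)
            also have "\<dots> = \<theta> * Polynomial.smult (w l i) (monom 1 l)" by simp
            also have "Polynomial.smult (w l i) (monom 1 l) = monom (w l i) l"
              by (simp add: smult_monom)
            finally show "x l * [:w l i:] = \<theta> * monom (w l i) l" .
          qed
          then show ?thesis by (simp add: X_def x_def distrib_left mult.assoc)
        qed
        then have "poly h \<theta> = (\<Sum>j\<le>d. g j x * x r ^ j)"
          by (simp add: h(1)[symmetric] g(1)[symmetric])
        also have "\<dots> = (\<Sum>j\<le>d. g j (\<lambda>l. \<theta> * x0 l) * (\<theta> * u) ^ j)"
          by (intro sum.cong refl arg_cong2[of _ _ _ _ "(*)"] polyfun_cong[OF g(2)])
            (auto simp: x_def)
        also have "\<dots> = poly (\<Sum>j\<le>d. p j * monom (u ^ j) j) \<theta>"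
          by (simp add: p(1) poly_sum poly_monom power_mult_distrib mult_ac)
        finally show "poly h \<theta> = poly (\<Sum>j\<le>d. p j * monom (u ^ j) j) \<theta>" .
      qed
      then have "H (\<lambda>i. b i + u * z i) = (\<Sum>j\<le>d. coeff (monom (u ^ j) j * p j) d)"
        by (simp add: h(2)[symmetric] coeff_sum mult.commute)
      also have "\<dots> = (\<Sum>j\<le>d. u ^ j * coeff (p j) (d - j))"
        by (intro sum.cong refl) (simp add: coeff_monom_mult)
      finally show ?thesis by (simp add: L_def poly_sum poly_monom mult.commute)
    qed
    moreover have "monom 1 s dvd L"
      unfolding monom_1_dvd_iff' by (auto simp: L_def coeff_sum p0)
    ultimately show ?thesis by (auto simp: dvd_def poly_monom)
  qed
  then show ?thesis unfolding vanishes_to_def H_def b_def by blast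
qed

section \<open>Polynomials with prescribed multiplicities\<close>

text \<open>Stars and bars: one exponent is split off and the resulting binomials are summed along a
  diagonal. Extensional functions on a finite index set make the number of variables accessible to
  induction.\<close>

lemma card_exps_aux:
  assumes "finite I"
  shows "card {\<alpha> \<in> PiE I (\<lambda>_. UNIV :: nat set). sum \<alpha> I \<le> d} = (d + card I) choose card I
    \<and> finite {\<alpha> \<in> PiE I (\<lambda>_. UNIV :: nat set). sum \<alpha> I \<le> d}"
  using assms
proof (induction I arbitrary: d)
  case empty
  have "{\<alpha> \<in> PiE {} (\<lambda>_. UNIV :: nat set). sum \<alpha> {} \<le> d} = {\<lambda>_. undefined}" by auto
  then show ?case by simp
next
  case (insert k I)
  let ?E = "\<lambda>I d. {\<alpha> \<in> PiE I (\<lambda>_. UNIV :: nat set). sum \<alpha> I \<le> d}"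
  have bij: "bij_betw (\<lambda>(j, \<alpha>). \<alpha>(k := j)) (SIGMA j:{..d}. ?E I (d - j)) (?E (insert k I) d)"
  proof (rule bij_betw_byWitness[where f' = "\<lambda>\<alpha>. (\<alpha> k, \<alpha>(k := undefined))"])
    have upd: "sum (\<alpha>(k := j)) I = sum \<alpha> I" for \<alpha> :: "'a \<Rightarrow> nat" and j
      using insert(2) by (intro sum.cong) auto
    show "\<forall>a\<in>SIGMA j:{..d}. ?E I (d - j). (case case a of (j, \<alpha>) \<Rightarrow> \<alpha>(k := j) of \<alpha> \<Rightarrow>
      (\<alpha> k, \<alpha>(k := undefined))) = a"
      using insert(2) by (auto simp: PiE_def extensional_def fun_eq_iff)
    show "(\<lambda>(j, \<alpha>). \<alpha>(k := j)) ` (SIGMA j:{..d}. ?E I (d - j)) \<subseteq> ?E (insert k I) d"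
      using insert(1,2) upd by (auto simp: PiE_def extensional_def)
    show "(\<lambda>\<alpha>. (\<alpha> k, \<alpha>(k := undefined))) ` ?E (insert k I) d \<subseteq> (SIGMA j:{..d}. ?E I (d - j))"
      using insert(1,2) upd by (auto simp: PiE_def extensional_def)
  qed auto
  have fin: "finite (SIGMA j:{..d}. ?E I (d - j))" using insert(3) by (intro finite_SigmaI) auto
  have "card (?E (insert k I) d) = card (SIGMA j:{..d}. ?E I (d - j))"
    using bij_betw_same_card[OF bij] by simp
  also have "\<dots> = (\<Sum>j\<le>d. card (?E I (d - j)))" using insert(3) by (intro card_SigmaI) auto
  also have "\<dots> = (\<Sum>j\<le>d. (d - j + card I) choose card I)" using insert(3) by simp
  also have "\<dots> = (\<Sum>j\<le>d. (card I + (d - j)) choose (d - j))"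
  proof (rule sum.cong[OF refl])
    fix j
    show "(d - j + card I) choose card I = (card I + (d - j)) choose (d - j)"
      using binomial_symmetric[of "card I" "card I + (d - j)"] by (simp add: add.commute)
  qed
  also have "\<dots> = (\<Sum>j\<le>d. (card I + j) choose j)"
    by (rule sum.reindex_bij_witness[where i = "\<lambda>j. d - j" and j = "\<lambda>j. d - j"]) auto
  also have "\<dots> = Suc (card I + d) choose d" by (rule sum_choose_lower)
  also have "\<dots> = (d + card (insert k I)) choose card (insert k I)"
    using insert(1,2) binomial_symmetric[of d "Suc (card I + d)"] by (simp add: add.commute)
  finally show ?case using bij_betw_finite[OF bij] fin by simp
qed

lemma card_exps: "card (exps d :: ('n::finite \<Rightarrow> nat) set) = (d + CARD('n)) choose CARD('n)"
  using card_exps_aux[of "UNIV :: 'n set" d] by (simp add: exps_def PiE_UNIV_domain)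

lemma fact_le_fact_add: "(d + 1) ^ n * fact d \<le> (fact (d + n) :: nat)"
proof (induction n)
  case (Suc n)
  have "(d + 1) ^ Suc n * fact d = (d + 1) * ((d + 1) ^ n * fact d)"
    by (simp only: power_Suc mult.assoc)
  also have "\<dots> \<le> (d + Suc n) * fact (d + n)" by (rule mult_le_mono) (use Suc in auto)
  finally show ?case by simp
qed simp

text \<open>Together with \<open>card_exps_le_power\<close> this brackets the count, up to the
  common factor n!, by \<open>n\<close>th powers whose bases differ by less than \<open>n\<close>;
  such additive errors disappear as the multiplicities grow.\<close>

lemma power_le_card_exps:
  "(d + 1) ^ CARD('n) \<le> fact CARD('n) * card (exps d :: ('n::finite \<Rightarrow> nat) set)"
proof -
  let ?n = "CARD('n)"
  have "fact ?n * fact d * ((d + ?n) choose ?n) = fact (d + ?n)"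
    using binomial_fact_lemma[of ?n "d + ?n"] by simp
  then have "(d + 1) ^ ?n * fact d \<le> fact ?n * card (exps d :: ('n \<Rightarrow> nat) set) * fact d"
    using fact_le_fact_add[of d ?n] by (simp add: card_exps mult_ac)
  then show ?thesis by simp
qed

lemma card_exps_le_power:
  "fact CARD('n) * card (exps d :: ('n::finite \<Rightarrow> nat) set) \<le> (d + CARD('n)) ^ CARD('n)"
  unfolding card_exps using binomial_fact_pow[of "d + CARD('n)" "CARD('n)"]
    by (simp add: mult.commute)

text \<open>Kronecker substitution: with suitable weights the exponent vectors are recovered from one number.\<close>

lemma ex_separating_weights:
  assumes "finite I"
  shows "\<exists>e :: 'i \<Rightarrow> nat. \<forall>\<alpha> \<beta>. (\<forall>i\<in>I. \<alpha> i < N \<and> \<beta> i < N) \<and> (\<Sum>i\<in>I. \<alpha> i * e i) = (\<Sum>i\<in>I. \<beta> i * e i)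
    \<longrightarrow> (\<forall>i\<in>I. \<alpha> i = (\<beta> i :: nat))"
  using assms
proof (induction I)
  case (insert k I)
  then obtain e :: "'i \<Rightarrow> nat" where e: "\<And>\<alpha> \<beta>. (\<forall>i\<in>I. \<alpha> i < N \<and> \<beta> i < N) \<Longrightarrow>
      (\<Sum>i\<in>I. \<alpha> i * e i) = (\<Sum>i\<in>I. \<beta> i * e i) \<Longrightarrow> \<forall>i\<in>I. \<alpha> i = (\<beta> i :: nat)" by blast
  \<comment> \<open>Digits in base \<open>N\<close>: the new variable gets weight \<open>1\<close>
    and the old weights are multiplied by \<open>N\<close>, so the residue modulo \<open>N\<close>
    recovers the new exponent.\<close>
  define e' where "e' i = (if i = k then 1 else N * e i)" for i
  have sum_eq: "(\<Sum>i\<in>insert k I. \<alpha> i * e' i) = \<alpha> k + N * (\<Sum>i\<in>I. \<alpha> i * e i)" for \<alpha> :: "'i \<Rightarrow> nat"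
  proof -
    have "(\<Sum>i\<in>I. \<alpha> i * e' i) = (\<Sum>i\<in>I. N * (\<alpha> i * e i))"
      using insert(2) by (intro sum.cong) (auto simp: e'_def)
    then show ?thesis using insert(1,2) by (simp add: e'_def sum_distrib_left)
  qed
  have "\<forall>i\<in>insert k I. \<alpha> i = \<beta> i"
    if "\<forall>i\<in>insert k I. \<alpha> i < N \<and> \<beta> i < N" "(\<Sum>i\<in>insert k I. \<alpha> i * e' i)
      = (\<Sum>i\<in>insert k I. \<beta> i * e' i)"
    for \<alpha> \<beta> :: "'i \<Rightarrow> nat"
  proof -
    have eq: "\<alpha> k + N * (\<Sum>i\<in>I. \<alpha> i * e i) = \<beta> k + N * (\<Sum>i\<in>I. \<beta> i * e i)"
      using that(2) unfolding sum_eq .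
    have lt: "\<alpha> k < N" "\<beta> k < N" using that(1) by auto
    have "\<alpha> k = \<beta> k" using arg_cong[OF eq, of "\<lambda>x. x mod N"] lt by simp
    moreover have "(\<Sum>i\<in>I. \<alpha> i * e i) = (\<Sum>i\<in>I. \<beta> i * e i)" using eq calculation lt by simp
    moreover from this have "\<forall>i\<in>I. \<alpha> i = \<beta> i" by (intro e) (use that(1) in simp_all)
    ultimately show ?thesis by simp
  qed
  then show ?case by blast
qed auto

text \<open>A nonzero polynomial may vanish on all of a finite field, but not on its polynomial
  ring: at suitable powers of t distinct monomials take distinct powers of t as values and cannot
  cancel.\<close>

lemma peval_nonzero:
  fixes c :: "('n::finite \<Rightarrow> nat) \<Rightarrow> 'f::field"
  assumes "finite A" "\<alpha>0 \<in> A" "c \<alpha>0 \<noteq> 0"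
  shows "\<exists>x. peval c A x \<noteq> 0"
proof -
  define N where "N = Suc (\<Sum>\<alpha>\<in>A. sum \<alpha> UNIV)"
  have lt: "\<alpha> i < N" if "\<alpha> \<in> A" for \<alpha> i
  proof -
    have "\<alpha> i \<le> sum \<alpha> UNIV" by (rule member_le_sum) auto
    also have "\<dots> \<le> (\<Sum>\<alpha>\<in>A. sum \<alpha> UNIV)"
      using member_le_sum[of \<alpha> A "\<lambda>\<alpha>. sum \<alpha> UNIV"] that assms(1) by auto
    finally show ?thesis by (simp add: N_def)
  qed
  obtain e :: "'n \<Rightarrow> nat" where e: "\<And>\<alpha> \<beta>. (\<forall>i. \<alpha> i < N \<and> \<beta> i < N) \<Longrightarrow>
      (\<Sum>i\<in>UNIV. \<alpha> i * e i) = (\<Sum>i\<in>UNIV. \<beta> i * e i) \<Longrightarrow> (\<forall>i. \<alpha> i = (\<beta> i :: nat))"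
    using ex_separating_weights[of "UNIV :: 'n set" N]
      by (simp only: finite UNIV_I ball_simps simp_thms) blast
  define E where "E \<alpha> = (\<Sum>i\<in>UNIV. \<alpha> i * e i)" for \<alpha>
  have mono: "(\<Prod>i\<in>UNIV. monom (1::'f) (e i) ^ \<alpha> i) = monom 1 (E \<alpha>)" for \<alpha>
  proof -
    have "(\<Prod>i\<in>I. monom (1::'f) (e i) ^ \<alpha> i) = monom 1 (\<Sum>i\<in>I. \<alpha> i * e i)" if "finite I" for I
      using that by induction (simp_all add: monom_power mult_monom mult.commute)
    then show ?thesis by (simp add: E_def)
  qed
  have E_inj: "E \<alpha> = E \<alpha>0 \<longleftrightarrow> \<alpha> = \<alpha>0" if "\<alpha> \<in> A" for \<alpha>
    using e[of \<alpha> \<alpha>0] lt that assms(2) by (auto simp: E_def fun_eq_iff)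
  have "coeff (peval c A (\<lambda>i. monom 1 (e i))) (E \<alpha>0) = (\<Sum>\<alpha>\<in>A. if \<alpha> = \<alpha>0 then c \<alpha> else 0)"
    unfolding peval_def coeff_sum mono by (intro sum.cong) (auto simp: E_inj)
  also have "\<dots> = c \<alpha>0" using assms(1,2) by simp
  finally show ?thesis using assms(3) by (metis coeff_0)
qed

text \<open>The Hasse derivative of order \<open>\<beta>\<close> at \<open>y\<close>: binomial
  coefficients in place of factorials keep it meaningful in positive characteristic.\<close>

definition shift_coeff :: "nat \<Rightarrow> (('n::finite \<Rightarrow> nat) \<Rightarrow> 'f::field) \<Rightarrow> ('n \<Rightarrow> 'f) \<Rightarrow> ('n \<Rightarrow> nat) \<Rightarrow> 'f"
  where "shift_coeff d c y \<beta>
    = (\<Sum>\<alpha>\<in>exps d. c \<alpha> * (\<Prod>i\<in>UNIV. of_nat (\<alpha> i choose \<beta> i) * y i ^ (\<alpha> i - \<beta> i)))"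

lemma peval_shift:
  fixes c :: "('n::finite \<Rightarrow> nat) \<Rightarrow> 'f::field"
  shows "peval c (exps d) (\<lambda>i. [:y i:] + x i) = peval (shift_coeff d c y) (exps d) x"
proof -
  define B where "B \<alpha> \<beta>
    = (\<Prod>i\<in>UNIV. of_nat (\<alpha> i choose \<beta> i) * y i ^ (\<alpha> i - \<beta> i))" for \<alpha> \<beta> :: "'n \<Rightarrow> nat"
  define X where "X \<beta> = (\<Prod>i\<in>UNIV. x i ^ \<beta> i)" for \<beta>
  have expand: "(\<Prod>i\<in>UNIV. ([:y i:] + x i) ^ \<alpha> i)
      = (\<Sum>\<beta>\<in>exps d. [:B \<alpha> \<beta>:] * X \<beta>)"
    if \<alpha>: "\<alpha> \<in> exps d" for \<alpha>
  proof -
    have le: "\<alpha> i \<le> d" for i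
      using member_le_sum[of i UNIV \<alpha>] \<alpha> by (simp add: exps_def)
    have const: "[:\<Prod>i\<in>I. h i:] = (\<Prod>i\<in>I. [:h i:])" for h :: "'n \<Rightarrow> 'f" and I
    proof (induction I rule: infinite_finite_induct)
      case (insert i I)
      have "[:\<Prod>i\<in>insert i I. h i:] = [:h i:] * [:\<Prod>i\<in>I. h i:]" using insert(1,2) by simp
      then show ?case unfolding insert(3) using insert(1,2) by simp
    qed (simp_all add: one_pCons)
    have "([:y i:] + x i) ^ \<alpha> i
      = (\<Sum>b\<le>d. [:of_nat (\<alpha> i choose b) * y i ^ (\<alpha> i - b):] * x i ^ b)" for i
    proof -
      have "(x i + [:y i:]) ^ \<alpha> i = (\<Sum>b\<le>\<alpha> i. of_nat (\<alpha> i choose b) * x i ^ b * [:y i:] ^ (\<alpha> i - b))"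
        by (rule binomial_ring)
      also have "\<dots> = (\<Sum>b\<le>\<alpha> i. [:of_nat (\<alpha> i choose b) * y i ^ (\<alpha> i - b):] * x i ^ b)"
      proof (rule sum.cong[OF refl])
        fix b
        have "[:of_nat (\<alpha> i choose b) * y i ^ (\<alpha> i - b):]
          = of_nat (\<alpha> i choose b) * [:y i:] ^ (\<alpha> i - b)"
          by (simp add: of_nat_poly poly_const_pow)
        then show "of_nat (\<alpha> i choose b) * x i ^ b * [:y i:] ^ (\<alpha> i - b)
            = [:of_nat (\<alpha> i choose b) * y i ^ (\<alpha> i - b):] * x i ^ b" by (simp only: mult_ac)
      qed
      also have "\<dots> = (\<Sum>b\<le>d. [:of_nat (\<alpha> i choose b) * y i ^ (\<alpha> i - b):] * x i ^ b)"
        by (rule sum.mono_neutral_left) (use le[of i] in \<open>auto simp: binomial_eq_0\<close>)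
      finally show ?thesis by (simp add: add.commute)
    qed
    then have "(\<Prod>i\<in>UNIV. ([:y i:] + x i) ^ \<alpha> i)
      = (\<Prod>i\<in>UNIV. \<Sum>b\<le>d. [:of_nat (\<alpha> i choose b) * y i ^ (\<alpha> i - b):] * x i ^ b)" by simp
    also have "\<dots>
      = (\<Sum>\<beta>\<in>PiE UNIV (\<lambda>_. {..d}). \<Prod>i\<in>UNIV. [:of_nat (\<alpha> i choose \<beta> i) * y i ^ (\<alpha> i - \<beta> i):]
        * x i ^ \<beta> i)"
      by (rule prod_sum_PiE) auto
    also have "\<dots> = (\<Sum>\<beta>\<in>PiE UNIV (\<lambda>_. {..d}). [:B \<alpha> \<beta>:] * X \<beta>)"
      unfolding B_def X_def const by (intro sum.cong refl prod.distrib)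
    also have "\<dots> = (\<Sum>\<beta>\<in>exps d. [:B \<alpha> \<beta>:] * X \<beta>)"
    proof (rule sum.mono_neutral_right)
      show "exps d \<subseteq> (PiE UNIV (\<lambda>_. {..d}) :: ('n \<Rightarrow> nat) set)"
      proof
        fix \<beta> :: "'n \<Rightarrow> nat" assume "\<beta> \<in> exps d"
        then have "\<beta> i \<le> d" for i
          using member_le_sum[of i UNIV \<beta>] by (simp add: exps_def)
        then show "\<beta> \<in> PiE UNIV (\<lambda>_. {..d})" by auto
      qed
      show "\<forall>\<beta>\<in>PiE UNIV (\<lambda>_. {..d}) - exps d.
        [:B \<alpha> \<beta>:] * X \<beta> = 0"
      proof
        fix \<beta> :: "'n \<Rightarrow> nat" assume "\<beta> \<in> PiE UNIV (\<lambda>_. {..d}) - exps d"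
        then have "\<not> (\<forall>i. \<beta> i \<le> \<alpha> i)"
          using sum_mono[of UNIV \<beta> \<alpha>] \<alpha> by (auto simp: exps_def)
        then obtain i where "\<alpha> i < \<beta> i" by (auto simp: not_le)
        then have "B \<alpha> \<beta> = 0" unfolding B_def
          by (intro prod_zero finite bexI[of _ i]) (simp_all add: binomial_eq_0)
        then show "[:B \<alpha> \<beta>:] * X \<beta> = 0"
          by simp
      qed
    qed (auto intro: finite_PiE)
    finally show ?thesis .
  qed
  have const_sum: "[:\<Sum>\<alpha>\<in>I. h \<alpha>:] = (\<Sum>\<alpha>\<in>I. [:h \<alpha>:])" for h :: "('n \<Rightarrow> nat) \<Rightarrow> 'f" and I
    by (simp add: sum_to_poly)
  have "peval c (exps d) (\<lambda>i. [:y i:] + x i)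
      = (\<Sum>\<alpha>\<in>exps d. \<Sum>\<beta>\<in>exps d. [:c \<alpha>:] * ([:B \<alpha> \<beta>:] * X \<beta>))"
    unfolding peval_def by (intro sum.cong refl) (simp only: expand sum_distrib_left B_def)
  also have "\<dots> = (\<Sum>\<beta>\<in>exps d. \<Sum>\<alpha>\<in>exps d. [:c \<alpha>:] * ([:B \<alpha> \<beta>:] * X \<beta>))"
    by (rule sum.swap)
  also have "\<dots> = (\<Sum>\<beta>\<in>exps d. [:\<Sum>\<alpha>\<in>exps d. c \<alpha> * B \<alpha> \<beta>:] * X \<beta>)"
    unfolding const_sum sum_distrib_right by (intro sum.cong refl) (simp add: mult_ac)
  finally show ?thesis by (simp add: peval_def shift_coeff_def B_def X_def)
qed

text \<open>Linear algebra by pigeonhole: with more coefficients than conditions, two coefficient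
  vectors share all prescribed derivatives, and their difference is the polynomial. Positivity of
  \<open>m y\<close> makes \<open>exps (m y - 1)\<close> exactly the set of orders below
  \<open>m y\<close>.\<close>

lemma ex_vanishing_polynomial:
  fixes m :: "('n::finite \<Rightarrow> 'f::{field,finite}) \<Rightarrow> nat"
  assumes pos: "\<And>y. m y > 0"
    and count: "(\<Sum>y\<in>UNIV. card (exps (m y - 1) :: ('n \<Rightarrow> nat) set))
      < card (exps d :: ('n \<Rightarrow> nat) set)"
  shows "\<exists>(c :: ('n \<Rightarrow> nat) \<Rightarrow> 'f) D. D \<le> d \<and> (\<exists>\<alpha>. sum \<alpha> UNIV = D \<and> c \<alpha> \<noteq> 0) \<and>
    (\<forall>y. polyfun UNIV (m y) D (\<lambda>x. peval c (exps D) (\<lambda>i. [:y i:] + x i)))"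
proof -
  let ?q = "CARD('f)"
  have q: "?q > 1"
  proof -
    have "card {0, 1 :: 'f} \<le> ?q" by (rule card_mono) auto
    then show ?thesis by simp
  qed
  define C where "C = PiE (exps d :: ('n \<Rightarrow> nat) set) (\<lambda>_. UNIV :: 'f set)"
  define K where "K = (SIGMA y:(UNIV :: ('n \<Rightarrow> 'f) set). (exps (m y - 1) :: ('n \<Rightarrow> nat) set))"
  define \<Psi> where "\<Psi> c = (\<lambda>(y, \<beta>)\<in>K. shift_coeff d c y \<beta>)" for c :: "('n \<Rightarrow> nat) \<Rightarrow> 'f"
  have finK: "finite K" unfolding K_def by (intro finite_SigmaI) auto
  have cardK: "card K = (\<Sum>y\<in>UNIV. card (exps (m y - 1) :: ('n \<Rightarrow> nat) set))"
    unfolding K_def by (intro card_SigmaI) auto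
  have "\<Psi> ` C \<subseteq> PiE K (\<lambda>_. UNIV)" by (auto simp: \<Psi>_def)
  then have "card (\<Psi> ` C) \<le> card (PiE K (\<lambda>_. UNIV :: 'f set))"
    using finK by (intro card_mono finite_PiE) auto
  also have "\<dots> = ?q ^ card K" using finK by (simp add: card_PiE)
  also have "\<dots> < ?q ^ card (exps d :: ('n \<Rightarrow> nat) set)"
    using count q cardK by (intro power_strict_increasing) auto
  also have "\<dots> = card C" by (simp add: C_def card_PiE)
  finally have "\<not> inj_on \<Psi> C" using card_image by fastforce
  then obtain c1 c2 where c12: "c1 \<in> C" "c2 \<in> C" "c1 \<noteq> c2" "\<Psi> c1 = \<Psi> c2" by (auto simp: inj_on_def)
  define c where "c \<alpha> = (if \<alpha> \<in> exps d then c1 \<alpha> - c2 \<alpha> else 0)" for \<alpha>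
  have van: "shift_coeff d c y \<beta> = 0" if "sum \<beta> UNIV < m y" for y \<beta>
  proof -
    have "(y, \<beta>) \<in> K" using that by (auto simp: K_def exps_def)
    then have "shift_coeff d c1 y \<beta> = shift_coeff d c2 y \<beta>"
      using fun_cong[OF c12(4), of "(y, \<beta>)"] by (simp add: \<Psi>_def)
    moreover have "shift_coeff d c y \<beta> = shift_coeff d c1 y \<beta> - shift_coeff d c2 y \<beta>"
      unfolding shift_coeff_def sum_subtractf[symmetric]
      by (intro sum.cong) (auto simp: c_def left_diff_distrib)
    ultimately show ?thesis by simp
  qed
  have ex: "\<exists>\<alpha>\<in>exps d. c \<alpha> \<noteq> 0"
  proof (rule ccontr)
    assume "\<not> ?thesis"
    then have "c1 \<alpha> = c2 \<alpha>" if "\<alpha> \<in> exps d" for \<alpha> using that by (auto simp: c_def)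
    then have "c1 = c2" using c12(1,2) unfolding C_def by (intro PiE_ext) auto
    with c12(3) show False by simp
  qed
  \<comment> \<open>The true degree, so that the form of degree \<open>D\<close> is nonzero. No
    coefficient lies above it, hence the derivatives computed with \<open>D\<close> and with
    \<open>d\<close> agree.\<close>
  define D where "D = Max ((\<lambda>\<alpha>. sum \<alpha> UNIV) ` {\<alpha> \<in> exps d. c \<alpha> \<noteq> 0})"
  have "D \<in> (\<lambda>\<alpha>. sum \<alpha> UNIV) ` {\<alpha> \<in> exps d. c \<alpha> \<noteq> 0}"
    unfolding D_def using ex by (intro Max_in) auto
  then obtain \<alpha>0 where \<alpha>0: "\<alpha>0 \<in> exps d" "c \<alpha>0 \<noteq> 0" "sum \<alpha>0 UNIV = D" by auto
  have Dd: "D \<le> d" using \<alpha>0 by (simp add: exps_def)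
  have c0: "c \<alpha> = 0" if "\<alpha> \<notin> exps D" for \<alpha>
  proof (rule ccontr)
    assume "c \<alpha> \<noteq> 0"
    then have "\<alpha> \<in> {\<alpha> \<in> exps d. c \<alpha> \<noteq> 0}" by (auto simp: c_def split: if_splits)
    then have "sum \<alpha> UNIV \<le> D" unfolding D_def by (intro Max_ge) auto
    with that show False by (simp add: exps_def)
  qed
  have sub: "exps D \<subseteq> (exps d :: ('n \<Rightarrow> nat) set)" using Dd by (auto simp: exps_def)
  have shift_eq: "shift_coeff D c y \<beta> = shift_coeff d c y \<beta>" for y \<beta>
    unfolding shift_coeff_def by (rule sum.mono_neutral_left) (use sub c0 in auto)
  have "polyfun UNIV (m y) D (\<lambda>x. peval c (exps D) (\<lambda>i. [:y i:] + x i))" for y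
    unfolding peval_shift
  proof (rule polyfun_peval)
    fix \<alpha> :: "'n \<Rightarrow> nat" assume "\<alpha> \<in> exps D" "shift_coeff D c y \<alpha> \<noteq> 0"
    then show "m y \<le> sum \<alpha> UNIV \<and> sum \<alpha> UNIV \<le> D"
      using van[of \<alpha> y] by (auto simp: shift_eq exps_def not_less[symmetric])
  qed
  then show ?thesis using Dd \<alpha>0 by blast
qed

section \<open>Flats rich in a weight function\<close>

text \<open>\<open>count\<close> compares unknowns with conditions after multiplication by n!. The
  tuples in \<open>W\<close> are encoded on the grid of \<open>n\<close>-tuples of polynomials of
  degree below \<open>r\<close>, and at each encoding the leading form has multiplicity at least
  \<open>s\<close>; the grid side \<open>q ^ r\<close> is the left-hand factor.\<close>

lemma multiplicity_count:
  fixes m :: "('n::finite \<Rightarrow> 'f::{field,finite}) \<Rightarrow> nat" and W :: "(nat \<Rightarrow> 'n \<Rightarrow> 'f) set"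
    and r :: nat
  defines "q \<equiv> CARD('f)"
  assumes pos: "\<And>y. m y > 0"
    and count: "(\<Sum>y\<in>UNIV. (m y - 1 + CARD('n)) ^ CARD('n)) < (d + 1) ^ CARD('n)"
    and W: "W \<subseteq> PiE {..<r} (\<lambda>_. UNIV)"
    and big: "\<And>w. w \<in> W \<Longrightarrow> \<exists>a. d * q ^ r + s * q ^ (r + 1)
      < q * (\<Sum>T\<in>PiE {..<r} (\<lambda>_. UNIV). m (\<lambda>i. a i + (\<Sum>l<r. T l * w l i)))"
  shows "q ^ r * (card W * s) \<le> d * q ^ (r * CARD('n))"
proof -
  let ?n = "CARD('n)"
  have "fact ?n * (\<Sum>y\<in>UNIV. card (exps (m y - 1) :: ('n \<Rightarrow> nat) set))
    < fact ?n * card (exps d :: ('n \<Rightarrow> nat) set)"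
  proof -
    have "fact ?n * (\<Sum>y\<in>UNIV. card (exps (m y - 1) :: ('n \<Rightarrow> nat) set))
      \<le> (\<Sum>y\<in>UNIV. (m y - 1 + ?n) ^ ?n)"
      unfolding sum_distrib_left by (intro sum_mono card_exps_le_power)
    then show ?thesis using count power_le_card_exps[of d, where 'n = 'n] by linarith
  qed
  then have "(\<Sum>y\<in>UNIV. card (exps (m y - 1) :: ('n \<Rightarrow> nat) set)) < card (exps d :: ('n \<Rightarrow> nat) set)"
    by simp
  from ex_vanishing_polynomial[OF pos this]
  obtain c :: "('n \<Rightarrow> nat) \<Rightarrow> 'f" and D \<alpha>0 where c: "D \<le> d" "sum \<alpha>0 UNIV = D" "c \<alpha>0 \<noteq> 0"
    "\<And>y. polyfun UNIV (m y) D (\<lambda>x. peval c (exps D) (\<lambda>i. [:y i:] + x i))" by blast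
  define H where "H = peval c {\<alpha>. sum \<alpha> UNIV = D}"
  have fin: "finite {\<alpha> :: 'n \<Rightarrow> nat. sum \<alpha> UNIV = D}"
    by (rule finite_subset[OF _ finite_exps[of D]]) (auto simp: exps_def)
  obtain x0 where x0: "H x0 \<noteq> 0"
    unfolding H_def using peval_nonzero[OF fin, of \<alpha>0 c] c(2,3) by blast
  have H: "polyfun UNIV 0 D H" unfolding H_def by (rule polyfun_peval) auto
  define enc where "enc w = (\<lambda>i. \<Sum>l<r. monom (w l i) l)" for w :: "nat \<Rightarrow> 'n \<Rightarrow> 'f"
  define B where "B = (\<lambda>v. \<Sum>l<r. monom (v l) l) ` PiE {..<r} (\<lambda>_. UNIV :: 'f set)"
  have coeff_enc: "coeff (\<Sum>l<r. monom (v l) l) k = (if k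
    < r then v k else 0)" for v :: "nat \<Rightarrow> 'f" and k
    by (simp add: coeff_sum)
  have cardB: "card B = q ^ r"
  proof -
    have "inj_on (\<lambda>v. \<Sum>l<r. monom (v l) l) (PiE {..<r} (\<lambda>_. UNIV :: 'f set))"
    proof (rule inj_onI)
      fix v v' :: "nat \<Rightarrow> 'f" assume v: "v \<in> PiE {..<r} (\<lambda>_. UNIV)" "v' \<in> PiE {..<r} (\<lambda>_. UNIV)"
        and eq: "(\<Sum>l<r. monom (v l) l) = (\<Sum>l<r. monom (v' l) l)"
      have "v l = v' l" if "l < r" for l
        using arg_cong[OF eq, of "\<lambda>p. coeff p l"] that by (simp add: coeff_enc)
      with v show "v = v'" by (intro PiE_ext) auto
    qed
    then show ?thesis unfolding B_def by (simp add: card_image card_PiE q_def)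
  qed
  have finB: "finite B" unfolding B_def by (intro finite_imageI finite_PiE) auto
  have enc_B: "enc w \<in> PiE UNIV (\<lambda>_. B)" if "w \<in> W" for w
  proof -
    have "enc w i \<in> B" for i
      unfolding B_def enc_def
      by (rule image_eqI[of _ _ "\<lambda>l\<in>{..<r}. w l i"]) (auto intro: sum.cong)
    then show ?thesis by auto
  qed
  have inj: "inj_on enc W"
  proof (rule inj_onI)
    fix w w' assume w: "w \<in> W" "w' \<in> W" and eq: "enc w = enc w'"
    have "w l = w' l" if "l < r" for l
    proof
      fix i
      show "w l i = w' l i"
        using arg_cong[OF fun_cong[OF eq, of i], of "\<lambda>p. coeff p l"] that
          by (simp add: enc_def coeff_enc)
    qed
    with w W show "w = w'" by (intro PiE_ext[of w "{..<r}" "\<lambda>_. UNIV" w']) auto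
  qed
  \<comment> \<open>Off the encodings only multiplicity \<open>0\<close> is claimed, which every
    polynomial function has.\<close>
  define \<mu> where "\<mu> b = (if b \<in> enc ` W then s else 0)" for b
  have "card B * sum \<mu> (PiE UNIV (\<lambda>_. B)) \<le> D * card B ^ card (UNIV :: 'n set)"
  proof (rule Schwartz_Zippel_multiplicity[OF infinite_UNIV_poly _ finB H x0])
    fix b
    show "vanishes_to H b (\<mu> b)"
    proof (cases "b \<in> enc ` W")
      case True
      then obtain w where w: "w \<in> W" "b = enc w" by blast
      from big[OF w(1)] obtain a where a: "d * q ^ r + s * q ^ (r + 1)
        < q * (\<Sum>T\<in>PiE {..<r} (\<lambda>_. UNIV). m (\<lambda>i. a i + (\<Sum>l<r. T l * w l i)))" by blast
      have "D * q ^ r + s * q ^ (r + 1)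
        < q * (\<Sum>T\<in>PiE {..<r} (\<lambda>_. UNIV). m (\<lambda>i. a i + (\<Sum>l<r. T l * w l i)))"
        using c(1) by (intro le_less_trans[OF _ a]) simp
      from leading_form_vanishes[OF c(4) this[unfolded q_def]] show ?thesis
        using True by (simp add: \<mu>_def w(2) enc_def H_def)
    next
      case False
      then show ?thesis using polyfun_affine_line[OF H] by (simp add: \<mu>_def vanishes_to_def)
    qed
  qed simp
  moreover have "sum \<mu> (PiE UNIV (\<lambda>_. B)) = card W * s"
  proof -
    have "sum \<mu> (PiE UNIV (\<lambda>_. B)) = (\<Sum>b\<in>enc ` W. s)"
      by (rule sum.mono_neutral_cong_right) (use finB enc_B in \<open>auto simp: \<mu>_def finite_PiE\<close>)
    then show ?thesis using card_image[OF inj] by simp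
  qed
  ultimately have "q ^ r * (card W * s) \<le> D * (q ^ r) ^ ?n" by (simp add: cardB)
  also have "\<dots> \<le> d * (q ^ r) ^ ?n" using c(1) by simp
  finally show ?thesis by (simp add: power_mult)
qed

text \<open>A second-order upper bound for both signs of \<open>x\<close>, since excess and deficit
  are both treated. The separate exponent \<open>k \<le> n\<close> lets the induction run under a
  fixed smallness condition.\<close>

lemma one_plus_power_le:
  fixes x :: real
  assumes "\<bar>real n * x\<bar> \<le> 1" "\<bar>x\<bar> \<le> 1" "k \<le> n"
  shows "(1 + x) ^ k \<le> 1 + real k * x + (real k * x)\<^sup>2"
  using assms(3)
proof (induction k)
  case (Suc k)
  have x: "1 + x \<ge> 0" using assms(2) by linarith
  have "real k * \<bar>x\<bar> \<le> real n * \<bar>x\<bar>" using Suc(2) by (intro mult_right_mono) auto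
  also have "\<dots> \<le> 1" using assms(1) by (simp add: abs_mult)
  finally have kx: "real k * x \<le> 1" by (smt (verit) mult_left_mono of_nat_0_le_iff)
  have "real k * (real k * x) \<le> real k * 1" using kx by (intro mult_left_mono) auto
  then have "x\<^sup>2 * ((real k)\<^sup>2 * x) \<le> x\<^sup>2 * (real k + 1)"
    by (intro mult_left_mono) (auto simp: power2_eq_square mult.assoc)
  moreover have "(1 + x) ^ Suc k \<le> (1 + real k * x + (real k * x)\<^sup>2) * (1 + x)"
    using mult_right_mono[OF Suc.IH x] Suc(2) by (simp add: mult.commute)
  ultimately show ?case by (simp add: algebra_simps power2_eq_square)
qed simp

lemma le_if_linear_growth:
  fixes a b c e :: real
  assumes "\<And>s :: nat. s \<ge> s0 \<Longrightarrow> real s * a - b \<le> real s * c + e"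
  shows "a \<le> c"
proof (rule ccontr)
  assume "\<not> ?thesis"
  then have pos: "a - c > 0" by simp
  obtain s1 :: nat where "real s1 > (b + e) / (a - c)" using reals_Archimedean2 by blast
  then have "real (max s0 s1) > (b + e) / (a - c)" by simp
  then have "real (max s0 s1) * (a - c) > b + e" using pos by (simp add: pos_divide_less_eq)
  moreover have "real (max s0 s1) * a - b \<le> real (max s0 s1) * c + e" by (rule assms) simp
  ultimately show False by (simp add: algebra_simps)
qed

text \<open>The multiplicity \<open>s (1 + \<phi>)\<close> raises the number of vanishing conditions only by
  the average of \<open>(1 + \<phi>)\<^sup>n\<close>, while a flat rich in \<open>\<phi>\<close> gains \<open>\<eta>\<close> more than that; the
  limit \<open>s \<rightarrow> \<infinity>\<close> removes all rounding.\<close>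

theorem rich_flats_bound:
  fixes \<phi> :: "('n::finite \<Rightarrow> 'f::{field,finite}) \<Rightarrow> real" and W :: "(nat \<Rightarrow> 'n \<Rightarrow> 'f) set"
    and r :: nat
  defines "q \<equiv> real CARD('f)" and "n \<equiv> CARD('n)"
  defines "A \<equiv> (\<Sum>y\<in>UNIV. \<phi> y) / q ^ n" and "Q \<equiv> (\<Sum>y\<in>UNIV. (\<phi> y)\<^sup>2) / q ^ n"
  assumes \<phi>: "\<And>y. \<bar>\<phi> y\<bar> \<le> 1 / (2 * real n)" and \<eta>: "\<eta> > 0"
    and W: "W \<subseteq> PiE {..<r} (\<lambda>_. UNIV)"
    and rich: "\<And>w. w \<in> W \<Longrightarrow> \<exists>a. q ^ r * (A + real n * Q + \<eta>)
      \<le> (\<Sum>T\<in>PiE {..<r} (\<lambda>_. UNIV). \<phi> (\<lambda>i. a i + (\<Sum>l<r. T l * w l i)))"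
  shows "q ^ r * real (card W) * \<eta> \<le> 4 * q * q ^ (r * n)"
proof -
  have n: "n \<ge> 1" unfolding n_def by (simp add: Suc_leI)
  have q: "q \<ge> 1" unfolding q_def by (simp add: Suc_leI)
  have qn: "q ^ n > 0" using q by simp
  have cardU: "real CARD('n \<Rightarrow> 'f) = q ^ n"
    unfolding q_def n_def using card_PiE[of "UNIV :: 'n set" "\<lambda>_. UNIV :: 'f set"]
    by (simp add: PiE_UNIV_domain)
  have inv_n: "1 / (2 * real n) \<le> 1 / 2" using n by (simp add: divide_simps)
  \<comment> \<open>\<open>L\<close> bounds the \<open>n\<close>th root of the mean of
    \<open>(1 + \<phi> y) ^ n\<close>: the second-order expansion gives
    \<open>1 + n * (A + n * Q)\<close> for the mean, and Bernoulli's inequality extracts the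
    root.\<close>
  define L where "L = 1 + A + real n * Q"
  have A_abs: "\<bar>A\<bar> \<le> 1 / (2 * real n)"
  proof -
    have "\<bar>\<Sum>y\<in>UNIV. \<phi> y\<bar> \<le> (\<Sum>y\<in>(UNIV :: ('n \<Rightarrow> 'f) set). 1 / (2 * real n))"
      by (rule order_trans[OF sum_abs]) (intro sum_mono \<phi>)
    then have "\<bar>\<Sum>y\<in>UNIV. \<phi> y\<bar> \<le> q ^ n * (1 / (2 * real n))" by (simp add: cardU)
    then have "\<bar>\<Sum>y\<in>UNIV. \<phi> y\<bar> / q ^ n \<le> 1 / (2 * real n)"
      using qn by (subst pos_divide_le_eq) (simp_all only: mult.commute)
    then show ?thesis using qn by (simp add: A_def abs_divide)
  qed
  have Q_bounds: "0 \<le> Q" "real n * Q \<le> 1 / 2"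
  proof -
    show "0 \<le> Q" using q unfolding Q_def by (intro divide_nonneg_nonneg sum_nonneg) auto
    have "(\<phi> y)\<^sup>2 \<le> (1 / (2 * real n))\<^sup>2" for y using power_mono[OF \<phi>[of y], of 2] by simp
    then have "(\<Sum>y\<in>UNIV. (\<phi> y)\<^sup>2) \<le> (\<Sum>y\<in>(UNIV :: ('n \<Rightarrow> 'f) set). (1 / (2 * real n))\<^sup>2)"
      by (intro sum_mono)
    also have "\<dots> = q ^ n * (1 / (2 * real n))\<^sup>2" by (simp add: cardU)
    finally have "Q \<le> (1 / (2 * real n))\<^sup>2"
      using qn unfolding Q_def by (subst pos_divide_le_eq) (simp_all only: mult.commute)
    then have "real n * Q \<le> real n * (1 / (2 * real n))\<^sup>2" by (intro mult_left_mono) auto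
    also have "\<dots> = 1 / (4 * real n)" using n by (simp add: power2_eq_square divide_simps)
    also have "\<dots> \<le> 1 / 2" using n by (simp add: divide_simps)
    finally show "real n * Q \<le> 1 / 2" .
  qed
  have "0 \<le> real n * Q" using Q_bounds(1) by simp
  then have L: "L \<ge> 1 / 2" "L \<le> 2" unfolding L_def using A_abs inv_n Q_bounds(2) by linarith+
  have avg: "(\<Sum>y\<in>UNIV. (1 + \<phi> y) ^ n) \<le> q ^ n * L ^ n"
  proof -
    have "(1 + \<phi> y) ^ n \<le> 1 + real n * \<phi> y + (real n * \<phi> y)\<^sup>2" for y
    proof (rule one_plus_power_le)
      have "real n * \<bar>\<phi> y\<bar> \<le> real n * (1 / (2 * real n))" using \<phi>[of y]
        by (intro mult_left_mono) auto
      then show "\<bar>real n * \<phi> y\<bar> \<le> 1" using n by (simp add: abs_mult)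
      show "\<bar>\<phi> y\<bar> \<le> 1" using \<phi>[of y] inv_n by linarith
    qed simp
    then have "(\<Sum>y\<in>UNIV. (1 + \<phi> y) ^ n) \<le> (\<Sum>y\<in>UNIV. 1 + real n * \<phi> y + (real n * \<phi> y)\<^sup>2)"
      by (intro sum_mono)
    also have "\<dots> = q ^ n * (1 + real n * (A + real n * Q))"
      using q by (simp add: sum.distrib cardU A_def Q_def sum_distrib_left[symmetric]
          power_mult_distrib field_simps power2_eq_square)
    also have "\<dots> \<le> q ^ n * L ^ n"
    proof (rule mult_left_mono)
      have "-1 \<le> A + real n * Q" using L(1) unfolding L_def by linarith
      from Bernoulli_inequality[OF this, of n]
      show "1 + real n * (A + real n * Q) \<le> L ^ n" by (simp add: L_def add.assoc)
    qed (use q in auto)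
    finally show ?thesis .
  qed
  define X where "X = q ^ r * real (card W)"
  define Y where "Y = q ^ (r * n)"
  have main: "real s * (X * \<eta> / 2) - X \<le> real s * (q * L * Y) + q * L * (2 * real n) * Y"
    if s: "s \<ge> Suc (nat \<lceil>4 * real n * L / \<eta>\<rceil>)" for s :: nat
  proof -
    have s_big: "4 * real n * L < real s * \<eta>"
    proof -
      have "4 * real n * L / \<eta> \<le> real (nat \<lceil>4 * real n * L / \<eta>\<rceil>)" by (rule real_nat_ceiling_ge)
      also have "\<dots> < real s" using s by simp
      finally show ?thesis using \<eta> by (simp add: divide_simps)
    qed
    have s1: "real s \<ge> 1" using s by simp
    \<comment> \<open>Rounding \<open>m\<close> up and the shift by \<open>n\<close> in the number
      of conditions are absorbed by \<open>2 * n\<close> in \<open>d\<close>, because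
      \<open>1 + \<phi> y \<ge> 1 / 2\<close>. The gain \<open>s * \<eta>\<close> of a rich flat is
      split: one half pays for the order \<open>s'\<close> of the leading form, the other exceeds
      the surplus \<open>2 * n * L\<close> by the choice of \<open>s\<close>.\<close>
    define m where "m y = nat \<lceil>real s * (1 + \<phi> y)\<rceil>" for y
    define d where "d = nat \<lfloor>q * L * (real s + 2 * real n)\<rfloor>"
    define s' where "s' = nat \<lfloor>real s * \<eta> / 2\<rfloor>"
    have \<phi>1: "1 + \<phi> y \<ge> 1 / 2" for y using \<phi>[of y] inv_n by linarith
    have mpos: "real s * (1 + \<phi> y) > 0" for y using \<phi>1[of y] s1 by (intro mult_pos_pos) linarith+
    have m_lower: "real (m y) \<ge> real s * (1 + \<phi> y)" for y unfolding m_def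
      by (rule real_nat_ceiling_ge)
    have m_upper: "real (m y) \<le> real s * (1 + \<phi> y) + 1" for y
      unfolding m_def using mpos[of y] by linarith
    have m0: "m y > 0" for y using m_lower[of y] mpos[of y] by linarith
    have d_upper: "real d \<le> q * L * (real s + 2 * real n)"
      unfolding d_def using q L s1 by (intro of_nat_floor) auto
    have d_lower: "q * L * (real s + 2 * real n) < real d + 1" unfolding d_def by linarith
    have s'_upper: "real s' \<le> real s * \<eta> / 2" unfolding s'_def using \<eta> by (intro of_nat_floor) auto
    have s'_lower: "real s * \<eta> / 2 - 1 < real s'" unfolding s'_def by linarith
    have "CARD('f) ^ r * (card W * s') \<le> d * CARD('f) ^ (r * CARD('n))"
    proof (rule multiplicity_count[OF m0 _ W])
      have "real (\<Sum>y\<in>UNIV. (m y - 1 + CARD('n)) ^ CARD('n))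
        = (\<Sum>y\<in>UNIV. (real (m y) - 1 + real n) ^ n)"
        using m0 by (simp add: n_def of_nat_diff Suc_leI algebra_simps)
      also have "\<dots> \<le> (\<Sum>y\<in>UNIV. ((real s + 2 * real n) * (1 + \<phi> y)) ^ n)"
      proof (intro sum_mono power_mono)
        fix y :: "'n \<Rightarrow> 'f"
        have "real n * 1 \<le> real n * (2 * (1 + \<phi> y))" using \<phi>1[of y] by (intro mult_left_mono) auto
        then show "real (m y) - 1 + real n \<le> (real s + 2 * real n) * (1 + \<phi> y)"
          using m_upper[of y] by (simp add: algebra_simps)
        show "0 \<le> real (m y) - 1 + real n" using n by linarith
      qed
      also have "\<dots> = (real s + 2 * real n) ^ n * (\<Sum>y\<in>UNIV. (1 + \<phi> y) ^ n)"
        by (simp add: power_mult_distrib sum_distrib_left)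
      also have "\<dots> \<le> (real s + 2 * real n) ^ n * (q ^ n * L ^ n)"
        using avg by (intro mult_left_mono) auto
      also have "\<dots> = (q * L * (real s + 2 * real n)) ^ n" by (simp add: power_mult_distrib)
      also have "\<dots> < (real d + 1) ^ n"
        using d_lower q L n s1 by (intro power_strict_mono) auto
      also have "\<dots> = real ((d + 1) ^ CARD('n))" by (simp add: n_def add.commute)
      finally show "(\<Sum>y\<in>UNIV. (m y - 1 + CARD('n)) ^ CARD('n)) < (d + 1) ^ CARD('n)"
        by (simp only: of_nat_less_iff)
    next
      fix w assume "w \<in> W"
      from rich[OF this] obtain a where a: "q ^ r * (A + real n * Q + \<eta>)
        \<le> (\<Sum>T\<in>PiE {..<r} (\<lambda>_. UNIV). \<phi> (\<lambda>i. a i + (\<Sum>l<r. T l * w l i)))" by blast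
      have "real (d * CARD('f) ^ r + s' * CARD('f) ^ (r + 1))
        = real d * q ^ r + real s' * q * q ^ r"
        by (simp add: q_def)
      also have "\<dots> \<le> q * L * (real s + 2 * real n) * q ^ r + real s * \<eta> / 2 * q * q ^ r"
        using d_upper s'_upper q by (intro add_mono mult_right_mono) auto
      also have "\<dots> = q * q ^ r * (real s * L + 2 * real n * L + real s * \<eta> / 2)"
        by (simp add: algebra_simps)
      also have "\<dots> < q * q ^ r * (real s * (L + \<eta>))"
        using s_big q by (intro mult_strict_left_mono) (auto simp: algebra_simps)
      also have "\<dots> = q * (real s * (q ^ r + q ^ r * (A + real n * Q + \<eta>)))"
        by (simp add: L_def algebra_simps)
      also have "\<dots>
        \<le> q * (real s * (q ^ r + (\<Sum>T\<in>PiE {..<r} (\<lambda>_. UNIV). \<phi> (\<lambda>i. a i + (\<Sum>l<r. T l * w l i)))))"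
        using a q by (intro mult_left_mono add_left_mono) auto
      also have "\<dots>
        = q * (\<Sum>T\<in>PiE {..<r} (\<lambda>_. UNIV). real s * (1 + \<phi> (\<lambda>i. a i + (\<Sum>l<r. T l * w l i))))"
        by (simp add: sum_distrib_left[symmetric] sum.distrib card_PiE q_def)
      also have "\<dots> \<le> q * (\<Sum>T\<in>PiE {..<r} (\<lambda>_. UNIV). real (m (\<lambda>i. a i + (\<Sum>l<r. T l * w l i))))"
        using q by (intro mult_left_mono sum_mono m_lower) auto
      also have "\<dots>
        = real (CARD('f) * (\<Sum>T\<in>PiE {..<r} (\<lambda>_. UNIV). m (\<lambda>i. a i + (\<Sum>l<r. T l * w l i))))"
        by (simp add: q_def)
      finally show "\<exists>a. d * CARD('f) ^ r + s' * CARD('f) ^ (r + 1)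
        < CARD('f) * (\<Sum>T\<in>PiE {..<r} (\<lambda>_. UNIV). m (\<lambda>i. a i + (\<Sum>l<r. T l * w l i)))"
        by (auto simp only: of_nat_less_iff)
    qed
    then have "real (CARD('f) ^ r * (card W * s')) \<le> real (d * CARD('f) ^ (r * CARD('n)))"
      by (simp only: of_nat_le_iff)
    then have "X * real s' \<le> real d * Y" by (simp add: X_def Y_def q_def n_def mult.assoc)
    moreover have "X * (real s * \<eta> / 2 - 1) \<le> X * real s'"
      using s'_lower q by (intro mult_left_mono) (auto simp: X_def)
    moreover have "real d * Y \<le> q * L * (real s + 2 * real n) * Y"
      using d_upper q by (intro mult_right_mono) (auto simp: Y_def)
    ultimately have "X * (real s * \<eta> / 2 - 1) \<le> q * L * (real s + 2 * real n) * Y" by linarith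
    then show ?thesis by (simp add: algebra_simps)
  qed
  from le_if_linear_growth[OF main] have "X * \<eta> / 2 \<le> q * L * Y" .
  also have "\<dots> \<le> q * 2 * Y" using L q by (intro mult_right_mono mult_left_mono) (auto simp: Y_def)
  finally show ?thesis by (simp add: X_def Y_def)
qed

section \<open>Counting frames of subspaces\<close>

definition lincomb :: "nat \<Rightarrow> (nat \<Rightarrow> 'f::field ^ 'n) \<Rightarrow> (nat \<Rightarrow> 'f) \<Rightarrow> 'f ^ 'n"
  where "lincomb l w T = (\<Sum>i<l. T i *s w i)"

definition frames :: "nat \<Rightarrow> ('f::field ^ 'n) set \<Rightarrow> (nat \<Rightarrow> 'f ^ 'n) set"
  where "frames l V = {w \<in> PiE {..<l} (\<lambda>_. V). \<forall>T. lincomb l w T = 0 \<longrightarrow> (\<forall>i<l. T i = 0)}"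

lemma lincomb_diff: "lincomb l w T - lincomb l w T' = lincomb l w (\<lambda>i. T i - T' i)"
  by (simp add: lincomb_def sum_subtractf vec.scale_left_diff_distrib)

lemma lincomb_cong: "(\<And>i. i < l \<Longrightarrow> T i = T' i) \<Longrightarrow> (\<And>i. i < l \<Longrightarrow> w i = w' i) \<Longrightarrow> lincomb l w T
  = lincomb l w' T'"
  by (simp add: lincomb_def)

lemma lincomb_scale: "c *s lincomb l w T = lincomb l w (\<lambda>i. c * T i)"
  by (simp add: lincomb_def vec.scale_sum_right)

lemma lincomb_in_subspace:
  assumes "vec.subspace V" "\<And>i. i < l \<Longrightarrow> w i \<in> V"
  shows "lincomb l w T \<in> V"
  unfolding lincomb_def using assms by (intro vec.subspace_sum vec.subspace_scale) auto

lemma range_lincomb: "range (lincomb l w) = lincomb l w ` PiE {..<l} (\<lambda>_. UNIV)"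
proof -
  have "lincomb l w T \<in> lincomb l w ` PiE {..<l} (\<lambda>_. UNIV)" for T
    by (rule image_eqI[of _ _ "restrict T {..<l}"]) (auto intro: lincomb_cong)
  then show ?thesis by blast
qed

lemma inj_on_lincomb:
  assumes "\<forall>T. lincomb l w T = 0 \<longrightarrow> (\<forall>i<l. T i = 0)"
  shows "inj_on (lincomb l w) (PiE {..<l} (\<lambda>_. UNIV))"
proof (rule inj_onI)
  fix T T' assume T: "T \<in> PiE {..<l} (\<lambda>_. UNIV)" "T' \<in> PiE {..<l} (\<lambda>_. UNIV)"
    and "lincomb l w T = lincomb l w T'"
  then have "lincomb l w (\<lambda>i. T i - T' i) = 0" using lincomb_diff[of l w T T'] by simp
  then have "T i = T' i" if "i < l" for i using assms that by fastforce
  with T show "T = T'" by (intro PiE_ext) auto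
qed

lemma card_range_lincomb:
  fixes w :: "nat \<Rightarrow> 'f::{field,finite} ^ 'n"
  assumes "\<forall>T. lincomb l w T = 0 \<longrightarrow> (\<forall>i<l. T i = 0)"
  shows "card (range (lincomb l w)) = CARD('f) ^ l"
  unfolding range_lincomb using card_image[OF inj_on_lincomb[OF assms]] by (simp add: card_PiE)

text \<open>After \<open>l\<close> independent vectors have been chosen, the next one avoids exactly
  their \<open>q ^ l\<close> linear combinations.\<close>

lemma card_frames:
  fixes V :: "('f::{field,finite} ^ 'n) set"
  assumes V: "vec.subspace V" "card V = CARD('f) ^ k"
  shows "card (frames l V) = (\<Prod>i<l. CARD('f) ^ k - CARD('f) ^ i)"
proof (induction l)
  case 0
  have "frames 0 V = {\<lambda>_. undefined}" by (auto simp: frames_def)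
  then show ?case by simp
next
  case (Suc l)
  have suc: "lincomb (Suc l) w T = lincomb l w T + T l *s w l" for w :: "nat \<Rightarrow> 'f ^ 'n" and T
    by (simp add: lincomb_def)
  have upd: "lincomb l (w(l := x)) T = lincomb l w T" "lincomb l w (T(l := c))
    = lincomb l w T" for w T x c
    by (rule lincomb_cong; simp)+
  have "bij_betw (\<lambda>(w, x). w(l := x)) (SIGMA w:frames l V. V - range (lincomb l w)) (frames
    (Suc l) V)"
  proof (rule bij_betw_byWitness[where f' = "\<lambda>w. (w(l := undefined), w l)"])
    show "\<forall>a\<in>SIGMA w:frames l V. V - range (lincomb l w).
        (case case a of (w, x) \<Rightarrow> w(l := x) of w \<Rightarrow> (w(l := undefined), w l)) = a"
      by (auto simp: frames_def PiE_def extensional_def fun_eq_iff)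
    show "(\<lambda>(w, x). w(l := x)) ` (SIGMA w:frames l V. V - range (lincomb l w)) \<subseteq> frames (Suc l) V"
    proof clarify
      fix w x assume w: "w \<in> frames l V" and x: "x \<in> V" "x \<notin> range (lincomb l w)"
      have "T i = 0" if T: "lincomb (Suc l) (w(l := x)) T = 0" and i: "i < Suc l" for T i
      proof -
        have eq: "lincomb l w T + T l *s x = 0" using T by (simp add: suc upd)
        have "T l = 0"
        proof (rule ccontr)
          assume "T l \<noteq> 0"
          then have "x = (1 / T l) *s (T l *s x)" by simp
          also have "T l *s x = - lincomb l w T" using eq
            by (simp add: eq_neg_iff_add_eq_0 add.commute)
          also have "(1 / T l) *s - lincomb l w T = (- (1 / T l)) *s lincomb l w T"
            by (simp only: vec.scale_minus_left vec.scale_minus_right)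
          finally have "x \<in> range (lincomb l w)" by (simp only: lincomb_scale rangeI)
          with x show False by simp
        qed
        then have "lincomb l w T = 0" using eq by simp
        then show ?thesis using w i \<open>T l = 0\<close> by (auto simp: frames_def less_Suc_eq)
      qed
      moreover have "w(l := x) \<in> PiE {..<Suc l} (\<lambda>_. V)"
        using w x by (auto simp: frames_def PiE_def Pi_def extensional_def less_Suc_eq)
      ultimately show "w(l := x) \<in> frames (Suc l) V" by (auto simp: frames_def)
    qed
    show "(\<lambda>w. (w(l := undefined), w l)) ` frames (Suc l) V
      \<subseteq> (SIGMA w:frames l V. V - range (lincomb l w))"
    proof (rule image_subsetI)
      fix w assume w: "w \<in> frames (Suc l) V"
      have indep: "T i = 0" if "lincomb (Suc l) w T = 0" "i < Suc l" for T i
        using w that by (auto simp: frames_def)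
      have "w(l := undefined) \<in> frames l V"
      proof -
        have "T i = 0" if "lincomb l w T = 0" "i < l" for T i
          using indep[of "T(l := 0)" i] that by (simp add: suc upd)
        moreover have "w(l := undefined) \<in> PiE {..<l} (\<lambda>_. V)"
          using w by (auto simp: frames_def PiE_def Pi_def extensional_def less_Suc_eq)
        ultimately show ?thesis by (auto simp: frames_def upd)
      qed
      moreover have "w l \<notin> range (lincomb l (w(l := undefined)))"
      proof
        assume "w l \<in> range (lincomb l (w(l := undefined)))"
        then obtain T where "w l = lincomb l w T" by (auto simp: upd)
        then have "lincomb (Suc l) w (T(l := - 1)) = 0" by (simp add: suc upd)
        from indep[OF this, of l] show False by simp
      qed
      moreover have "w l \<in> V" using w by (auto simp: frames_def)
      ultimately show "(w(l := undefined), w l) \<in> (SIGMA w:frames l V. V - range (lincomb l w))"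
        by auto
    qed
  qed (auto simp: fun_eq_iff)
  then have "card (frames (Suc l) V) = card (SIGMA w:frames l V. V - range (lincomb l w))"
    by (simp add: bij_betw_same_card)
  also have "\<dots> = (\<Sum>w\<in>frames l V. card (V - range (lincomb l w)))"
    by (rule card_SigmaI) (auto simp: frames_def intro: finite_subset[OF _ finite_PiE[of "{..<l}"
      "\<lambda>_. V"]])
  also have "\<dots> = (\<Sum>w\<in>frames l V. CARD('f) ^ k - CARD('f) ^ l)"
  proof (rule sum.cong[OF refl])
    fix w assume w: "w \<in> frames l V"
    have "range (lincomb l w) \<subseteq> V"
      using w by (auto intro!: lincomb_in_subspace[OF V(1)] simp: frames_def)
    then have "card (V - range (lincomb l w)) = card V - card (range (lincomb l w))"
      by (intro card_Diff_subset) auto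
    then show "card (V - range (lincomb l w)) = CARD('f) ^ k - CARD('f) ^ l"
      using V(2) card_range_lincomb[of l w] w by (simp add: frames_def)
  qed
  finally show ?case using Suc by simp
qed

lemma card_subspace:
  fixes S :: "('f::{field,finite} ^ 'n) set"
  assumes "vec.subspace S"
  shows "card S = CARD('f) ^ vec.dim S"
proof -
  obtain B where B: "B \<subseteq> S" "vec.independent B" "S \<subseteq> vec.span B" "card B = vec.dim S"
    using vec.basis_exists by blast
  have S: "S = vec.span B" using B(1,3) vec.span_minimal[OF B(1) assms] by blast
  obtain h where h: "bij_betw h {..<vec.dim S} B"
    using ex_bij_betw_nat_finite[of B] B(4) by (auto simp: atLeast0LessThan)
  have comb: "lincomb (vec.dim S) h (\<lambda>i. u (h i)) = (\<Sum>v\<in>B. u v *s v)" for u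
    unfolding lincomb_def by (rule sum.reindex_bij_betw[OF h])
  have comb': "lincomb (vec.dim S) h T = (\<Sum>v\<in>B. T (inv_into {..<vec.dim S} h v) *s v)" for T
  proof -
    have "lincomb (vec.dim S) h T = lincomb (vec.dim S) h (\<lambda>i. T (inv_into {..<vec.dim S} h (h i)))"
      by (rule lincomb_cong) (use h in \<open>auto simp: bij_betw_def inv_into_f_f\<close>)
    then show ?thesis using comb[of "\<lambda>v. T (inv_into {..<vec.dim S} h v)"] by (rule trans)
  qed
  have "S = range (lincomb (vec.dim S) h)"
  proof -
    have "S = range (\<lambda>u. \<Sum>v\<in>B. u v *s v)" using S vec.span_finite[of B] by simp
    also have "\<dots> = range (lincomb (vec.dim S) h)"
    proof (intro equalityI subsetI)
      fix x assume "x \<in> range (\<lambda>u. \<Sum>v\<in>B. u v *s v)"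
      then show "x \<in> range (lincomb (vec.dim S) h)" using comb
        by (metis (no_types, lifting) imageE rangeI)
    next
      fix x assume "x \<in> range (lincomb (vec.dim S) h)"
      then show "x \<in> range (\<lambda>u. \<Sum>v\<in>B. u v *s v)" by (auto simp: comb')
    qed
    finally show ?thesis .
  qed
  moreover have "\<forall>T. lincomb (vec.dim S) h T = 0 \<longrightarrow> (\<forall>i<vec.dim S. T i = 0)"
  proof clarify
    fix T i assume T: "lincomb (vec.dim S) h T = 0" and i: "i < vec.dim S"
    have "(\<Sum>v\<in>B. T (inv_into {..<vec.dim S} h v) *s v) = 0" using T comb' by simp
    then have "T (inv_into {..<vec.dim S} h v) = 0" if "v \<in> B" for v
      using B(2) that vec.dependent_finite[of B] by auto
    from this[of "h i"] show "T i = 0" using h i by (auto simp: bij_betw_def inv_into_f_f)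
  qed
  ultimately show ?thesis using card_range_lincomb[of "vec.dim S" h] by simp
qed

lemma CARD_field_gt_1: "CARD('f::{field,finite}) > 1"
proof -
  have "card {0, 1 :: 'f} \<le> CARD('f)" by (rule card_mono) auto
  then show ?thesis by simp
qed

lemma frame_range:
  fixes S :: "('f::{field,finite} ^ 'n) set"
  assumes "vec.subspace S" "vec.dim S = r" "w \<in> frames r S"
  shows "range (lincomb r w) = S"
proof (rule card_subset_eq)
  show "range (lincomb r w) \<subseteq> S"
    using assms(3) by (auto intro!: lincomb_in_subspace[OF assms(1)] simp: frames_def)
  show "card (range (lincomb r w)) = card S"
    using assms card_subspace[OF assms(1)] card_range_lincomb[of r w] by (simp add: frames_def)
qed simp

definition grassmannian :: "nat \<Rightarrow> ('f::field ^ 'n) set set"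
  where "grassmannian r = {S. vec.subspace S \<and> vec.dim S = r}"

lemma frames_UN: "(\<Union>S\<in>grassmannian r. frames r S)
  = frames r (UNIV :: ('f::{field,finite} ^ 'n) set)"
proof (intro equalityI subsetI)
  fix w :: "nat \<Rightarrow> 'f ^ 'n" assume w: "w \<in> frames r UNIV"
  define S where "S = range (lincomb r w)"
  have sub: "vec.subspace S"
  proof (rule vec.subspaceI)
    have "lincomb r w (\<lambda>_. 0) = 0" by (simp add: lincomb_def)
    then show "0 \<in> S" unfolding S_def by (metis rangeI)
  next
    fix x y assume "x \<in> S" "y \<in> S"
    then obtain T T' where "x = lincomb r w T" "y = lincomb r w T'" by (auto simp: S_def)
    then have "x + y = lincomb r w (\<lambda>i. T i + T' i)"
      by (simp add: lincomb_def sum.distrib vec.scale_left_distrib)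
    then show "x + y \<in> S" by (simp add: S_def)
  next
    fix c x assume "x \<in> S"
    then show "c *s x \<in> S" by (auto simp: S_def lincomb_scale)
  qed
  have "CARD('f) ^ vec.dim S = CARD('f) ^ r"
    using card_subspace[OF sub] card_range_lincomb[of r w] w by (simp add: S_def frames_def)
  then have "vec.dim S = r" using CARD_field_gt_1[where 'f = 'f] by simp
  moreover have "w \<in> frames r S"
  proof -
    have "w l \<in> S" if "l < r" for l
    proof -
      have "lincomb r w (\<lambda>i. if i = l then 1 else 0) = w l"
        using that by (simp add: lincomb_def if_distrib[of "\<lambda>c. c *s _"] cong: if_cong)
      then show ?thesis unfolding S_def by (metis rangeI)
    qed
    then show ?thesis using w by (auto simp: frames_def PiE_def)
  qed
  ultimately show "w \<in> (\<Union>S\<in>grassmannian r. frames r S)" using sub by (auto simp: grassmannian_def)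
qed (auto simp: frames_def PiE_def)

text \<open>At least half of all \<open>r\<close>-tuples are independent. The induction carries the
  explicit deficit \<open>q ^ l / (2 * q ^ n)\<close>; its step reduces to
  \<open>3 * x \<le> q * x\<close>, which is where \<open>q \<ge> 3\<close> enters.\<close>

lemma card_frames_UNIV_ge:
  assumes "CARD('f::{field,finite}) \<ge> 3" "r \<le> CARD('n)"
  shows "real CARD('f) ^ (r * CARD('n)) \<le> 2 * real (card (frames r (UNIV :: ('f ^ 'n) set)))"
proof -
  let ?q = "real CARD('f)" and ?n = "CARD('n)"
  have q: "?q \<ge> 3" using assms(1) by simp
  have prod: "?q ^ (l * ?n) * (1 - ?q ^ l / (2 * ?q ^ ?n)) \<le> (\<Prod>i<l. ?q ^ ?n - ?q ^ i)" if "l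
    \<le> ?n" for l
    using that
  proof (induction l)
    case (Suc l)
    define x where "x = ?q ^ l / ?q ^ ?n"
    have "?q ^ l \<le> ?q ^ ?n" using Suc(2) q by (intro power_increasing) auto
    then have x: "0 \<le> x" "x \<le> 1" using q by (auto simp: x_def divide_simps)
    have "1 - ?q ^ Suc l / (2 * ?q ^ ?n) = 1 - ?q * x / 2" by (simp add: x_def)
    also have "\<dots> \<le> (1 - x / 2) * (1 - x)"
    proof -
      have "3 * x \<le> ?q * x" using q x by (intro mult_right_mono) auto
      moreover have "(1 - x / 2) * (1 - x) = 1 - 3 * x / 2 + x * x / 2" by (simp add: field_simps)
      moreover have "0 \<le> x * x" by simp
      ultimately show ?thesis by linarith
    qed
    finally have "?q ^ (l * ?n) * ?q ^ ?n * (1 - ?q ^ Suc l / (2 * ?q ^ ?n))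
        \<le> ?q ^ (l * ?n) * ?q ^ ?n * ((1 - x / 2) * (1 - x))"
      using q by (intro mult_left_mono) auto
    also have "\<dots> = (?q ^ (l * ?n) * (1 - ?q ^ l / (2 * ?q ^ ?n))) * (?q ^ ?n - ?q ^ l)"
      using q by (simp add: x_def field_simps)
    also have "\<dots> \<le> (\<Prod>i<l. ?q ^ ?n - ?q ^ i) * (?q ^ ?n - ?q ^ l)"
      using Suc \<open>?q ^ l \<le> ?q ^ ?n\<close> by (intro mult_right_mono) auto
    finally show ?case by (simp add: power_add mult.commute)
  qed simp
  have "real (\<Prod>i<r. CARD('f) ^ ?n - CARD('f) ^ i) = (\<Prod>i<r. ?q ^ ?n - ?q ^ i)"
    unfolding of_nat_prod
  proof (rule prod.cong[OF refl])
    fix i assume "i \<in> {..<r}"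
    then have "CARD('f) ^ i \<le> CARD('f) ^ ?n" using assms by (intro power_increasing) auto
    then show "real (CARD('f) ^ ?n - CARD('f) ^ i) = ?q ^ ?n - ?q ^ i" by (simp add: of_nat_diff)
  qed
  moreover have "card (UNIV :: ('f ^ 'n) set) = CARD('f) ^ ?n" by simp
  ultimately have card: "real (card (frames r (UNIV :: ('f ^ 'n) set))) = (\<Prod>i<r. ?q ^ ?n - ?q ^ i)"
    using card_frames[of "UNIV :: ('f ^ 'n) set" ?n r] by (simp add: vec.subspace_UNIV)
  have "?q ^ r \<le> ?q ^ ?n" using assms q by (intro power_increasing) auto
  then have "1 / 2 \<le> 1 - ?q ^ r / (2 * ?q ^ ?n)" using q by (simp add: divide_simps)
  then have "?q ^ (r * ?n) * (1 / 2) \<le> ?q ^ (r * ?n) * (1 - ?q ^ r / (2 * ?q ^ ?n))"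
    by (intro mult_left_mono) auto
  then show ?thesis using prod[OF assms(2)] card by linarith
qed

text \<open>All subspaces of dimension \<open>r\<close> have the same number of frames, and distinct
  subspaces share none, because a frame spans its subspace. A proportion of tuples thus becomes a
  proportion of subspaces; the factor 2 pays for the dependent tuples.\<close>

lemma grassmannian_proportion:
  fixes Bad :: "('f::{field,finite} ^ 'n) set set"
  assumes "CARD('f) \<ge> 3" "r \<le> CARD('n)" "Bad \<subseteq> grassmannian r"
  shows "real (card Bad) * real CARD('f) ^ (r * CARD('n))
      \<le> 2 * real (card (\<Union>S\<in>Bad. frames r S)) * real (card (grassmannian r :: ('f ^ 'n) set set))"
    and "card (grassmannian r :: ('f ^ 'n) set set) > 0"
proof -
  let ?q = "CARD('f)"
  define K where "K = (\<Prod>i<r. ?q ^ r - ?q ^ i)"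
  have K: "card (frames r S) = K" if "S \<in> grassmannian r" for S :: "('f ^ 'n) set"
    using card_frames[of S r r] card_subspace[of S] that by (simp add: grassmannian_def K_def)
  have UN: "card (\<Union>S\<in>\<S>. frames r S) = card \<S> * K" if "\<S>
    \<subseteq> grassmannian r" for \<S> :: "('f ^ 'n) set set"
  proof -
    have "card (\<Union>S\<in>\<S>. frames r S) = (\<Sum>S\<in>\<S>. card (frames r S))"
    proof (rule card_UN_disjoint)
      show "\<forall>S\<in>\<S>. finite (frames r S)"
        by (auto simp: frames_def intro: finite_subset[OF _ finite_PiE[of "{..<r}" "\<lambda>_. UNIV"]])
      show "\<forall>S\<in>\<S>. \<forall>S'\<in>\<S>. S \<noteq> S' \<longrightarrow> frames r S \<inter> frames r S' = {}"
      proof (intro ballI impI equals0I)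
        fix S S' w assume "S \<in> \<S>" "S' \<in> \<S>" "S \<noteq> S'" "w \<in> frames r S \<inter> frames r S'"
        then show False
          using frame_range[of S r w] frame_range[of S' r w] that by (auto simp: grassmannian_def)
      qed
    qed simp
    also have "\<dots> = card \<S> * K" using that K by (simp add: subset_iff)
    finally show ?thesis .
  qed
  have all: "card (frames r (UNIV :: ('f ^ 'n) set))
    = card (grassmannian r :: ('f ^ 'n) set set) * K"
    using UN[of "grassmannian r"] by (simp add: frames_UN)
  have ge: "real ?q ^ (r * CARD('n))
    \<le> 2 * (real (card (grassmannian r :: ('f ^ 'n) set set)) * real K)"
    using card_frames_UNIV_ge[where 'f = 'f and 'n = 'n, OF assms(1,2)] all by simp
  have "0 < real ?q ^ (r * CARD('n))" by simp
  then have "card (grassmannian r :: ('f ^ 'n) set set) * K > 0" using ge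
    by (metis gr0I less_le_not_le mult_zero_right of_nat_0 of_nat_mult)
  then show "card (grassmannian r :: ('f ^ 'n) set set) > 0" by simp
  have "real (card Bad) * real ?q ^ (r * CARD('n))
      \<le> real (card Bad) * (2 * (real (card (grassmannian r :: ('f ^ 'n) set set)) * real K))"
    using ge by (intro mult_left_mono) auto
  also have "\<dots> = 2 * real (card Bad * K) * real (card (grassmannian r :: ('f ^ 'n) set set))"
    by simp
  finally show "real (card Bad) * real ?q ^ (r * CARD('n))
      \<le> 2 * real (card (\<Union>S\<in>Bad. frames r S)) * real (card (grassmannian r :: ('f ^ 'n) set set))"
    by (simp add: UN[OF assms(3)])
qed

section \<open>Equidistribution over the translates of a random subspace\<close>

text \<open>Every frame of a rich subspace parametrises it bijectively and is therefore a rich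
  tuple, so the bound for tuples applies to the union of all these frames.\<close>

lemma rich_subspaces_bound:
  fixes \<phi> :: "'f::{field,finite} ^ 'n \<Rightarrow> real" and Bad :: "('f ^ 'n) set set" and r :: nat
  defines "q \<equiv> real CARD('f)" and "n \<equiv> CARD('n)"
  defines "A \<equiv> (\<Sum>y\<in>UNIV. \<phi> y) / q ^ n" and "Q \<equiv> (\<Sum>y\<in>UNIV. (\<phi> y)\<^sup>2) / q ^ n"
  assumes q3: "CARD('f) \<ge> 3" and r: "r \<le> n"
    and \<phi>: "\<And>y. \<bar>\<phi> y\<bar> \<le> 1 / (2 * real n)" and \<eta>: "\<eta> > 0"
    and Bad: "Bad \<subseteq> grassmannian r"
    and rich: "\<And>S. S \<in> Bad \<Longrightarrow> \<exists>a. q ^ r * (A + real n * Q + \<eta>) \<le> (\<Sum>y\<in>S. \<phi> (a + y))"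
  shows "q ^ r * \<eta> * real (card Bad) \<le> 8 * q * real (card (grassmannian r :: ('f ^ 'n) set set))"
proof -
  define W where "W = (\<Union>S\<in>Bad. frames r S)"
  define conv where "conv w = (\<lambda>l\<in>{..<r}. \<lambda>i. w l $ i)" for w :: "nat \<Rightarrow> 'f ^ 'n"
  define \<psi> where "\<psi> y = \<phi> (\<chi> i. y i)" for y
  have reindex: "(\<Sum>y\<in>UNIV. g (\<chi> i. y i)) = (\<Sum>y\<in>UNIV. g y)" for g :: "'f ^ 'n \<Rightarrow> real"
    by (rule sum.reindex_bij_witness[where i = "\<lambda>y i. y $ i" and j = "\<lambda>y. \<chi> i. y i"]) auto
  have A: "(\<Sum>y\<in>UNIV. \<psi> y) / q ^ n = A" and Q: "(\<Sum>y\<in>UNIV. (\<psi> y)\<^sup>2) / q ^ n = Q"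
    using reindex[of \<phi>] reindex[of "\<lambda>y. (\<phi> y)\<^sup>2"] by (simp_all add: \<psi>_def A_def Q_def)
  have inj: "inj_on conv W"
  proof (rule inj_onI)
    fix w w' assume w: "w \<in> W" "w' \<in> W" and eq: "conv w = conv w'"
    have "w l = w' l" if "l < r" for l
      using fun_cong[OF eq, of l] that by (simp add: conv_def vec_eq_iff fun_eq_iff)
    moreover have "w \<in> PiE {..<r} (\<lambda>_. UNIV)" "w' \<in> PiE {..<r} (\<lambda>_. UNIV)"
      using w by (auto simp: W_def frames_def PiE_def)
    ultimately show "w = w'" by (intro PiE_ext) auto
  qed
  have "q ^ r * real (card (conv ` W)) * \<eta> \<le> 4 * q * q ^ (r * n)"
    unfolding q_def n_def
  proof (rule rich_flats_bound[where \<phi> = \<psi>])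
    show "\<bar>\<psi> y\<bar> \<le> 1 / (2 * real CARD('n))" for y using \<phi> by (simp add: \<psi>_def n_def)
    show "conv ` W \<subseteq> PiE {..<r} (\<lambda>_. UNIV)" by (auto simp: conv_def)
    fix w' assume "w' \<in> conv ` W"
    then obtain w S where w: "w' = conv w" "S \<in> Bad" "w \<in> frames r S" by (auto simp: W_def)
    from w(2) Bad have S: "vec.subspace S" "vec.dim S = r" by (auto simp: grassmannian_def)
    from rich[OF w(2)] obtain a where a: "q ^ r * (A + real n * Q + \<eta>) \<le> (\<Sum>y\<in>S. \<phi> (a + y))" by blast
    have "S = lincomb r w ` PiE {..<r} (\<lambda>_. UNIV)"
      using frame_range[OF S w(3)] range_lincomb[of r w] by simp
    moreover have "inj_on (lincomb r w) (PiE {..<r} (\<lambda>_. UNIV))"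
      using w(3) by (intro inj_on_lincomb) (simp add: frames_def)
    ultimately have "(\<Sum>y\<in>S. \<phi> (a + y)) = (\<Sum>T\<in>PiE {..<r} (\<lambda>_. UNIV). \<phi> (a + lincomb r w T))"
      by (simp add: sum.reindex)
    also have "\<dots> = (\<Sum>T\<in>PiE {..<r} (\<lambda>_. UNIV). \<psi> (\<lambda>i. a $ i + (\<Sum>l<r. T l * w' l i)))"
    proof (rule sum.cong[OF refl])
      fix T
      have "a + lincomb r w T = (\<chi> i. a $ i + (\<Sum>l<r. T l * w' l i))"
        by (simp add: vec_eq_iff lincomb_def w(1) conv_def)
      then show "\<phi> (a + lincomb r w T) = \<psi> (\<lambda>i. a $ i + (\<Sum>l<r. T l * w' l i))" by (simp add: \<psi>_def)
    qed
    finally show "\<exists>a. real CARD('f) ^ r * ((\<Sum>y\<in>UNIV. \<psi> y) / real CARD('f) ^ CARD('n) +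
        real CARD('n) * ((\<Sum>y\<in>UNIV. (\<psi> y)\<^sup>2) / real CARD('f) ^ CARD('n)) + \<eta>)
        \<le> (\<Sum>T\<in>PiE {..<r} (\<lambda>_. UNIV). \<psi> (\<lambda>i. a i + (\<Sum>l<r. T l * w' l i)))"
      using a A Q by (intro exI[of _ "\<lambda>i. a $ i"]) (simp add: q_def n_def)
  qed (rule \<eta>)
  then have W: "q ^ r * real (card W) * \<eta> \<le> 4 * q * q ^ (r * n)" by (simp add: card_image[OF inj])
  have q0: "q > 0" using q3 by (simp add: q_def)
  let ?G = "real (card (grassmannian r :: ('f ^ 'n) set set))"
  have "q ^ r * \<eta> * (real (card Bad) * q ^ (r * n)) \<le> q ^ r * \<eta> * (2 * real (card W) * ?G)"
    using grassmannian_proportion(1)[OF q3 r[unfolded n_def] Bad] q0 \<eta>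
    by (intro mult_left_mono) (auto simp: q_def n_def W_def)
  also have "\<dots> = 2 * ?G * (q ^ r * real (card W) * \<eta>)" by (simp only: mult_ac)
  also have "\<dots> \<le> 2 * ?G * (4 * q * q ^ (r * n))" using W by (intro mult_left_mono) auto
  finally have "q ^ r * \<eta> * real (card Bad) * q ^ (r * n) \<le> 8 * q * ?G * q ^ (r * n)"
    by (simp only: mult_ac)
  then show ?thesis using q0 by simp
qed

text \<open>Excess and deficit are two instances, \<open>\<sigma> = 1\<close> and
  \<open>\<sigma> = -1\<close>, of one bound and contribute half of the constant 64 each. The
  existential over \<open>a\<close> stays inside the bad event, so the estimate is uniform in the
  translate.\<close>

theorem flats_equidistributed:
  fixes f :: "'f::{field,finite} ^ 'n \<Rightarrow> real" and r :: nat
  defines "q \<equiv> real CARD('f)" and "n \<equiv> CARD('n)"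
  defines "\<mu> \<equiv> (\<Sum>y\<in>UNIV. f y) / q ^ n"
  assumes q3: "CARD('f) \<ge> 3" and r: "r \<le> n"
    and f: "\<And>y. 0 \<le> f y" "\<And>y. f y \<le> M" and \<mu>: "\<mu> > 0" and \<epsilon>: "0 < \<epsilon>" "\<epsilon> \<le> 1"
  shows "real (card {S \<in> grassmannian r. \<exists>a. \<epsilon> * \<mu> * q ^ r < \<bar>(\<Sum>y\<in>S. f (a + y)) - \<mu> * q ^ r\<bar>})
    \<le> 64 * real n * q * M / (\<epsilon>\<^sup>2 * \<mu> * q ^ r) * real (card (grassmannian r :: ('f ^ 'n) set set))"
proof -
  let ?G = "real (card (grassmannian r :: ('f ^ 'n) set set))"
  have n: "real n \<ge> 1" unfolding n_def by (simp add: Suc_leI)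
  have q: "q \<ge> 3" using q3 by (simp add: q_def)
  have cardU: "real (card (UNIV :: ('f ^ 'n) set)) = q ^ n" by (simp add: q_def n_def)
  have M: "M > 0"
  proof (rule ccontr)
    assume "\<not> M > 0"
    then have "f y \<le> 0" for y using f(2)[of y] by linarith
    then have "(\<Sum>y\<in>UNIV. f y) \<le> 0" by (intro sum_nonpos)
    then have "\<mu> \<le> 0" unfolding \<mu>_def using q by (simp add: divide_nonpos_nonneg)
    then show False using \<mu> by simp
  qed
  have sum_f: "(\<Sum>y\<in>UNIV. f y) = \<mu> * q ^ n" using q by (simp add: \<mu>_def)
  define Bad where "Bad \<sigma> = {S \<in> grassmannian r. \<exists>a. \<epsilon> * \<mu> * q ^ r
    < \<sigma> * ((\<Sum>y\<in>S. f (a + y)) - \<mu> * q ^ r)}"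
    for \<sigma> :: real
  have bound: "real (card (Bad \<sigma>)) \<le> 32 * real n * q * M / (\<epsilon>\<^sup>2 * \<mu> * q ^ r) * ?G" if \<sigma>: "\<sigma>
    = 1 \<or> \<sigma> = -1" for \<sigma>
  proof -
    \<comment> \<open>Chosen so that the bound \<open>n * \<kappa>\<^sup>2 * M * \<mu>\<close> on
      the second-order loss equals \<open>\<eta>\<close>, half of the deviation
      \<open>\<epsilon> * \<kappa> * \<mu>\<close>; the other half is the gain required of a rich
      flat.\<close>
    define \<kappa> where "\<kappa> = \<epsilon> / (2 * real n * M)"
    have \<kappa>: "\<kappa> > 0" using \<epsilon> n M by (simp add: \<kappa>_def)
    define \<phi> where "\<phi> y = \<sigma> * \<kappa> * f y" for y
    define \<eta> where "\<eta> = \<epsilon> * \<kappa> * \<mu> / 2"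
    have \<eta>: "\<eta> > 0" using \<epsilon> \<kappa> \<mu> by (simp add: \<eta>_def)
    have avg: "(\<Sum>y\<in>UNIV. \<phi> y) / q ^ n = \<sigma> * \<kappa> * \<mu>"
      using q by (simp add: \<phi>_def sum_distrib_left[symmetric] sum_f)
    have sq: "real n * ((\<Sum>y\<in>UNIV. (\<phi> y)\<^sup>2) / q ^ n) \<le> \<eta>"
    proof -
      have "(\<phi> y)\<^sup>2 \<le> \<kappa>\<^sup>2 * M * f y" for y
      proof -
        have "(\<phi> y)\<^sup>2 = \<kappa>\<^sup>2 * (f y * f y)" using \<sigma> by (auto simp: \<phi>_def power2_eq_square)
        also have "\<dots> \<le> \<kappa>\<^sup>2 * (M * f y)" using f by (intro mult_left_mono mult_right_mono) auto
        finally show ?thesis by (simp add: mult.assoc)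
      qed
      then have "(\<Sum>y\<in>UNIV. (\<phi> y)\<^sup>2) \<le> \<kappa>\<^sup>2 * M * (\<mu> * q ^ n)"
        unfolding sum_f[symmetric] sum_distrib_left by (intro sum_mono)
      then have "(\<Sum>y\<in>UNIV. (\<phi> y)\<^sup>2) / q ^ n \<le> \<kappa>\<^sup>2 * M * \<mu>"
        using q by (simp add: pos_divide_le_eq mult.assoc)
      then have "real n * ((\<Sum>y\<in>UNIV. (\<phi> y)\<^sup>2) / q ^ n) \<le> real n * (\<kappa>\<^sup>2 * M * \<mu>)"
        by (intro mult_left_mono) auto
      also have "\<dots> = \<eta>" using n M by (simp add: \<eta>_def \<kappa>_def power2_eq_square field_simps)
      finally show ?thesis .
    qed
    have "q ^ r * \<eta> * real (card (Bad \<sigma>)) \<le> 8 * q * ?G"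
      unfolding q_def
    proof (rule rich_subspaces_bound[where \<phi> = \<phi>, OF q3 r[unfolded n_def] _ \<eta>])
      fix y
      have "\<kappa> * f y \<le> \<kappa> * M" using f(2) \<kappa> by (intro mult_left_mono) auto
      also have "\<dots> = \<epsilon> / (2 * real n)" using M by (simp add: \<kappa>_def)
      also have "\<dots> \<le> 1 / (2 * real n)" using \<epsilon> by (intro divide_right_mono) auto
      finally show "\<bar>\<phi> y\<bar> \<le> 1 / (2 * real CARD('n))"
        using \<sigma> \<kappa> f(1)[of y] by (auto simp: \<phi>_def abs_mult n_def)
    next
      show "Bad \<sigma> \<subseteq> grassmannian r" by (auto simp: Bad_def)
    next
      fix S assume "S \<in> Bad \<sigma>"
      then obtain a where a: "\<epsilon> * \<mu> * q ^ r < \<sigma> * ((\<Sum>y\<in>S. f (a + y)) - \<mu> * q ^ r)"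
        by (auto simp: Bad_def)
      have "q ^ r * (\<sigma> * \<kappa> * \<mu> + real n * ((\<Sum>y\<in>UNIV. (\<phi> y)\<^sup>2) / q ^ n) + \<eta>)
          \<le> q ^ r * (\<sigma> * \<kappa> * \<mu> + \<eta> + \<eta>)"
        using sq q by (intro mult_left_mono) auto
      also have "\<dots> = \<kappa> * (\<sigma> * \<mu> * q ^ r + \<epsilon> * \<mu> * q ^ r)" by (simp add: \<eta>_def algebra_simps)
      also have "\<dots> \<le> \<kappa> * (\<sigma> * (\<Sum>y\<in>S. f (a + y)))"
        using a \<kappa> by (intro mult_left_mono) (auto simp: algebra_simps)
      also have "\<dots> = (\<Sum>y\<in>S. \<phi> (a + y))" by (simp add: \<phi>_def sum_distrib_left mult_ac)
      finally show "\<exists>a. real CARD('f) ^ r * ((\<Sum>y\<in>UNIV. \<phi> y) / real CARD('f) ^ CARD('n) +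
        real CARD('n) * ((\<Sum>y\<in>UNIV. (\<phi> y)\<^sup>2) / real CARD('f) ^ CARD('n)) + \<eta>)
        \<le> (\<Sum>y\<in>S. \<phi> (a + y))"
        using avg by (auto simp: q_def n_def)
    qed
    then have "real (card (Bad \<sigma>)) \<le> 8 * q * ?G / (q ^ r * \<eta>)"
      using q \<eta> by (simp add: pos_le_divide_eq mult_ac)
    also have "\<dots> = 32 * real n * q * M / (\<epsilon>\<^sup>2 * \<mu> * q ^ r) * ?G"
      using q n M \<epsilon> \<mu> by (simp add: \<eta>_def \<kappa>_def field_simps power2_eq_square)
    finally show ?thesis .
  qed
  have "{S \<in> grassmannian r. \<exists>a. \<epsilon> * \<mu> * q ^ r < \<bar>(\<Sum>y\<in>S. f (a + y)) - \<mu> * q ^ r\<bar>}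
    \<subseteq> Bad 1 \<union> Bad (-1)"
    by (auto simp: Bad_def abs_if split: if_splits)
  then have "card {S \<in> grassmannian r. \<exists>a. \<epsilon> * \<mu> * q ^ r < \<bar>(\<Sum>y\<in>S. f (a + y)) - \<mu> * q ^ r\<bar>}
      \<le> card (Bad 1 \<union> Bad (-1))" by (intro card_mono) auto
  also have "\<dots> \<le> card (Bad 1) + card (Bad (-1))" by (rule card_Un_le)
  finally have "real (card {S \<in> grassmannian r. \<exists>a. \<epsilon> * \<mu> * q ^ r
    < \<bar>(\<Sum>y\<in>S. f (a + y)) - \<mu> * q ^ r\<bar>})
      \<le> real (card (Bad 1)) + real (card (Bad (-1)))"
        by (simp only: of_nat_le_iff of_nat_add[symmetric])
  also have "\<dots>
    \<le> 32 * real n * q * M / (\<epsilon>\<^sup>2 * \<mu> * q ^ r) * ?G + 32 * real n * q * M / (\<epsilon>\<^sup>2 * \<mu> * q ^ r) * ?G"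
    by (intro add_mono bound) auto
  finally show ?thesis by (simp add: algebra_simps)
qed

section \<open>Lattice points in convex bodies\<close>

lemma int_lattice_closed:
  "0 \<in> int_lattice" "x \<in> int_lattice \<Longrightarrow> y \<in> int_lattice \<Longrightarrow> x + y \<in> int_lattice"
  "x \<in> int_lattice \<Longrightarrow> y \<in> int_lattice \<Longrightarrow> x - y \<in> int_lattice" "x \<in> int_lattice \<Longrightarrow> - x \<in> int_lattice"
  by (auto simp: int_lattice_def)

lemma finite_int_lattice_bounded:
  fixes B :: "(real ^ 'n) set"
  assumes "bounded B"
  shows "finite (int_lattice \<inter> B)"
proof -
  obtain R where R: "\<And>x. x \<in> B \<Longrightarrow> norm x \<le> R" using assms by (auto simp: bounded_iff)
  define k where "k = \<lceil>R\<rceil>"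
  have "int_lattice \<inter> B \<subseteq> (\<lambda>f. \<chi> i. real_of_int (f i)) ` PiE UNIV (\<lambda>_ :: 'n. {-k..k})"
  proof
    fix x assume x: "x \<in> int_lattice \<inter> B"
    have "\<bar>x $ i\<bar> \<le> R" for i
      using component_le_norm_cart[of x i] R[of x] x by auto
    then have "\<bar>x $ i\<bar> \<le> real_of_int k" for i unfolding k_def
      by (meson le_of_int_ceiling order_trans)
    then have "-k \<le> \<lfloor>x $ i\<rfloor> \<and> \<lfloor>x $ i\<rfloor> \<le> k" for i
      by (smt (verit) floor_le_iff le_floor_iff of_int_minus)
    moreover have "x = (\<chi> i. real_of_int \<lfloor>x $ i\<rfloor>)" using x
      by (auto simp: vec_eq_iff int_lattice_def)
    ultimately show "x \<in> (\<lambda>f. \<chi> i. real_of_int (f i)) ` PiE UNIV (\<lambda>_ :: 'n. {-k..k})"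
      by (intro image_eqI[of _ _ "\<lambda>i. \<lfloor>x $ i\<rfloor>"]) auto
  qed
  then show ?thesis by (rule finite_subset) (intro finite_imageI finite_PiE; simp)
qed

lemma finite_int_lattice_coset:
  fixes A :: "(real ^ 'n) set"
  assumes "bounded A"
  shows "finite {z \<in> int_lattice. y + z \<in> A}"
proof (rule finite_subset)
  show "{z \<in> int_lattice. y + z \<in> A} \<subseteq> int_lattice \<inter> (+) (- y) ` A"
  proof
    fix z assume z: "z \<in> {z \<in> int_lattice. y + z \<in> A}"
    have "z = - y + (y + z)" by simp
    then show "z \<in> int_lattice \<inter> (+) (- y) ` A" using z by blast
  qed
qed (intro finite_int_lattice_bounded bounded_translation assms)

section \<open>Averages over the unit cell\<close>

definition unit_cell :: "(real ^ 'n) set"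
  where "unit_cell = {x. \<forall>i. 0 \<le> x $ i \<and> x $ i < 1}"

lemma unit_cell_unique:
  assumes "x - z \<in> unit_cell" "x - z' \<in> unit_cell" "z \<in> int_lattice" "z' \<in> int_lattice"
  shows "z = z'"
proof -
  have "z $ i = z' $ i" for i
  proof -
    have "z $ i - z' $ i \<in> \<int>" "\<bar>z $ i - z' $ i\<bar> < 1"
      using assms by (auto simp: unit_cell_def int_lattice_def) (smt (verit))
    then show ?thesis using Ints_nonzero_abs_less1 by fastforce
  qed
  then show ?thesis by (simp add: vec_eq_iff)
qed

lemma unit_cell_exists: "\<exists>z\<in>int_lattice. x - z \<in> unit_cell"
  by (rule bexI[of _ "\<chi> i. real_of_int \<lfloor>x $ i\<rfloor>"])
    (auto simp: unit_cell_def int_lattice_def, linarith+)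

lemma unit_cell_measure: "(unit_cell :: (real ^ 'n) set) \<in> lmeasurable" "measure lebesgue
  (unit_cell :: (real ^ 'n) set) = 1"
proof -
  have sub: "box 0 1 \<subseteq> (unit_cell :: (real ^ 'n) set)" "(unit_cell :: (real ^ 'n) set) \<subseteq> cbox 0 1"
    by (auto simp: unit_cell_def mem_box_cart less_imp_le)
  have "convex (unit_cell :: (real ^ 'n) set)"
  proof -
    have eq: "(unit_cell :: (real ^ 'n) set) = (\<Inter>i. {x. 0 \<le> x $ i} \<inter> {x. x $ i < 1})"
      by (auto simp: unit_cell_def)
    have c: "convex {x :: real ^ 'n. 0 \<le> x $ i}" "convex {x :: real ^ 'n. x $ i < 1}" for i
      using convex_halfspace_ge[of 0 "axis i (1::real)"] convex_halfspace_lt[of "axis i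
        (1::real)" 1]
      by (simp_all add: inner_axis' inner_axis)
    show ?thesis unfolding eq by (intro convex_INT convex_Int c)
  qed
  moreover have "bounded (unit_cell :: (real ^ 'n) set)" using sub(2) bounded_cbox bounded_subset
    by blast
  ultimately show m: "(unit_cell :: (real ^ 'n) set) \<in> lmeasurable" by (rule measurable_convex)
  have "measure lebesgue (cbox 0 1 :: (real ^ 'n) set)
    = 1" "measure lebesgue (box 0 1 :: (real ^ 'n) set) = 1"
  proof -
    have "(1 :: real ^ 'n) \<bullet> b = 1" if "b \<in> Basis" for b
      using that by (auto simp: Basis_vec_def inner_axis)
    then show "measure lebesgue (cbox 0 1 :: (real ^ 'n) set)
      = 1" "measure lebesgue (box 0 1 :: (real ^ 'n) set) = 1"
      by (simp_all add: measure_completion measure_lborel_box_eq measure_lborel_cbox_eq)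
  qed
  moreover have "measure lebesgue (box 0 1 :: (real ^ 'n) set)
    \<le> measure lebesgue (unit_cell :: (real ^ 'n) set)"
    using sub(1) m by (intro measure_mono_fmeasurable) (auto simp: fmeasurableD)
  moreover have "measure lebesgue (unit_cell :: (real ^ 'n) set)
    \<le> measure lebesgue (cbox 0 1 :: (real ^ 'n) set)"
    using sub(2) m by (intro measure_mono_fmeasurable) (auto simp: fmeasurableD)
  ultimately show "measure lebesgue (unit_cell :: (real ^ 'n) set) = 1" by linarith
qed

text \<open>Folding \<open>A\<close> onto the torus: its volume is the average over the unit cell of the number of
  points of \<open>A\<close> in a coset of the integer lattice.\<close>

lemma measure_eq_average:
  fixes A :: "(real ^ 'n) set"
  assumes "bounded A" "A \<in> lmeasurable"
  obtains g :: "real ^ 'n \<Rightarrow> real" where "\<And>x. g x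
    = indicat_real unit_cell x * real (card {z \<in> int_lattice. x + z \<in> A})"
    "integrable lebesgue g" "measure lebesgue A = integral\<^sup>L lebesgue g"
proof -
  have bu: "bounded (unit_cell :: (real ^ 'n) set)"
    by (rule bounded_subset[OF bounded_cbox[of 0 1]])
      (auto simp: unit_cell_def mem_box_cart less_imp_le)
  \<comment> \<open>The finitely many lattice vectors by which a point of the unit cell can reach
    \<open>A\<close>.\<close>
  define Z where "Z = int_lattice \<inter> {a - u |a u. a \<in> A \<and> u \<in> unit_cell}"
  have finZ: "finite Z" unfolding Z_def
  proof (rule finite_int_lattice_bounded)
    have "{a - u |a u. a \<in> A \<and> u \<in> unit_cell} = (\<Union>a\<in>A. \<Union>u\<in>unit_cell. {a - u})" by auto
    then show "bounded {a - u |a u. a \<in> A \<and> u \<in> unit_cell}"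
      using bounded_differences[OF assms(1) bu] by simp
  qed
  define T where "T z = unit_cell \<inter> (+) (- z) ` A" for z
  have Tm: "T z \<in> lmeasurable" for z
    unfolding T_def by (intro fmeasurable.Int unit_cell_measure measurable_translation assms)
  have shift: "(+) z ` T z = (+) z ` unit_cell \<inter> A" for z
    by (auto simp: T_def image_iff)
      (metis add.commute diff_add_cancel uminus_add_conv_diff add_uminus_conv_diff)
  have A: "A = (\<Union>z\<in>Z. (+) z ` T z)"
  proof (intro equalityI subsetI)
    fix x assume x: "x \<in> A"
    obtain z where z: "z \<in> int_lattice" "x - z \<in> unit_cell" using unit_cell_exists by blast
    have "z = x - (x - z)" by simp
    then have "z \<in> Z" using z x unfolding Z_def by blast
    moreover have "x \<in> (+) z ` unit_cell \<inter> A" using z x by (auto intro!: image_eqI[of _ _ "x - z"])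
    ultimately show "x \<in> (\<Union>z\<in>Z. (+) z ` T z)" using shift by blast
  qed (auto simp: shift)
  have "measure lebesgue A = (\<Sum>z\<in>Z. measure lebesgue ((+) z ` T z))"
    unfolding A
  proof (rule measure_finite_Union[OF finZ])
    show "(\<lambda>z. (+) z ` T z) ` Z \<subseteq> sets lebesgue"
      using Tm measurable_translation by (auto simp: fmeasurableD)
    show "disjoint_family_on (\<lambda>z. (+) z ` T z) Z"
      unfolding disjoint_family_on_def
    proof (intro ballI impI equals0I)
      fix z z' x assume "z \<in> Z" "z' \<in> Z" "z \<noteq> z'" "x \<in> (+) z ` T z \<inter> (+) z' ` T z'"
      then show False using unit_cell_unique[of x z z'] by (auto simp: Z_def T_def)
    qed
    show "emeasure lebesgue ((+) z ` T z) \<noteq> \<infinity>" if "z \<in> Z" for z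
      unfolding infinity_ennreal_def by (rule fmeasurableD2[OF measurable_translation[OF Tm]])
  qed
  also have "\<dots> = (\<Sum>z\<in>Z. measure lebesgue (T z))" by (simp only: measure_translation)
  also have "\<dots> = (\<Sum>z\<in>Z. integral\<^sup>L lebesgue (indicat_real (T z)))"
    using Tm by (intro sum.cong) (simp_all add: fmeasurableD)
  also have "\<dots> = integral\<^sup>L lebesgue (\<lambda>x. \<Sum>z\<in>Z. indicat_real (T z) x)"
    using Tm by (intro Bochner_Integration.integral_sum[symmetric])
      (simp add: lmeasurable_iff_integrable)
  finally have meas: "measure lebesgue A = integral\<^sup>L lebesgue (\<lambda>x. \<Sum>z\<in>Z. indicat_real (T z) x)" .
  show thesis
  proof (rule that[OF _ _ meas])
    show "integrable lebesgue (\<lambda>x. \<Sum>z\<in>Z. indicat_real (T z) x)"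
      using Tm by (intro Bochner_Integration.integrable_sum) (simp add: lmeasurable_iff_integrable)
    fix x
    show "(\<Sum>z\<in>Z. indicat_real (T z) x)
      = indicat_real unit_cell x * real (card {z \<in> int_lattice. x + z \<in> A})"
    proof (cases "x \<in> unit_cell")
      case True
      have mem: "x \<in> T z \<longleftrightarrow> x + z \<in> A" for z
        using True by (auto simp: T_def image_iff algebra_simps intro: bexI[of _ "x + z"])
      have "z \<in> Z" if "z \<in> int_lattice" "x + z \<in> A" for z
      proof -
        have "z = (x + z) - x" by simp
        then show ?thesis using that True unfolding Z_def by blast
      qed
      then have "{z \<in> int_lattice. x + z \<in> A} = {z \<in> Z. x \<in> T z}" by (auto simp: mem Z_def)
      moreover have "(\<Sum>z\<in>Z. indicat_real (T z) x) = real (card {z \<in> Z. x \<in> T z})"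
        using finZ by (simp add: indicator_def sum.If_cases Int_def)
      ultimately show ?thesis using True by simp
    qed (auto simp: T_def)
  qed
qed

text \<open>An average over a cell of volume one does not exceed a common upper bound. In this form
  volume estimates reduce to injections between sets of lattice points.\<close>

lemma measure_le_if_card_le:
  fixes A :: "(real ^ 'n) set"
  assumes "bounded A" "A \<in> lmeasurable" "\<And>x. card {z \<in> int_lattice. x + z \<in> A} \<le> N"
  shows "measure lebesgue A \<le> real N"
proof -
  obtain g where g: "\<And>x. g x = indicat_real unit_cell x * real (card {z \<in> int_lattice. x + z \<in> A})"
    "integrable lebesgue g" "measure lebesgue A = integral\<^sup>L lebesgue g"
    using measure_eq_average[OF assms(1,2)] by blast
  have "integral\<^sup>L lebesgue g
    \<le> integral\<^sup>L lebesgue (\<lambda>x :: real ^ 'n. indicat_real unit_cell x * real N)"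
  proof (rule Bochner_Integration.integral_mono)
    show "integrable lebesgue g" by (rule g(2))
    show "integrable lebesgue (\<lambda>x :: real ^ 'n. indicat_real unit_cell x * real N)"
      using unit_cell_measure(1)
        by (intro integrable_mult_left) (simp add: lmeasurable_iff_integrable)
  qed (use assms(3) in \<open>auto simp: g(1) intro!: mult_left_mono\<close>)
  also have "\<dots> = real N" using unit_cell_measure[where 'n = 'n] by (simp add: fmeasurableD)
  finally show ?thesis by (simp add: g(3))
qed

lemma measure_ge_if_card_ge:
  fixes A :: "(real ^ 'n) set"
  assumes "bounded A" "A \<in> lmeasurable" "\<And>x. N \<le> card {z \<in> int_lattice. x + z \<in> A}"
  shows "real N \<le> measure lebesgue A"
proof -
  obtain g where g: "\<And>x. g x = indicat_real unit_cell x * real (card {z \<in> int_lattice. x + z \<in> A})"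
    "integrable lebesgue g" "measure lebesgue A = integral\<^sup>L lebesgue g"
    using measure_eq_average[OF assms(1,2)] by blast
  have "integral\<^sup>L lebesgue (\<lambda>x :: real ^ 'n. indicat_real unit_cell x * real N)
    \<le> integral\<^sup>L lebesgue g"
  proof (rule Bochner_Integration.integral_mono)
    show "integrable lebesgue g" by (rule g(2))
    show "integrable lebesgue (\<lambda>x :: real ^ 'n. indicat_real unit_cell x * real N)"
      using unit_cell_measure(1)
        by (intro integrable_mult_left) (simp add: lmeasurable_iff_integrable)
  qed (use assms(3) in \<open>auto simp: g(1) intro!: mult_left_mono\<close>)
  moreover have "integral\<^sup>L lebesgue (\<lambda>x :: real ^ 'n. indicat_real unit_cell x * real N) = real N"
    using unit_cell_measure[where 'n = 'n] by (simp add: fmeasurableD)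
  ultimately show ?thesis unfolding g(3) by linarith
qed

section \<open>Lattice points in dilates of a convex covering body\<close>

lemma measure_scaleR: "measure lebesgue ((*\<^sub>R) a ` A)
  = \<bar>a\<bar> ^ CARD('n) * measure lebesgue (A :: (real ^ 'n) set)"
  using measure_lebesgue_affine[of a 0 A] by simp

lemma scaleR_convex_add:
  assumes "convex K" "0 \<le> a" "0 \<le> b" "u \<in> (*\<^sub>R) a ` K" "v \<in> (*\<^sub>R) b ` K"
  shows "u + v \<in> (*\<^sub>R) (a + b) ` K"
proof (cases "a + b = 0")
  case True
  then have "a = 0" "b = 0" using assms by auto
  then show ?thesis using assms by auto
next
  case False
  obtain x y where xy: "u = a *\<^sub>R x" "v = b *\<^sub>R y" "x \<in> K" "y \<in> K" using assms by auto
  have "(a / (a + b)) *\<^sub>R x + (b / (a + b)) *\<^sub>R y \<in> K"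
    using assms xy False by (intro convexD) (auto simp: add_divide_distrib[symmetric])
  moreover have "u + v = (a + b) *\<^sub>R ((a / (a + b)) *\<^sub>R x + (b / (a + b)) *\<^sub>R y)"
    using False by (simp add: xy scaleR_add_right)
  ultimately show ?thesis by blast
qed

context
  fixes K :: "(real ^ 'n) set"
  assumes K: "bounded K" "convex K" and cov: "is_covering int_lattice K"
begin

lemma covering_obtain:
  obtains l k where "x = l + k" "l \<in> int_lattice" "k \<in> K"
  using cov unfolding is_covering_def by blast

lemma scaled_lmeasurable: "(+) x ` (*\<^sub>R) a ` K \<in> lmeasurable"
  using K by (intro measurable_translation measurable_convex convex_scaling bounded_scaling)

lemma scaled_bounded: "bounded ((+) x ` (*\<^sub>R) a ` K)"
  using K by (intro bounded_translation bounded_scaling)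

lemma covering_measure_ge_1: "1 \<le> measure lebesgue K"
proof -
  have "real 1 \<le> measure lebesgue K"
  proof (rule measure_ge_if_card_ge)
    fix x :: "real ^ 'n"
    obtain l k where "x = l + k" "l \<in> int_lattice" "k \<in> K" by (rule covering_obtain)
    then have "- l \<in> {z \<in> int_lattice. x + z \<in> K}" by (auto simp: int_lattice_closed)
    moreover have "finite {z \<in> int_lattice. x + z \<in> K}" using K(1)
      by (rule finite_int_lattice_coset)
    ultimately show "1 \<le> card {z \<in> int_lattice. x + z \<in> K}"
      by (metis card_0_eq empty_iff less_one not_less)
  qed (use K measurable_convex in auto)
  then show ?thesis by simp
qed

text \<open>Any \<open>y\<close> is \<open>l + k\<close> with \<open>l\<close> in the lattice and
  \<open>k\<close> in \<open>K\<close>. Moving the lattice points of the body by \<open>- l\<close>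
  puts as many points of the coset of \<open>y\<close> into the body enlarged by one copy of
  \<open>K\<close>. Every coset meets the larger body at least that often, and its volume is the
  average of these numbers.\<close>

lemma card_lattice_le:
  assumes "a \<ge> 0"
  shows "real (card (int_lattice \<inter> (+) x ` (*\<^sub>R) a ` K)) \<le> (a + 1) ^ CARD('n) * measure lebesgue K"
proof -
  let ?A = "(+) x ` (*\<^sub>R) (a + 1) ` K"
  have "real (card (int_lattice \<inter> (+) x ` (*\<^sub>R) a ` K)) \<le> measure lebesgue ?A"
  proof (rule measure_ge_if_card_ge[OF scaled_bounded scaled_lmeasurable])
    fix y :: "real ^ 'n"
    obtain l k where lk: "y = l + k" "l \<in> int_lattice" "k \<in> K" by (rule covering_obtain)
    show "card (int_lattice \<inter> (+) x ` (*\<^sub>R) a ` K) \<le> card {z \<in> int_lattice. y + z \<in> ?A}"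
    proof (rule card_inj_on_le[of "\<lambda>z. z - l"])
      show "(\<lambda>z. z - l) ` (int_lattice \<inter> (+) x ` (*\<^sub>R) a ` K) \<subseteq> {z \<in> int_lattice. y + z \<in> ?A}"
      proof clarify
        fix z k' assume z: "x + a *\<^sub>R k' \<in> int_lattice" "k' \<in> K"
        have "a *\<^sub>R k' + 1 *\<^sub>R k \<in> (*\<^sub>R) (a + 1) ` K"
          using z lk assms by (intro scaleR_convex_add K) auto
        then have "x + (a *\<^sub>R k' + k) \<in> ?A" by simp
        then show "x + a *\<^sub>R k' - l \<in> int_lattice \<and> y + (x + a *\<^sub>R k' - l) \<in> ?A"
          using z lk by (simp add: int_lattice_closed algebra_simps)
      qed
      show "finite {z \<in> int_lattice. y + z \<in> ?A}" by (intro finite_int_lattice_coset scaled_bounded)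
    qed (auto simp: inj_on_def)
  qed
  then show ?thesis using assms by (simp add: measure_translation measure_scaleR)
qed

text \<open>The reverse injection: with \<open>- y = l + k\<close>, adding \<open>k\<close> moves
  the points of a coset in the smaller body to lattice points of the larger one, so the average over
  cosets is at most their number.\<close>

lemma card_lattice_ge:
  assumes "a \<ge> 1"
  shows "(a - 1) ^ CARD('n) * measure lebesgue K \<le> real (card (int_lattice \<inter> (+) x ` (*\<^sub>R) a ` K))"
proof -
  let ?A = "(+) x ` (*\<^sub>R) (a - 1) ` K"
  have "measure lebesgue ?A \<le> real (card (int_lattice \<inter> (+) x ` (*\<^sub>R) a ` K))"
  proof (rule measure_le_if_card_le[OF scaled_bounded scaled_lmeasurable])
    fix y :: "real ^ 'n"
    obtain l k where lk: "- y = l + k" "l \<in> int_lattice" "k \<in> K" by (rule covering_obtain)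
    show "card {z \<in> int_lattice. y + z \<in> ?A} \<le> card (int_lattice \<inter> (+) x ` (*\<^sub>R) a ` K)"
    proof (rule card_inj_on_le[of "\<lambda>z. z - l"])
      show "(\<lambda>z. z - l) ` {z \<in> int_lattice. y + z \<in> ?A} \<subseteq> int_lattice \<inter> (+) x ` (*\<^sub>R) a ` K"
      proof clarify
        fix z k' assume z: "z \<in> int_lattice" "y + z = x + (a - 1) *\<^sub>R k'" "k' \<in> K"
        have "(a - 1) *\<^sub>R k' + 1 *\<^sub>R k \<in> (*\<^sub>R) ((a - 1) + 1) ` K"
          using z lk assms by (intro scaleR_convex_add K) auto
        then have "x + ((a - 1) *\<^sub>R k' + k) \<in> (+) x ` (*\<^sub>R) a ` K" by simp
        moreover have "z - l = x + ((a - 1) *\<^sub>R k' + k)"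
        proof -
          have "l = - y - k" using lk(1) by (simp add: algebra_simps)
          then have "z - l = (y + z) + k" by simp
          then show ?thesis unfolding z(2) by (simp only: add.assoc)
        qed
        ultimately show "z - l \<in> int_lattice \<inter> (+) x ` (*\<^sub>R) a ` K"
          using int_lattice_closed(3)[OF z(1) lk(2)] by simp
      qed
    qed (auto simp: inj_on_def intro: finite_int_lattice_bounded scaled_bounded)
  qed
  then show ?thesis using assms by (simp add: measure_translation measure_scaleR)
qed

end

section \<open>Packings\<close>

lemma packing_unique:
  assumes "is_packing int_lattice K" "x + z \<in> K" "x + z' \<in> K" "z \<in> int_lattice" "z' \<in> int_lattice"
  shows "z = z'"
proof (rule ccontr)
  assume "z \<noteq> z'"
  then have "(+) (- z) ` K \<inter> (+) (- z') ` K = {}"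
    using assms(1)[unfolded is_packing_def disjoint_family_on_def, rule_format,
        OF int_lattice_closed(4)[OF assms(4)] int_lattice_closed(4)[OF assms(5)]] by simp
  moreover have "x \<in> (+) (- z) ` K" "x \<in> (+) (- z') ` K"
    using image_eqI[of x "(+) (- z)" "x + z" K] image_eqI[of x "(+) (- z')" "x + z'" K] assms(2,3)
    by simp_all
  ultimately show False by blast
qed

lemma packing_measure_le_1:
  fixes K :: "(real ^ 'n) set"
  assumes "bounded K" "convex K" "is_packing int_lattice K"
  shows "measure lebesgue K \<le> 1"
proof -
  have "measure lebesgue K \<le> real 1"
  proof (rule measure_le_if_card_le)
    fix x :: "real ^ 'n"
    show "card {z \<in> int_lattice. x + z \<in> K} \<le> 1"
      unfolding One_nat_def
      by (rule card_le_Suc0_iff_eq[THEN iffD2, OF finite_int_lattice_coset[OF assms(1)]])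
        (use packing_unique[OF assms(3)] in blast)
  qed (use assms measurable_convex in auto)
  then show ?thesis by simp
qed

text \<open>\<open>K\<close> need not contain the origin, so its smaller dilate need not lie in the
  larger one. Only differences matter: \<open>a *\<^sub>R (k - k') = b *\<^sub>R (k1 - k')\<close>
  for a point \<open>k1\<close> on the segment from \<open>k'\<close> to \<open>k\<close>, so a
  collision at scale \<open>a\<close> gives one at scale \<open>b\<close>.\<close>

lemma packing_mono:
  assumes "convex K" "0 < a" "a \<le> b" "is_packing L ((*\<^sub>R) b ` K)"
  shows "is_packing L ((*\<^sub>R) a ` K)"
  unfolding is_packing_def disjoint_family_on_def
proof (intro ballI impI equals0I)
  fix l l' x assume l: "l \<in> L" "l' \<in> L" "l \<noteq> l'" "x \<in> (+) l ` (*\<^sub>R) a ` K \<inter> (+) l' ` (*\<^sub>R) a ` K"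
  then obtain k k' where k: "k \<in> K" "k' \<in> K" "x = l + a *\<^sub>R k" "x = l' + a *\<^sub>R k'" by auto
  define k1 where "k1 = k' + (a / b) *\<^sub>R (k - k')"
  have "k1 = (a / b) *\<^sub>R k + (1 - a / b) *\<^sub>R k'" by (simp add: k1_def algebra_simps)
  then have "k1 \<in> K" using assms k by (auto intro!: convexD simp: divide_simps)
  moreover have "b *\<^sub>R k1 = b *\<^sub>R k' + a *\<^sub>R (k - k')"
    using assms by (simp add: k1_def scaleR_add_right)
  moreover have "a *\<^sub>R (k - k') = l' - l" using k(3,4) by (simp add: algebra_simps)
  ultimately have "b *\<^sub>R k1 = b *\<^sub>R k' + (l' - l)" by simp
  then have "l + b *\<^sub>R k1 = l' + b *\<^sub>R k'" by simp
  moreover have "l + b *\<^sub>R k1 \<in> (+) l ` (*\<^sub>R) b ` K" "l' + b *\<^sub>R k' \<in> (+) l' ` (*\<^sub>R) b ` K"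
    using \<open>k1 \<in> K\<close> k(2) by blast+
  ultimately have "(+) l ` (*\<^sub>R) b ` K \<inter> (+) l' ` (*\<^sub>R) b ` K \<noteq> {}" by auto
  then show False using assms(4) l(1-3) unfolding is_packing_def disjoint_family_on_def by blast
qed

section \<open>Covering and packing radii; construction A\<close>

lemma ex_packing:
  fixes K :: "(real ^ 'n) set"
  assumes "bounded K"
  shows "\<exists>a>0. is_packing int_lattice ((*\<^sub>R) a ` K)"
proof -
  obtain R where R: "R > 0" "\<And>x. x \<in> K \<Longrightarrow> norm x \<le> R" using assms by (auto simp: bounded_pos)
  \<comment> \<open>Points of the scaled body differ by at most \<open>1 / 2\<close> in every
    coordinate, so distinct lattice translates cannot meet.\<close>
  define a where "a = 1 / (4 * R)"
  have a: "a > 0" using R by (simp add: a_def)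
  have "l = l'" if l: "l \<in> int_lattice" "l' \<in> int_lattice" and k: "k \<in> K" "k' \<in> K"
    and eq: "l + a *\<^sub>R k = l' + a *\<^sub>R k'" for l l' k k' :: "real ^ 'n"
  proof -
    have "l $ i = l' $ i" for i
    proof -
      have "l $ i - l' $ i = a * (k' $ i - k $ i)"
        using arg_cong[OF eq, of "\<lambda>x. x $ i"] by (simp add: algebra_simps)
      moreover have "\<bar>k' $ i - k $ i\<bar> \<le> 2 * R"
        using component_le_norm_cart[of k i] component_le_norm_cart[of k' i] R(2)[OF k(1)] R(2)[OF
          k(2)]
        by linarith
      ultimately have "\<bar>l $ i - l' $ i\<bar> \<le> a * (2 * R)" using a by (simp add: abs_mult)
      then have "\<bar>l $ i - l' $ i\<bar> < 1" using R(1) by (simp add: a_def)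
      moreover have "l $ i - l' $ i \<in> \<int>" using l by (auto simp: int_lattice_def)
      ultimately show ?thesis using Ints_nonzero_abs_less1 by fastforce
    qed
    then show ?thesis by (simp add: vec_eq_iff)
  qed
  then have "is_packing int_lattice ((*\<^sub>R) a ` K)"
    unfolding is_packing_def disjoint_family_on_def by blast
  with a show ?thesis by blast
qed

lemma ex_covering:
  fixes K :: "(real ^ 'n) set"
  assumes "interior K \<noteq> {}"
  shows "\<exists>a>0. is_covering int_lattice ((*\<^sub>R) a ` K)"
proof -
  obtain x0 e where e: "e > 0" "ball x0 e \<subseteq> K" using assms by (auto simp: mem_interior)
  \<comment> \<open>The scaled ball has radius \<open>n + 1\<close>, more than the norm of any point
    of the unit cell.\<close>
  define a where "a = (real CARD('n) + 1) / e"
  have a: "a > 0" using e by (simp add: a_def add_nonneg_pos)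
  have "x \<in> {l + k |l k. l \<in> int_lattice \<and> k \<in> (*\<^sub>R) a ` K}" for x
  proof -
    obtain l where l: "l \<in> int_lattice" "x - a *\<^sub>R x0 - l \<in> unit_cell" using unit_cell_exists
      by blast
    define f where "f = x - a *\<^sub>R x0 - l"
    have "norm f \<le> (\<Sum>i\<in>UNIV. \<bar>f $ i\<bar>)" by (rule norm_le_l1_cart)
    also have "\<dots> \<le> (\<Sum>i\<in>(UNIV :: 'n set). 1)"
      using l(2) by (intro sum_mono) (auto simp: f_def unit_cell_def less_imp_le abs_le_iff)
    finally have "norm f < a * e" using e by (simp add: a_def)
    then have "norm ((1 / a) *\<^sub>R f) < e" using a by (simp add: divide_simps mult.commute)
    then have "x0 + (1 / a) *\<^sub>R f \<in> K" using e(2) by (auto simp: dist_norm subset_iff)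
    moreover have "x = l + a *\<^sub>R (x0 + (1 / a) *\<^sub>R f)" using a by (simp add: f_def scaleR_add_right)
    ultimately show ?thesis using l(1) by blast
  qed
  then have "is_covering int_lattice ((*\<^sub>R) a ` K)" unfolding is_covering_def by blast
  with a show ?thesis by blast
qed

text \<open>The radii are an infimum and a supremum that need not be attained; the strict inequality
  yields actual scales instead. Positive volume of \<open>K\<close> bounds the packing scales, so
  that the supremum is a genuine one.\<close>

lemma rho_less_obtain:
  fixes K :: "(real ^ 'n) set"
  assumes K: "bounded K" "convex K" "interior K \<noteq> {}" and rho: "rho K int_lattice
    < t" and t: "t > 0"
  obtains c \<rho> where "0 < c" "0 < \<rho>" "c < t * \<rho>" "is_covering int_lattice ((*\<^sub>R) c ` K)"
    "is_packing int_lattice ((*\<^sub>R) \<rho> ` K)"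
proof -
  define C where "C = {a. a > 0 \<and> is_covering int_lattice ((*\<^sub>R) a ` K)}"
  define P where "P = {a. a > 0 \<and> is_packing int_lattice ((*\<^sub>R) a ` K)}"
  have C: "C \<noteq> {}" using ex_covering[OF K(3)] by (auto simp: C_def)
  have P: "P \<noteq> {}" using ex_packing[OF K(1)] by (auto simp: P_def)
  have "open (interior K)" "bounded (interior K)" using K(1)
    by (auto intro: bounded_subset interior_subset)
  then have vol: "measure lebesgue K > 0"
  proof -
    have "0 < measure lebesgue (interior K)"
      using K(3) open_not_negligible[of
        "interior K"] measurable_convex[OF convex_interior[OF K(2)]] \<open>bounded (interior K)\<close>
      by (metis negligible_iff_measure open_interior zero_less_measure_iff)
    also have "\<dots> \<le> measure lebesgue K"
      using K by (intro measure_mono_fmeasurable interior_subset measurable_convex) auto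
    finally show ?thesis .
  qed
  have bdd: "bdd_above P"
  proof (rule bdd_aboveI)
    fix a assume a: "a \<in> P"
    show "a \<le> max 1 (1 / measure lebesgue K)"
    proof (cases "a \<le> 1")
      case False
      have "\<bar>a\<bar> ^ CARD('n) * measure lebesgue K \<le> 1"
        using packing_measure_le_1[of "(*\<^sub>R) a ` K"] a K
        by (simp add: P_def measure_scaleR bounded_scaling convex_scaling)
      moreover have "a ^ 1 \<le> a ^ CARD('n)" using False
        by (intro power_increasing) (auto simp: Suc_leI)
      ultimately have "a * measure lebesgue K \<le> 1"
        using False vol by (smt (verit) mult_right_mono power_one_right)
      then show ?thesis using vol by (simp add: pos_le_divide_eq le_max_iff_disj)
    qed simp
  qed
  obtain a0 where a0: "a0 \<in> P" using P by blast
  have "0 < a0" using a0 by (simp add: P_def)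
  also have "a0 \<le> Sup P" using a0 bdd by (rule cSup_upper)
  finally have SupP: "Sup P > 0" .
  have "Inf C / Sup P < t" using rho by (simp add: rho_def r_cov_def r_pack_def C_def P_def)
  then have "Inf C / t < Sup P" using SupP t by (simp add: divide_simps mult.commute)
  then obtain \<rho> where \<rho>: "\<rho> \<in> P" "Inf C / t < \<rho>" using less_cSupE[OF _ P] by blast
  then have "Inf C < t * \<rho>" using t by (simp add: divide_simps mult.commute)
  then obtain c where "c \<in> C" "c < t * \<rho>" using cInf_lessD[OF C] by blast
  with \<rho> show thesis by (intro that[of c \<rho>]) (auto simp: C_def P_def)
qed

text \<open>Take a coordinate set \<open>I\<close> of least size that still determines the elements
  of \<open>S\<close>. By minimality, dropping \<open>i\<close> leaves a nonzero element of
  \<open>S\<close> that vanishes on the rest of \<open>I\<close>; scaled at \<open>i\<close> it is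
  \<open>s i\<close>. In coding theory this is an information set with its systematic
  generators.\<close>

lemma information_set:
  fixes S :: "('f::{field,finite} ^ 'n) set"
  assumes S: "vec.subspace S"
  obtains I s where "\<And>x. x \<in> S \<Longrightarrow> (\<And>i. i \<in> I \<Longrightarrow> x $ i = 0) \<Longrightarrow> x = 0"
    "\<And>i. i \<in> I \<Longrightarrow> s i \<in> S" "\<And>i j. i \<in> I \<Longrightarrow> j \<in> I \<Longrightarrow> s i $ j = (if i = j then 1 else 0)"
    "card I = vec.dim S"
proof -
  define inf where "inf I \<longleftrightarrow> (\<forall>x\<in>S. (\<forall>i\<in>I. x $ i = 0) \<longrightarrow> x = 0)" for I
  have "inf UNIV" by (auto simp: inf_def vec_eq_iff)
  then obtain I where I: "inf I" "\<And>J. inf J \<Longrightarrow> card I \<le> card J"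
    using ex_has_least_nat[of inf UNIV card] by blast
  have "\<exists>s\<in>S. \<forall>j\<in>I. s $ j = (if i = j then 1 else 0)" if i: "i \<in> I" for i
  proof -
    have "\<not> inf (I - {i})"
    proof
      assume "inf (I - {i})"
      from I(2)[OF this] i show False by (metis card_Diff1_less finite not_less)
    qed
    then obtain x where x: "x \<in> S" "\<forall>j\<in>I - {i}. x $ j = 0" "x \<noteq> 0" by (auto simp: inf_def)
    then have "x $ i \<noteq> 0" using I(1) by (auto simp: inf_def)
    then have "(1 / x $ i) *s x \<in> S \<and> (\<forall>j\<in>I. ((1 / x $ i) *s x) $ j = (if i = j then 1 else 0))"
      using x S by (auto intro: vec.subspace_scale)
    then show ?thesis by blast
  qed
  then obtain s where s: "\<And>i. i \<in> I \<Longrightarrow> s i \<in> S \<and> (\<forall>j\<in>I. s i $ j = (if i = j then 1 else 0))" by metis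
  have "bij_betw (\<lambda>x. \<lambda>i\<in>I. x $ i) S (PiE I (\<lambda>_. UNIV :: 'f set))"
  proof (rule bij_betw_imageI)
    show "inj_on (\<lambda>x. \<lambda>i\<in>I. x $ i) S"
    proof (rule inj_onI)
      fix x y assume xy: "x \<in> S" "y \<in> S" and eq: "(\<lambda>i\<in>I. x $ i) = (\<lambda>i\<in>I. y $ i)"
      have "x $ i = y $ i" if "i \<in> I" for i using fun_cong[OF eq, of i] that by simp
      moreover have "x - y \<in> S" using S xy by (rule vec.subspace_diff)
      ultimately have "x - y = 0" using I(1) by (auto simp: inf_def)
      then show "x = y" by simp
    qed
    show "(\<lambda>x. \<lambda>i\<in>I. x $ i) ` S = PiE I (\<lambda>_. UNIV)"
    proof (intro equalityI subsetI)
      fix c assume c: "c \<in> PiE I (\<lambda>_. UNIV :: 'f set)"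
      define x where "x = (\<Sum>i\<in>I. c i *s s i)"
      have "x \<in> S" unfolding x_def using s S by (intro vec.subspace_sum vec.subspace_scale) auto
      moreover have xj: "x $ j = c j" if "j \<in> I" for j
      proof -
        have "x $ j = (\<Sum>i\<in>I. c i * s i $ j)" by (simp add: x_def)
        also have "\<dots> = (\<Sum>i\<in>I. if i = j then c i else 0)"
          by (rule sum.cong[OF refl]) (use that s in simp)
        finally show ?thesis using that by simp
      qed
      moreover have "c = (\<lambda>i\<in>I. x $ i)" using xj by (intro PiE_ext[OF c]) auto
      ultimately show "c \<in> (\<lambda>x. \<lambda>i\<in>I. x $ i) ` S" by blast
    qed auto
  qed
  then have "card S = CARD('f) ^ card I" by (simp add: bij_betw_same_card card_PiE)
  then have "card I = vec.dim S" using card_subspace[OF S] CARD_field_gt_1[where 'f = 'f] by simp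
  then show thesis using I(1) s by (intro that[of I s]) (auto simp: inf_def)
qed

lemma of_int_mod_ring_eq_0_iff: "(of_int k :: 'p::prime_card mod_ring) = 0 \<longleftrightarrow> int CARD('p) dvd k"
  using of_int_eq_iff_cong_CHAR[of k 0, where 'a = "'p mod_ring"] by (simp add: cong_0_iff)

lemma ex_int_mod_ring: "\<exists>k. of_int k = (x :: 'p::prime_card mod_ring)"
  by (rule exI[of _ "to_int_mod_ring x"]) (simp add: of_int_of_int_mod_ring)

text \<open>The basis consists of the unit vectors outside \<open>I\<close> and, for
  \<open>j\<close> in \<open>I\<close>, of the integer lift of \<open>s j\<close> divided by
  \<open>p\<close>. It factors into a unimodular matrix and a diagonal one with entry
  \<open>1 / p\<close> at the positions in \<open>I\<close>.\<close>

lemma lattice_basis_construction_A: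
  fixes S :: "('p::prime_card mod_ring ^ 'n) set"
  assumes S: "vec.subspace S"
  shows "\<exists>A. lattice_basis A (construction_A S) \<and> \<bar>det A\<bar> = 1 / real CARD('p) ^ vec.dim S"
proof -
  let ?p = "real CARD('p)"
  have p: "?p > 0" by simp
  obtain I s where I: "\<And>x. x \<in> S \<Longrightarrow> (\<And>i. i \<in> I \<Longrightarrow> x $ i = 0) \<Longrightarrow> x = 0"
    "\<And>i. i \<in> I \<Longrightarrow> s i \<in> S" "\<And>i j. i \<in> I \<Longrightarrow> j \<in> I \<Longrightarrow> s i $ j = (if i = j then 1 else 0)"
    "card I = vec.dim S"
    using information_set[OF S] by blast
  have "\<forall>j i. \<exists>k. of_int k = s j $ i" using ex_int_mod_ring by blast
  then obtain t :: "'n \<Rightarrow> 'n \<Rightarrow> int" where t: "\<And>j i. of_int (t j i) = s j $ i" by metis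
  \<comment> \<open>\<open>B (-1)\<close> is the inverse of \<open>B 1\<close>. Both have integer
    determinants with product \<open>1\<close>, so the determinant of \<open>B 1\<close> has
    absolute value \<open>1\<close>.\<close>
  define B :: "real \<Rightarrow> real ^ 'n ^ 'n"
    where "B \<sigma> = (\<chi> i j. if i = j then 1 else if i \<notin> I
      \<and> j \<in> I then \<sigma> * real_of_int (t j i) else 0)" for \<sigma>
  define dg where "dg j = (if j \<in> I then 1 / ?p else 1)" for j
  define D :: "real ^ 'n ^ 'n" where "D = (\<chi> i j. if i = j then dg j else 0)"
  define A where "A = B 1 ** D"
  have BB: "B 1 ** B (-1) = mat 1"
  proof -
    have "(B 1 ** B (-1)) $ i $ k = mat 1 $ i $ k" for i k
    proof (cases "i \<in> I")
      case True
      have "(\<Sum>j\<in>UNIV. B 1 $ i $ j * B (-1) $ j $ k) = (\<Sum>j\<in>UNIV. if i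
        = j then B (-1) $ j $ k else 0)"
        by (rule sum.cong[OF refl]) (use True in \<open>simp add: B_def\<close>)
      then have "(B 1 ** B (-1)) $ i $ k = B (-1) $ i $ k" by (simp add: matrix_matrix_mult_def)
      then show ?thesis using True by (simp add: B_def mat_def)
    next
      case False
      have "(B 1 ** B (-1)) $ i $ k = (\<Sum>j\<in>UNIV. B 1 $ i $ j * B (-1) $ j $ k)"
        by (simp add: matrix_matrix_mult_def)
      also have "\<dots> = (\<Sum>j\<in>UNIV. (if i = j then B (-1) $ j $ k else 0)
          + (if j = k then (if k \<in> I then real_of_int (t k i) else 0) else 0))"
        by (rule sum.cong[OF refl]) (use False in \<open>auto simp: B_def\<close>)
      also have "\<dots> = B (-1) $ i $ k + (if k \<in> I then real_of_int (t k i) else 0)"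
        by (simp add: sum.distrib)
      also have "\<dots> = mat 1 $ i $ k" using False by (auto simp: B_def mat_def)
      finally show ?thesis .
    qed
    then show ?thesis by (simp add: vec_eq_iff)
  qed
  have "\<bar>det (B 1)\<bar> = 1"
  proof -
    have prod: "det (B 1) * det (B (-1)) = 1" using BB by (metis det_I det_mul)
    have "det (B \<sigma>) \<in> \<int>" if "\<sigma> = 1 \<or> \<sigma> = -1" for \<sigma>
      by (rule det_Ints) (use that in \<open>auto simp: B_def\<close>)
    then have "det (B 1) \<in> \<int>" "det (B (-1)) \<in> \<int>" by auto
    moreover have "det (B 1) \<noteq> 0" "det (B (-1)) \<noteq> 0" using prod by auto
    ultimately have ge: "1 \<le> \<bar>det (B 1)\<bar>" "1 \<le> \<bar>det (B (-1))\<bar>"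
      by (simp_all add: Ints_nonzero_abs_ge1)
    have "\<bar>det (B 1)\<bar> * \<bar>det (B (-1))\<bar> = 1" using prod by (simp add: abs_mult[symmetric])
    moreover have "\<bar>det (B 1)\<bar> * 1 \<le> \<bar>det (B 1)\<bar> * \<bar>det (B (-1))\<bar>" using ge
      by (intro mult_left_mono) auto
    ultimately show ?thesis using ge by linarith
  qed
  moreover have "det D = 1 / ?p ^ card I"
  proof -
    have "det D = (\<Prod>i\<in>UNIV. D $ i $ i)" by (rule det_diagonal) (simp add: D_def)
    also have "\<dots> = (\<Prod>i\<in>UNIV. if i \<in> I then 1 / ?p else 1)" by (simp add: D_def dg_def)
    also have "\<dots> = (1 / ?p) ^ card I" by (simp add: prod.If_cases)
    finally show ?thesis by (simp add: power_divide)
  qed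
  ultimately have det: "\<bar>det A\<bar> = 1 / ?p ^ vec.dim S" by (simp add: A_def det_mul abs_mult I(4))
  then have inv: "invertible A" using p by (auto simp: invertible_det_nz)
  have A_entry: "A $ i $ j = B 1 $ i $ j * dg j" for i j
    by (simp add: A_def matrix_matrix_mult_def D_def if_distrib cong: if_cong)
  have Av: "(A *v (\<chi> i. real_of_int (\<zeta> i))) $ i
      = (1 / ?p) * real_of_int (if i \<in> I then \<zeta> i else int CARD('p) * \<zeta> i + (\<Sum>j\<in>I. t j i * \<zeta> j))"
        for \<zeta> i
  proof (cases "i \<in> I")
    case True
    have "(A *v (\<chi> i. real_of_int (\<zeta> i))) $ i = (\<Sum>j\<in>UNIV. A $ i $ j * real_of_int (\<zeta> j))"
      by (simp add: matrix_vector_mult_def)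
    also have "\<dots> = (\<Sum>j\<in>UNIV. if i = j then (1 / ?p) * real_of_int (\<zeta> j) else 0)"
      by (rule sum.cong[OF refl]) (use True in \<open>auto simp: A_entry B_def dg_def\<close>)
    finally show ?thesis using True by simp
  next
    case False
    have "(A *v (\<chi> i. real_of_int (\<zeta> i))) $ i = (\<Sum>j\<in>UNIV. A $ i $ j * real_of_int (\<zeta> j))"
      by (simp add: matrix_vector_mult_def)
    also have "\<dots> = (\<Sum>j\<in>UNIV. (if i = j then real_of_int (\<zeta> j) else 0)
        + (if j \<in> I then (1 / ?p) * real_of_int (t j i * \<zeta> j) else 0))"
      by (rule sum.cong[OF refl]) (use False in \<open>auto simp: A_entry B_def dg_def\<close>)
    also have "\<dots> = real_of_int (\<zeta> i) + (\<Sum>j\<in>I. (1 / ?p) * real_of_int (t j i * \<zeta> j))"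
      by (simp add: sum.distrib sum.If_cases)
    also have "\<dots> = (1 / ?p) * real_of_int (int CARD('p) * \<zeta> i + (\<Sum>j\<in>I. t j i * \<zeta> j))"
      by (simp add: distrib_left sum_distrib_left)
    finally show ?thesis using False by simp
  qed
  have mod_p: "(of_int (int CARD('p)) :: 'p mod_ring) = 0" by (simp add: of_int_mod_ring_eq_0_iff)
  have "construction_A S = (\<lambda>z. A *v z) ` int_lattice"
  proof (intro equalityI subsetI)
    fix x assume "x \<in> construction_A S"
    then obtain y where y: "x = (1 / ?p) *\<^sub>R (\<chi> i. real_of_int (y $ i))" "reduce_mod y \<in> S"
      by (auto simp: construction_A_def)
    \<comment> \<open>Subtracting the combination of generators clears the coordinates in
      \<open>I\<close>, which forces \<open>v = 0\<close>; the coordinates of \<open>y\<close>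
      outside \<open>I\<close> are then determined modulo \<open>p\<close> by those in
      \<open>I\<close>.\<close>
    define v where "v = reduce_mod y - (\<Sum>j\<in>I. of_int (y $ j) *s s j)"
    have "v \<in> S" unfolding v_def using y(2) I(2) S
      by (intro vec.subspace_diff vec.subspace_sum vec.subspace_scale) auto
    moreover have "v $ i = 0" if "i \<in> I" for i
    proof -
      have "(\<Sum>j\<in>I. of_int (y $ j) * s j $ i) = (\<Sum>j\<in>I. if j = i then of_int (y $ j) else 0)"
        using that I(3) by (intro sum.cong) auto
      then show ?thesis using that by (simp add: v_def reduce_mod_def)
    qed
    ultimately have v0: "v = 0" by (rule I(1))
    have "(of_int (y $ i - (\<Sum>j\<in>I. t j i * y $ j)) :: 'p mod_ring) = 0" for i
    proof -
      have "(of_int (y $ i - (\<Sum>j\<in>I. t j i * y $ j)) :: 'p mod_ring)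
          = of_int (y $ i) - (\<Sum>j\<in>I. of_int (y $ j) * s j $ i)"
        by (simp add: t mult.commute)
      also have "\<dots> = v $ i" by (simp add: v_def reduce_mod_def)
      finally show ?thesis using v0 by simp
    qed
    then have "int CARD('p) dvd y $ i - (\<Sum>j\<in>I. t j i * y $ j)" for i
      by (simp only: of_int_mod_ring_eq_0_iff)
    then have "\<forall>i. \<exists>k. y $ i = int CARD('p) * k + (\<Sum>j\<in>I. t j i * y $ j)"
      by (metis add.commute diff_add_cancel dvdE)
    then obtain k where k: "\<And>i. y $ i = int CARD('p) * k i + (\<Sum>j\<in>I. t j i * y $ j)" by metis
    define \<zeta> where "\<zeta> i = (if i \<in> I then y $ i else k i)" for i
    have "x = A *v (\<chi> i. real_of_int (\<zeta> i))"
    proof -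
      have "x $ i = (A *v (\<chi> i. real_of_int (\<zeta> i))) $ i" for i
      proof (cases "i \<in> I")
        case False
        have "(\<Sum>j\<in>I. t j i * \<zeta> j) = (\<Sum>j\<in>I. t j i * y $ j)" by (intro sum.cong) (auto simp: \<zeta>_def)
        then have "y $ i = int CARD('p) * \<zeta> i + (\<Sum>j\<in>I. t j i * \<zeta> j)"
          using k[of i] False by (simp add: \<zeta>_def)
        then show ?thesis using False unfolding Av y(1) by simp
      qed (simp add: Av y(1) \<zeta>_def)
      then show ?thesis by (simp add: vec_eq_iff)
    qed
    moreover have "(\<chi> i. real_of_int (\<zeta> i)) \<in> int_lattice" by (simp add: int_lattice_def)
    ultimately show "x \<in> (\<lambda>z. A *v z) ` int_lattice" by blast
  next
    fix x assume "x \<in> (\<lambda>z. A *v z) ` int_lattice"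
    then obtain z where z: "x = A *v z" "z \<in> int_lattice" by blast
    define \<zeta> where "\<zeta> i = \<lfloor>z $ i\<rfloor>" for i
    have \<zeta>: "z = (\<chi> i. real_of_int (\<zeta> i))" using z(2)
      by (auto simp: vec_eq_iff int_lattice_def \<zeta>_def)
    define y :: "int ^ 'n" where "y
      = (\<chi> i. if i \<in> I then \<zeta> i else int CARD('p) * \<zeta> i + (\<Sum>j\<in>I. t j i * \<zeta> j))"
    have "x = (1 / ?p) *\<^sub>R (\<chi> i. real_of_int (y $ i))"
      by (simp add: vec_eq_iff z(1) \<zeta> Av y_def)
    moreover have "reduce_mod y = (\<Sum>j\<in>I. of_int (\<zeta> j) *s s j)"
    proof -
      have "(of_int (y $ i) :: 'p mod_ring) = (\<Sum>j\<in>I. of_int (\<zeta> j) * s j $ i)" for i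
      proof (cases "i \<in> I")
        case True
        have "(\<Sum>j\<in>I. of_int (\<zeta> j) * s j $ i) = (\<Sum>j\<in>I. if j = i then of_int (\<zeta> j) else 0)"
          by (rule sum.cong[OF refl]) (use True I(3) in simp)
        then show ?thesis using True by (simp add: y_def)
      next
        case False
        then show ?thesis using mod_p by (simp add: y_def t mult.commute del: of_int_of_nat_eq)
      qed
      then show ?thesis by (simp add: vec_eq_iff reduce_mod_def)
    qed
    moreover have "(\<Sum>j\<in>I. of_int (\<zeta> j) *s s j) \<in> S"
      using S I(2) by (intro vec.subspace_sum vec.subspace_scale) auto
    ultimately show "x \<in> construction_A S" by (auto simp: construction_A_def)
  qed
  then show ?thesis using inv det by (auto simp: lattice_basis_def)
qed

lemma covol_construction_A:
  fixes S :: "('p::prime_card mod_ring ^ 'n) set"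
  assumes "vec.subspace S"
  shows "covol (construction_A S) = 1 / real CARD('p) ^ vec.dim S"
  using lattice_basis_construction_A[OF assms] covol_eq by metis

section \<open>Lattice points by residue class\<close>

definition of_int_vec :: "int ^ 'n \<Rightarrow> real ^ 'n"
  where "of_int_vec z = (\<chi> i. real_of_int (z $ i))"

definition fibre_count :: "(real ^ 'n) set \<Rightarrow> 'p::prime_card mod_ring ^ 'n \<Rightarrow> nat"
  where "fibre_count A v = card {z. reduce_mod z = v \<and> (1 / real CARD('p)) *\<^sub>R of_int_vec z \<in> A}"

lemma of_int_vec_eq_iff: "of_int_vec z = of_int_vec z' \<longleftrightarrow> z = z'"
  by (simp add: of_int_vec_def vec_eq_iff)

lemma of_int_vec_add: "of_int_vec (z + z') = of_int_vec z + of_int_vec z'"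
  and of_int_vec_diff: "of_int_vec (z - z') = of_int_vec z - of_int_vec z'"
  by (simp_all add: of_int_vec_def vec_eq_iff)

lemma range_of_int_vec: "range of_int_vec = int_lattice"
proof (intro equalityI subsetI)
  fix x :: "real ^ 'n" assume "x \<in> int_lattice"
  then have "x = of_int_vec (\<chi> i. \<lfloor>x $ i\<rfloor>)"
    by (auto simp: of_int_vec_def vec_eq_iff int_lattice_def)
  then show "x \<in> range of_int_vec" by blast
qed (auto simp: of_int_vec_def int_lattice_def)

lemma reduce_mod_add: "reduce_mod (z + z') = reduce_mod z + reduce_mod z'"
  and reduce_mod_diff: "reduce_mod (z - z') = reduce_mod z - reduce_mod z'"
  by (simp_all add: reduce_mod_def vec_eq_iff)

lemma surj_reduce_mod: "\<exists>z. reduce_mod z = (v :: 'p::prime_card mod_ring ^ 'n)"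
proof -
  have "\<forall>i. \<exists>k. of_int k = v $ i" using ex_int_mod_ring by blast
  then obtain k where "\<And>i. of_int (k i) = v $ i" by metis
  then have "reduce_mod (\<chi> i. k i) = v" by (simp add: reduce_mod_def vec_eq_iff)
  then show ?thesis by blast
qed

lemma reduce_mod_eq_0_iff:
  "reduce_mod z = (0 :: 'p::prime_card mod_ring ^ 'n)
    \<longleftrightarrow> (1 / real CARD('p)) *\<^sub>R of_int_vec z \<in> int_lattice"
proof -
  have "(of_int (z $ i) :: 'p mod_ring) = 0 \<longleftrightarrow> real_of_int (z $ i) / real CARD('p) \<in> \<int>" for i
  proof
    assume "(of_int (z $ i) :: 'p mod_ring) = 0"
    then obtain k where "z $ i = int CARD('p) * k" unfolding of_int_mod_ring_eq_0_iff by (elim dvdE)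
    then show "real_of_int (z $ i) / real CARD('p) \<in> \<int>" by simp
  next
    assume "real_of_int (z $ i) / real CARD('p) \<in> \<int>"
    then obtain k where "real_of_int (z $ i) / real CARD('p) = real_of_int k" by (elim Ints_cases)
    then have "real_of_int (z $ i) = real_of_int (k * int CARD('p))" by (simp add: divide_simps)
    then have "z $ i = k * int CARD('p)" by (simp only: of_int_eq_iff)
    then show "(of_int (z $ i) :: 'p mod_ring) = 0" unfolding of_int_mod_ring_eq_0_iff by simp
  qed
  then show ?thesis by (simp add: reduce_mod_def vec_eq_iff int_lattice_def of_int_vec_def)
qed

lemma finite_grid_bounded:
  fixes A :: "(real ^ 'n) set"
  assumes "bounded A" "t > 0"
  shows "finite {z. (1 / t) *\<^sub>R of_int_vec z \<in> A}"
proof -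
  have "of_int_vec ` {z. (1 / t) *\<^sub>R of_int_vec z \<in> A} \<subseteq> int_lattice \<inter> (*\<^sub>R) t ` A"
  proof clarify
    fix z :: "int ^ 'n" assume z: "(1 / t) *\<^sub>R of_int_vec z \<in> A"
    have "of_int_vec z = t *\<^sub>R ((1 / t) *\<^sub>R of_int_vec z)" using assms(2) by simp
    then have "of_int_vec z \<in> (*\<^sub>R) t ` A" using z by blast
    then show "of_int_vec z \<in> int_lattice \<inter> (*\<^sub>R) t ` A" using range_of_int_vec by blast
  qed
  then have "finite (of_int_vec ` {z. (1 / t) *\<^sub>R of_int_vec z \<in> A})"
    by (rule finite_subset) (intro finite_int_lattice_bounded bounded_scaling assms)
  then show ?thesis by (rule finite_imageD) (simp add: inj_on_def of_int_vec_eq_iff)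
qed

lemma finite_fibre:
  assumes "bounded A"
  shows "finite {z. reduce_mod z = (v :: 'p::prime_card mod_ring ^ 'n)
    \<and> (1 / real CARD('p)) *\<^sub>R of_int_vec z \<in> A}"
  by (rule finite_subset[OF _ finite_grid_bounded[OF assms, of "real CARD('p)"]]) auto

lemma sum_fibre_count:
  fixes S :: "('p::prime_card mod_ring ^ 'n) set"
  assumes "bounded A"
  shows "(\<Sum>v\<in>S. fibre_count A v) = card {z. reduce_mod z \<in> S
    \<and> (1 / real CARD('p)) *\<^sub>R of_int_vec z \<in> A}"
proof -
  have "card (\<Union>v\<in>S. {z. reduce_mod z = v \<and> (1 / real CARD('p)) *\<^sub>R of_int_vec z \<in> A})
    = (\<Sum>v\<in>S. fibre_count A v)"
    unfolding fibre_count_def by (rule card_UN_disjoint) (use finite_fibre[OF assms] in auto)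
  moreover have "(\<Union>v\<in>S. {z. reduce_mod z = v \<and> (1 / real CARD('p)) *\<^sub>R of_int_vec z \<in> A})
    = {z. reduce_mod z \<in> S \<and> (1 / real CARD('p)) *\<^sub>R of_int_vec z \<in> A}" by auto
  ultimately show ?thesis by simp
qed

lemma N_points_construction_A:
  fixes S :: "('p::prime_card mod_ring ^ 'n) set"
  assumes "bounded K"
  shows "N_points (construction_A S) K x = (\<Sum>v\<in>S. fibre_count ((+) x ` K) v)"
proof -
  let ?g = "\<lambda>z. (1 / real CARD('p)) *\<^sub>R of_int_vec z"
  have "construction_A S = ?g ` {z. reduce_mod z \<in> S}"
    by (auto simp: construction_A_def of_int_vec_def)
  moreover have "f ` Z \<inter> Y = f ` {z. z \<in> Z \<and> f z \<in> Y}" for f :: "int ^ 'n \<Rightarrow> real ^ 'n" and Z Y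
    by blast
  ultimately have eq: "construction_A S \<inter> (+) x ` K = ?g ` {z. reduce_mod z \<in> S \<and> ?g z \<in> (+) x ` K}"
    by simp
  have "N_points (construction_A S) K x = card {z. reduce_mod z \<in> S \<and> ?g z \<in> (+) x ` K}"
    unfolding N_points_def eq by (rule card_image) (simp add: inj_on_def of_int_vec_eq_iff)
  then show ?thesis using sum_fibre_count[OF bounded_translation[OF assms, of x], of S] by simp
qed

lemma fibre_count_mono:
  assumes "bounded A'" "A \<subseteq> A'"
  shows "fibre_count A (v :: 'p::prime_card mod_ring ^ 'n) \<le> fibre_count A' v"
  unfolding fibre_count_def by (rule card_mono[OF finite_fibre[OF assms(1)]]) (use assms(2) in auto)

text \<open>Moving the body by a grid vector translates the weight function on residues. All grid
  translates of a body are thus handled by the translates of \<open>S\<close> for one weight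
  function.\<close>

lemma fibre_count_shift:
  fixes v :: "'p::prime_card mod_ring ^ 'n"
  shows "fibre_count ((+) ((1 / real CARD('p)) *\<^sub>R of_int_vec g) ` A) v
    = fibre_count A (v - reduce_mod g)"
  unfolding fibre_count_def
proof (rule bij_betw_same_card[OF bij_betw_byWitness[where f = "\<lambda>z. z - g" and f' = "\<lambda>z. z + g"]])
  let ?e = "\<lambda>z. (1 / real CARD('p)) *\<^sub>R of_int_vec z"
  have e: "?e (z + z') = ?e z + ?e z'" "?e (z - z') = ?e z - ?e z'" for z z' :: "int ^ 'n"
    by (simp_all add: of_int_vec_add of_int_vec_diff scaleR_add_right scaleR_diff_right)
  show "(\<lambda>z. z - g) ` {z. reduce_mod z = v \<and> ?e z \<in> (+) (?e g) ` A}
      \<subseteq> {z. reduce_mod z = v - reduce_mod g \<and> ?e z \<in> A}"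
    by (auto simp: reduce_mod_diff e)
  show "(\<lambda>z. z + g) ` {z. reduce_mod z = v - reduce_mod g \<and> ?e z \<in> A}
      \<subseteq> {z. reduce_mod z = v \<and> ?e z \<in> (+) (?e g) ` A}"
    by (auto simp: reduce_mod_add e add.commute)
qed auto

text \<open>The grid points in one residue class form a coset of the integer lattice, so estimates
  for cosets bound single fibres.\<close>

lemma fibre_count_coset:
  fixes v :: "'p::prime_card mod_ring ^ 'n"
  shows "\<exists>y. fibre_count A v = card {l \<in> int_lattice. y + l \<in> A}"
proof -
  let ?e = "\<lambda>z. (1 / real CARD('p)) *\<^sub>R of_int_vec z"
  obtain z0 where z0: "reduce_mod z0 = v" using surj_reduce_mod by blast
  have iff: "reduce_mod z = v \<longleftrightarrow> ?e z - ?e z0 \<in> int_lattice" for z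
    using reduce_mod_eq_0_iff[of "z - z0", where 'p = 'p] z0
    by (simp add: reduce_mod_diff of_int_vec_diff scaleR_diff_right)
  have "bij_betw (\<lambda>z. ?e z - ?e z0) {z. reduce_mod z = v
    \<and> ?e z \<in> A} {l \<in> int_lattice. ?e z0 + l \<in> A}"
  proof (rule bij_betw_imageI)
    show "inj_on (\<lambda>z. ?e z - ?e z0) {z. reduce_mod z = v \<and> ?e z \<in> A}"
      by (simp add: inj_on_def of_int_vec_eq_iff)
    show "(\<lambda>z. ?e z - ?e z0) ` {z. reduce_mod z = v \<and> ?e z \<in> A} = {l \<in> int_lattice. ?e z0 + l \<in> A}"
    proof (intro equalityI subsetI)
      fix l assume l: "l \<in> {l \<in> int_lattice. ?e z0 + l \<in> A}"
      have "real CARD('p) *\<^sub>R l \<in> int_lattice" using l by (auto simp: int_lattice_def)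
      then obtain z1 where z1: "real CARD('p) *\<^sub>R l = of_int_vec z1" using range_of_int_vec by blast
      have "?e (z0 + z1) = ?e z0 + (1 / real CARD('p)) *\<^sub>R (real CARD('p) *\<^sub>R l)"
        unfolding z1 of_int_vec_add by (simp add: scaleR_add_right)
      then have e: "?e (z0 + z1) = ?e z0 + l" by simp
      then have "reduce_mod (z0 + z1) = v" using l unfolding iff by simp
      with e l show "l \<in> (\<lambda>z. ?e z - ?e z0) ` {z. reduce_mod z = v \<and> ?e z \<in> A}"
        by (intro image_eqI[of _ _ "z0 + z1"]) auto
    qed (auto simp: iff)
  qed
  then show ?thesis unfolding fibre_count_def using bij_betw_same_card by blast
qed

lemma fibre_count_packing:
  fixes v :: "'p::prime_card mod_ring ^ 'n"
  assumes "bounded A" "is_packing int_lattice A"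
  shows "fibre_count A v \<le> 1"
proof -
  obtain y where "fibre_count A v = card {l \<in> int_lattice. y + l \<in> A}" using fibre_count_coset
    by blast
  also have "\<dots> \<le> Suc 0"
    by (rule card_le_Suc0_iff_eq[THEN iffD2, OF finite_int_lattice_coset[OF assms(1)]])
      (use packing_unique[OF assms(2)] in blast)
  finally show ?thesis by simp
qed

lemma card_coset_eq: "card {l \<in> int_lattice. y + l \<in> (+) x ` A}
  = card (int_lattice \<inter> (+) (x - y) ` A)"
proof -
  have "{l \<in> int_lattice. y + l \<in> (+) x ` A} = int_lattice \<inter> (+) (x - y) ` A"
  proof (intro equalityI subsetI)
    fix l assume "l \<in> {l \<in> int_lattice. y + l \<in> (+) x ` A}"
    then obtain a where a: "l \<in> int_lattice" "a \<in> A" "y + l = x + a" by auto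
    then have "l = (x - y) + a" by (simp add: algebra_simps)
    with a show "l \<in> int_lattice \<inter> (+) (x - y) ` A" by blast
  qed auto
  then show ?thesis by simp
qed

lemma fibre_count_bounds:
  fixes K :: "(real ^ 'n) set" and v :: "'p::prime_card mod_ring ^ 'n"
  assumes K: "bounded K" "convex K" "is_covering int_lattice K"
  shows "a \<ge> 0 \<Longrightarrow> real (fibre_count ((+) x ` (*\<^sub>R) a ` K) v)
    \<le> (a + 1) ^ CARD('n) * measure lebesgue K"
    and "a \<ge> 1 \<Longrightarrow> (a - 1) ^ CARD('n) * measure lebesgue K
      \<le> real (fibre_count ((+) x ` (*\<^sub>R) a ` K) v)"
proof -
  obtain y where "fibre_count ((+) x ` (*\<^sub>R) a ` K) v
    = card {l \<in> int_lattice. y + l \<in> (+) x ` (*\<^sub>R) a ` K}"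
    using fibre_count_coset by blast
  then have eq: "fibre_count ((+) x ` (*\<^sub>R) a ` K) v
    = card (int_lattice \<inter> (+) (x - y) ` (*\<^sub>R) a ` K)"
    unfolding card_coset_eq .
  show "a \<ge> 0 \<Longrightarrow> real (fibre_count ((+) x ` (*\<^sub>R) a ` K) v)
    \<le> (a + 1) ^ CARD('n) * measure lebesgue K"
    unfolding eq by (rule card_lattice_le[OF K])
  show "a \<ge> 1 \<Longrightarrow> (a - 1) ^ CARD('n) * measure lebesgue K
    \<le> real (fibre_count ((+) x ` (*\<^sub>R) a ` K) v)"
    unfolding eq by (rule card_lattice_ge[OF K])
qed

text \<open>Summed over all residues, the grid points in the dilate by \<open>a / p\<close> become,
  after multiplication by \<open>p\<close>, the integer points in the dilate by
  \<open>a\<close>.\<close>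

lemma total_fibre_count_bounds:
  fixes K :: "(real ^ 'n) set"
  assumes K: "bounded K" "convex K" "is_covering int_lattice K"
  defines "T \<equiv> \<lambda>a. (\<Sum>v\<in>(UNIV :: ('p::prime_card mod_ring ^ 'n) set).
    real (fibre_count ((*\<^sub>R) (a / real CARD('p)) ` K) v))"
  shows "a \<ge> 0 \<Longrightarrow> T a \<le> (a + 1) ^ CARD('n) * measure lebesgue K"
    and "a \<ge> 1 \<Longrightarrow> (a - 1) ^ CARD('n) * measure lebesgue K \<le> T a"
proof -
  let ?p = "real CARD('p)"
  have p: "?p > 0" by simp
  let ?Z = "{z. (1 / ?p) *\<^sub>R of_int_vec z \<in> (*\<^sub>R) (a / ?p) ` K}"
  have "T a = real (\<Sum>v\<in>(UNIV :: ('p mod_ring ^ 'n) set). fibre_count ((*\<^sub>R) (a / ?p) ` K) v)"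
    by (simp add: T_def)
  also have "\<dots> = real (card ?Z)"
    by (subst sum_fibre_count) (auto intro: bounded_scaling K(1))
  also have "card ?Z = card (of_int_vec ` ?Z)"
    by (rule card_image[symmetric]) (simp add: inj_on_def of_int_vec_eq_iff)
  also have "of_int_vec ` ?Z = int_lattice \<inter> (+) 0 ` (*\<^sub>R) a ` K"
  proof (intro equalityI subsetI)
    fix x assume "x \<in> of_int_vec ` ?Z"
    then obtain z k where z: "x = of_int_vec z" "k \<in> K" "(1 / ?p) *\<^sub>R of_int_vec z
      = (a / ?p) *\<^sub>R k" by auto
    have "x = ?p *\<^sub>R ((1 / ?p) *\<^sub>R of_int_vec z)" by (simp add: z(1))
    also have "\<dots> = a *\<^sub>R k" unfolding z(3) by simp
    finally have "x \<in> (+) 0 ` (*\<^sub>R) a ` K" using z(2) by auto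
    moreover have "x \<in> int_lattice" unfolding z(1) range_of_int_vec[symmetric] by (rule rangeI)
    ultimately show "x \<in> int_lattice \<inter> (+) 0 ` (*\<^sub>R) a ` K" by blast
  next
    fix x assume x: "x \<in> int_lattice \<inter> (+) 0 ` (*\<^sub>R) a ` K"
    then obtain k where "k \<in> K" "x = a *\<^sub>R k" by auto
    moreover obtain z where "x = of_int_vec z" using x unfolding range_of_int_vec[symmetric]
      by blast
    ultimately have z: "x = of_int_vec z" "k \<in> K" "x = a *\<^sub>R k" by blast+
    have "(1 / ?p) *\<^sub>R of_int_vec z = (a / ?p) *\<^sub>R k" unfolding z(1)[symmetric] z(3) by simp
    then have "z \<in> ?Z" using z(2) by blast
    then show "x \<in> of_int_vec ` ?Z" unfolding z(1) by (rule imageI)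
  qed
  finally have eq: "T a = real (card (int_lattice \<inter> (+) 0 ` (*\<^sub>R) a ` K))" .
  show "a \<ge> 0 \<Longrightarrow> T a \<le> (a + 1) ^ CARD('n) * measure lebesgue K"
    unfolding eq by (rule card_lattice_le[OF K])
  show "a \<ge> 1 \<Longrightarrow> (a - 1) ^ CARD('n) * measure lebesgue K \<le> T a"
    unfolding eq by (rule card_lattice_ge[OF K])
qed

text \<open>A larger dilate of a covering body still covers, although it need not contain the
  smaller one: the point is first shifted by \<open>(t - 1) *\<^sub>R k0\<close> for a fixed
  \<open>k0\<close> in \<open>K\<close>.\<close>

lemma covering_scaled:
  fixes K :: "(real ^ 'n) set"
  assumes K: "convex K" "is_covering int_lattice K" and t: "t \<ge> 1"
  obtains l k where "x = of_int_vec l + t *\<^sub>R k" "k \<in> K"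
proof -
  obtain k0 where k0: "k0 \<in> K" using K(2) unfolding is_covering_def by blast
  obtain l k where lk: "x - (t - 1) *\<^sub>R k0 = l + k" "l \<in> int_lattice" "k \<in> K"
    using K(2) unfolding is_covering_def by blast
  have "1 *\<^sub>R k + (t - 1) *\<^sub>R k0 \<in> (*\<^sub>R) (1 + (t - 1)) ` K"
    using lk k0 t by (intro scaleR_convex_add K(1)) auto
  then obtain k' where k': "k' \<in> K" "k + (t - 1) *\<^sub>R k0 = t *\<^sub>R k'" by auto
  have "x = l + (k + (t - 1) *\<^sub>R k0)" using lk(1) by (simp add: algebra_simps)
  then show thesis using that k' lk(2) range_of_int_vec by (metis imageE)
qed

text \<open>The slack \<open>b - a \<ge> 1\<close> makes the dilate by \<open>b - a\<close> a
  covering body, so \<open>p *\<^sub>R x\<close> is an integer point plus an element of it;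
  convexity merges that element with the dilate by \<open>a\<close>. The inner approximation applies
  the same to \<open>- (p *\<^sub>R x)\<close>.\<close>

lemma grid_outer:
  fixes K :: "(real ^ 'n) set"
  assumes K: "convex K" "is_covering int_lattice K" and "p > 0" "0 \<le> a" "a + 1 \<le> b"
  shows "\<exists>g. (+) x ` (*\<^sub>R) (a / p) ` K \<subseteq> (+) ((1 / p) *\<^sub>R of_int_vec g) ` (*\<^sub>R) (b / p) ` K"
proof -
  obtain g k where gk: "p *\<^sub>R x = of_int_vec g + (b - a) *\<^sub>R k" "k \<in> K"
    using covering_scaled[OF K, of "b - a"] assms(5) by auto
  have "x = (1 / p) *\<^sub>R (p *\<^sub>R x)" using assms(3) by simp
  also have "\<dots> = (1 / p) *\<^sub>R of_int_vec g + ((b - a) / p) *\<^sub>R k" unfolding gk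
    by (simp add: scaleR_add_right)
  finally have x: "x = (1 / p) *\<^sub>R of_int_vec g + ((b - a) / p) *\<^sub>R k" .
  have "x + (a / p) *\<^sub>R k' \<in> (+) ((1 / p) *\<^sub>R of_int_vec g) ` (*\<^sub>R) (b / p) ` K" if "k' \<in> K" for k'
  proof -
    have "((b - a) / p) *\<^sub>R k + (a / p) *\<^sub>R k' \<in> (*\<^sub>R) ((b - a) / p + a / p) ` K"
      using gk that assms by (intro scaleR_convex_add K(1)) auto
    then have "((b - a) / p) *\<^sub>R k + (a / p) *\<^sub>R k' \<in> (*\<^sub>R) (b / p) ` K"
      by (simp add: add_divide_distrib[symmetric])
    then show ?thesis unfolding x add.assoc by (rule imageI)
  qed
  then show ?thesis by blast
qed

lemma grid_inner:
  fixes K :: "(real ^ 'n) set"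
  assumes K: "convex K" "is_covering int_lattice K" and "p > 0" "0 \<le> b" "b + 1 \<le> a"
  shows "\<exists>g. (+) ((1 / p) *\<^sub>R of_int_vec g) ` (*\<^sub>R) (b / p) ` K \<subseteq> (+) x ` (*\<^sub>R) (a / p) ` K"
proof -
  obtain g k where gk: "- (p *\<^sub>R x) = of_int_vec g + (a - b) *\<^sub>R k" "k \<in> K"
    using covering_scaled[OF K, of "a - b"] assms(5) by auto
  have neg: "of_int_vec (- g) = - of_int_vec g" by (simp add: of_int_vec_def vec_eq_iff)
  have "of_int_vec (- g) = p *\<^sub>R x + (a - b) *\<^sub>R k" using gk(1) unfolding neg
    by (simp add: algebra_simps)
  then have g: "(1 / p) *\<^sub>R of_int_vec (- g) = x + ((a - b) / p) *\<^sub>R k"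
    using assms(3) by (simp add: scaleR_add_right)
  have "(1 / p) *\<^sub>R of_int_vec (- g) + (b / p) *\<^sub>R k' \<in> (+) x ` (*\<^sub>R) (a / p) ` K" if "k' \<in> K"
    for k'
  proof -
    have "((a - b) / p) *\<^sub>R k + (b / p) *\<^sub>R k' \<in> (*\<^sub>R) ((a - b) / p + b / p) ` K"
      using gk that assms by (intro scaleR_convex_add K(1)) auto
    then have "((a - b) / p) *\<^sub>R k + (b / p) *\<^sub>R k' \<in> (*\<^sub>R) (a / p) ` K"
      by (simp add: add_divide_distrib[symmetric])
    then show ?thesis unfolding g add.assoc by (rule imageI)
  qed
  then show ?thesis by blast
qed

section \<open>Balanced subspaces\<close>

definition scale_count :: "(real ^ 'n) set \<Rightarrow> nat \<Rightarrow> 'p::prime_card mod_ring ^ 'n \<Rightarrow> real"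
  where "scale_count K j v = real (fibre_count ((*\<^sub>R) (real j / real CARD('p)) ` K) v)"

definition mean_count :: "'p::prime_card itself \<Rightarrow> (real ^ 'n) set \<Rightarrow> nat \<Rightarrow> real"
  where "mean_count _ K j =
    (\<Sum>v\<in>UNIV. scale_count K j (v :: 'p mod_ring ^ 'n)) / real CARD('p) ^ CARD('n)"

definition balanced :: "(real ^ 'n) set \<Rightarrow> nat \<Rightarrow> real \<Rightarrow> nat \<Rightarrow>
  ('p::prime_card mod_ring ^ 'n) set \<Rightarrow> bool"
  where "balanced K r \<epsilon> j S
    \<longleftrightarrow> (\<forall>a. \<bar>(\<Sum>y\<in>S. scale_count K j (a + y)) - mean_count TYPE('p) K j * real CARD('p) ^ r\<bar>
    \<le> \<epsilon> * mean_count TYPE('p) K j * real CARD('p) ^ r)"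

lemma mean_count_bounds:
  fixes K :: "(real ^ 'n) set"
  assumes K: "bounded K" "convex K" "is_covering int_lattice K"
  shows "mean_count TYPE('p::prime_card) K j
    \<le> ((real j + 1) / real CARD('p)) ^ CARD('n) * measure lebesgue K"
    and "j \<ge> 1 \<Longrightarrow> ((real j - 1) / real CARD('p)) ^ CARD('n) * measure lebesgue K
      \<le> mean_count TYPE('p) K j"
proof -
  have p: "real CARD('p) ^ CARD('n) > 0" by simp
  show "mean_count TYPE('p) K j \<le> ((real j + 1) / real CARD('p)) ^ CARD('n) * measure lebesgue K"
    using total_fibre_count_bounds(1)[OF K, of "real j", where 'p = 'p] p
    by (simp add: mean_count_def scale_count_def power_divide divide_right_mono)
  show "((real j - 1) / real CARD('p)) ^ CARD('n) * measure lebesgue K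
    \<le> mean_count TYPE('p) K j" if "j \<ge> 1"
    using total_fibre_count_bounds(2)[OF K, of "real j", where 'p = 'p] p that
    by (simp add: mean_count_def scale_count_def power_divide divide_right_mono)
qed

text \<open>The bound of \<open>flats_equidistributed\<close> contains
  \<open>M / (\<mu> * p ^ r)\<close>, so a bound \<open>M\<close> on the fibres with
  \<open>p ^ 3 * M \<le> \<mu> * p ^ r\<close> is wanted. Small dilates are packings and allow
  \<open>M = 1\<close>; for the others \<open>M\<close> is at most \<open>(3 * \<tau>) ^ n\<close>
  times the mean, which the dimension \<open>r\<close> outweighs.\<close>

lemma unbalanced_bound:
  fixes K :: "(real ^ 'n) set" and \<rho> \<tau> \<epsilon> :: real and r j :: nat
  defines "p \<equiv> real CARD('p::prime_card)" and "n \<equiv> CARD('n)" and "V \<equiv> measure lebesgue K"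
  assumes K: "bounded K" "convex K" "is_covering int_lattice K"
    and \<rho>: "\<rho> > 0" "is_packing int_lattice ((*\<^sub>R) \<rho> ` K)" and \<tau>: "\<tau> \<ge> 1" "1 < \<tau> * \<rho>"
    and r: "r \<le> n" "p ^ 3 * (3 * \<tau>) ^ n \<le> p ^ r" and p3: "CARD('p) \<ge> 3"
    and \<epsilon>: "0 < \<epsilon>" "\<epsilon> \<le> 1" and j: "j \<ge> 3" "p ^ 3 \<le> ((real j - 1) / p) ^ n * V * p ^ r"
  shows "real (card {S \<in> grassmannian r. \<not> balanced K r \<epsilon> j (S :: ('p mod_ring ^ 'n) set)})
    \<le> 64 * real n / (\<epsilon>\<^sup>2 * p\<^sup>2) * real (card (grassmannian r :: ('p mod_ring ^ 'n) set set))"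
proof -
  let ?f = "scale_count K j :: 'p mod_ring ^ 'n \<Rightarrow> real" and ?\<mu> = "mean_count TYPE('p) K j"
  let ?G = "real (card (grassmannian r :: ('p mod_ring ^ 'n) set set))"
  have p: "p \<ge> 3" using p3 by (simp add: p_def)
  have V: "V \<ge> 1" unfolding V_def by (rule covering_measure_ge_1[OF K])
  have \<mu>_ge: "((real j - 1) / p) ^ n * V \<le> ?\<mu>"
    using mean_count_bounds(2)[OF K, of j, where 'p = 'p] j(1) by (simp add: p_def n_def V_def)
  have "0 < ((real j - 1) / p) ^ n * V" using j(1) p V by (intro mult_pos_pos zero_less_power) auto
  then have \<mu>: "?\<mu> > 0" using \<mu>_ge by linarith
  have "\<exists>M. (\<forall>v. ?f v \<le> M) \<and> p ^ 3 * M \<le> ?\<mu> * p ^ r"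
  proof (cases "real j / p \<le> \<rho>")
    case True
    have "is_packing int_lattice ((*\<^sub>R) (real j / p) ` K)"
      using True j(1) p by (intro packing_mono[OF K(2) _ _ \<rho>(2)]) auto
    then have "fibre_count ((*\<^sub>R) (real j / p) ` K) v \<le> 1" for v :: "'p mod_ring ^ 'n"
      by (intro fibre_count_packing bounded_scaling K(1))
    then have "?f v \<le> 1" for v by (simp add: scale_count_def p_def)
    moreover have "p ^ 3 * 1 \<le> ?\<mu> * p ^ r"
    proof -
      have "0 \<le> p ^ r" using p by simp
      from mult_right_mono[OF \<mu>_ge this] j(2) show ?thesis by linarith
    qed
    ultimately show ?thesis by blast
  next
    case False
    define M where "M = (real j / p + 1) ^ n * V"
    have "?f v \<le> M" for v
      using fibre_count_bounds(1)[OF K, of "real j / p" 0 v] p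
      by (simp add: scale_count_def M_def n_def V_def p_def)
    moreover have "p ^ 3 * M \<le> ?\<mu> * p ^ r"
    proof -
      \<comment> \<open>Past the packing scale \<open>j / p\<close> exceeds
        \<open>1 / \<tau>\<close>, so adding \<open>1\<close> to it costs a factor of at most
        \<open>2 * \<tau>\<close>; passing from \<open>j\<close> to \<open>j - 1\<close> costs
        \<open>3 / 2\<close> because \<open>j \<ge> 3\<close>. The product \<open>3 * \<tau>\<close>
        is the origin of \<open>ln 3\<close> in the dimension formula.\<close>
      have "\<tau> * \<rho> < \<tau> * (real j / p)" using False \<tau> by (intro mult_strict_left_mono) auto
      then have "1 < \<tau> * (real j / p)" using \<tau>(2) by linarith
      then have "real j / p + 1 \<le> real j / p * (1 + \<tau>)"
        unfolding distrib_left mult.commute[of \<tau>] by simp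
      also have "\<dots> \<le> real j / p * (2 * \<tau>)" using \<tau>(1) p by (intro mult_left_mono) auto
      also have "\<dots> \<le> (3 * \<tau>) * ((real j - 1) / p)"
      proof -
        have "2 * real j \<le> 3 * (real j - 1)" using j(1) by simp
        then have "\<tau> * (2 * real j) / p \<le> \<tau> * (3 * (real j - 1)) / p"
          using \<tau>(1) p by (intro divide_right_mono mult_left_mono) auto
        then show ?thesis by (simp add: mult_ac)
      qed
      finally have "(real j / p + 1) ^ n \<le> ((3 * \<tau>) * ((real j - 1) / p)) ^ n"
        using p by (intro power_mono) auto
      then have "M \<le> ((3 * \<tau>) * ((real j - 1) / p)) ^ n * V"
        unfolding M_def using V by (intro mult_right_mono) linarith+
      also have "\<dots> = (3 * \<tau>) ^ n * (((real j - 1) / p) ^ n * V)"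
        unfolding power_mult_distrib[of "3 * \<tau>"] by (rule mult.assoc)
      also have "\<dots> \<le> (3 * \<tau>) ^ n * ?\<mu>" using \<mu>_ge \<tau>(1) by (intro mult_left_mono) auto
      finally have "p ^ 3 * M \<le> p ^ 3 * ((3 * \<tau>) ^ n * ?\<mu>)" using p by (intro mult_left_mono) auto
      also have "\<dots> = (p ^ 3 * (3 * \<tau>) ^ n) * ?\<mu>" by simp
      also have "\<dots> \<le> p ^ r * ?\<mu>" using r(2) \<mu> by (intro mult_right_mono) auto
      finally show ?thesis by (simp add: mult.commute)
    qed
    ultimately show ?thesis by blast
  qed
  then obtain M where M: "\<And>v. ?f v \<le> M" "p ^ 3 * M \<le> ?\<mu> * p ^ r" by blast
  have "real (card {S \<in> grassmannian r. \<not> balanced K r \<epsilon> j (S :: ('p mod_ring ^ 'n) set)})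
      \<le> 64 * real n * p * M / (\<epsilon>\<^sup>2 * ?\<mu> * p ^ r) * ?G"
    using flats_equidistributed[of r ?f M \<epsilon>] p3 r(1) M(1) \<mu> \<epsilon>
    by (simp add: balanced_def not_le mean_count_def p_def n_def scale_count_def)
  also have "\<dots> \<le> 64 * real n / (\<epsilon>\<^sup>2 * p\<^sup>2) * ?G"
  proof (rule mult_right_mono)
    have "64 * real n * p * M / (\<epsilon>\<^sup>2 * ?\<mu> * p ^ r)
      = 64 * real n / (\<epsilon>\<^sup>2 * p\<^sup>2) * (p ^ 3 * M / (?\<mu> * p ^ r))"
      using p by (simp add: power2_eq_square power3_eq_cube)
    also have "\<dots> \<le> 64 * real n / (\<epsilon>\<^sup>2 * p\<^sup>2) * 1"
      using M(2) \<mu> p by (intro mult_left_mono) (auto simp: divide_le_eq_1)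
    finally show "64 * real n * p * M / (\<epsilon>\<^sup>2 * ?\<mu> * p ^ r) \<le> 64 * real n / (\<epsilon>\<^sup>2 * p\<^sup>2)" by simp
  qed simp
  finally show ?thesis .
qed

lemma one_plus_power_le_linear:
  fixes x :: real
  assumes "0 \<le> x" "real n * x \<le> 1"
  shows "(1 + x) ^ n \<le> 1 + 2 * (real n * x)"
proof (cases "n = 0")
  case False
  have "1 * x \<le> real n * x" using assms(1) False by (intro mult_right_mono) auto
  then have "\<bar>x\<bar> \<le> 1" using assms by simp
  then have "(1 + x) ^ n \<le> 1 + real n * x + (real n * x)\<^sup>2"
    using assms by (intro one_plus_power_le[where n = n]) auto
  moreover have "(real n * x)\<^sup>2 \<le> real n * x"
    using assms by (simp add: power2_eq_square mult_left_le)
  ultimately show ?thesis by simp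
qed simp

lemma one_minus_power_ge:
  fixes x :: real
  assumes "x \<le> 1"
  shows "1 - real n * x \<le> (1 - x) ^ n"
  using Bernoulli_inequality[of "- x" n] assms by simp

text \<open>There are two regimes. For large \<open>a\<close> the covering property alone determines
  every fibre up to a factor \<open>1 \<plusminus> \<epsilon>\<close>, whatever the subspace.
  Otherwise the translate is sandwiched between grid translates at two integer scales, and balance
  at these scales applies.\<close>

lemma N_points_balanced:
  fixes K :: "(real ^ 'n) set" and S :: "('p::prime_card mod_ring ^ 'n) set" and \<epsilon> a :: real
    and r J :: nat
  defines "p \<equiv> real CARD('p)" and "n \<equiv> CARD('n)" and "V \<equiv> measure lebesgue K"
  defines "N0 \<equiv> (a / p) ^ n * V * p ^ r"
  assumes K: "bounded K" "convex K" "is_covering int_lattice K"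
    and S: "S \<in> grassmannian r" and \<epsilon>: "0 < \<epsilon>" "\<epsilon> < 1"
    and a: "50 * real n / \<epsilon> \<le> a" "exp 1 * p ^ 3 \<le> N0"
    and J: "8 * real n * p / \<epsilon> + 2 \<le> real J"
    and good: "\<And>j. j \<in> {3..J} \<Longrightarrow> p ^ 3 \<le> ((real j - 1) / p) ^ n * V * p ^ r
      \<Longrightarrow> balanced K r (\<epsilon> / 4) j S"
  shows "\<bar>real (N_points (construction_A S) ((*\<^sub>R) (a / p) ` K) x) / N0 - 1\<bar> \<le> \<epsilon>"
proof -
  let ?A = "(+) x ` (*\<^sub>R) (a / p) ` K"
  define N where "N = real (N_points (construction_A S) ((*\<^sub>R) (a / p) ` K) x)"
  have n: "real n \<ge> 1" unfolding n_def by (simp add: Suc_leI)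
  have p: "p > 0" by (simp add: p_def)
  have V: "V \<ge> 1" unfolding V_def by (rule covering_measure_ge_1[OF K])
  have a_n: "50 * real n \<le> a * \<epsilon>" using a(1) \<epsilon> by (simp add: pos_divide_le_eq)
  have a50: "50 \<le> a"
  proof -
    have "a * \<epsilon> \<le> a * 1 \<or> a < 0" using \<epsilon> by (cases "a < 0") (auto simp: mult_left_le)
    moreover have "a \<ge> 0" using a_n n \<epsilon> by (smt (verit) mult_less_0_iff)
    ultimately show ?thesis using a_n n by linarith
  qed
  have na: "real n / a \<le> \<epsilon> / 50" using a_n a50 by (simp add: divide_simps mult.commute)
  have N0: "N0 > 0" unfolding N0_def using a50 p V by (intro mult_pos_pos zero_less_power) auto
  have bA: "bounded ?A" by (intro bounded_translation bounded_scaling K(1))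
  have N_sum: "N = (\<Sum>v\<in>S. real (fibre_count ?A v))"
    by (simp add: N_def N_points_construction_A[OF bounded_scaling[OF K(1)]])
  have cardS: "real (card S) = p ^ r"
    using card_subspace[of S] S by (simp add: grassmannian_def p_def)
  have e_ge: "exp 1 \<ge> (2 :: real)" using exp_ge_add_one_self[of 1] by simp
  have up: "((a + t) / p) ^ n \<le> (a / p) ^ n * (1 + 2 * (t * real n / a))" if t: "0
    \<le> t" "t * real n / a \<le> 1" for t
  proof -
    have "(a + t) / p = (a / p) * (1 + t / a)" using a50 p by (simp add: field_simps)
    then have "((a + t) / p) ^ n = (a / p) ^ n * (1 + t / a) ^ n" by (simp only: power_mult_distrib)
    also have "(1 + t / a) ^ n \<le> 1 + 2 * (real n * (t / a))"
      using t a50 by (intro one_plus_power_le_linear) (auto simp: mult.commute)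
    finally show ?thesis using a50 p by (simp add: mult_ac)
  qed
  have lo: "(a / p) ^ n * (1 - t * real n / a) \<le> ((a - t) / p) ^ n" if t: "t \<le> a" for t
  proof -
    have "1 - real n * (t / a) \<le> (1 - t / a) ^ n" using t a50 by (intro one_minus_power_ge) auto
    then have "(a / p) ^ n * (1 - real n * (t / a)) \<le> (a / p) ^ n * (1 - t / a) ^ n"
      using a50 p by (intro mult_left_mono) auto
    also have "\<dots> = ((a - t) / p) ^ n"
    proof -
      have "(a - t) / p = (a / p) * (1 - t / a)" using a50 p by (simp add: field_simps)
      then show ?thesis by (simp only: power_mult_distrib)
    qed
    finally show ?thesis by (simp add: mult_ac)
  qed
  have "N \<le> (1 + \<epsilon>) * N0 \<and> (1 - \<epsilon>) * N0 \<le> N"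
  proof (cases "8 * real n * p / \<epsilon> \<le> a")
    \<comment> \<open>Here \<open>p * n / a \<le> \<epsilon> / 8\<close>, so enlarging or shrinking
      the body by one copy of \<open>K\<close> changes its volume by a factor within
      \<open>1 \<plusminus> \<epsilon>\<close>.\<close>
    case True
    have pa: "p * real n / a \<le> \<epsilon> / 8" using True \<epsilon> a50 by (simp add: divide_simps mult_ac)
    have pa1: "p * real n / a \<le> 1" using pa \<epsilon> by linarith
    have "p * 1 \<le> p * real n" using n p by (intro mult_left_mono) auto
    then have "p / a \<le> p * real n / a" using a50 by (intro divide_right_mono) auto
    then have "p / a \<le> 1" using pa \<epsilon> by linarith
    then have ap: "p \<le> a" using a50 by (simp add: divide_le_eq_1)
    have "N \<le> (\<Sum>v\<in>S. (a / p + 1) ^ n * V)"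
      unfolding N_sum n_def V_def using ap p by (intro sum_mono fibre_count_bounds(1)[OF K]) auto
    also have "\<dots> = p ^ r * (((a + p) / p) ^ n * V)" using p by (simp add: cardS add_divide_distrib)
    also have "\<dots> \<le> p ^ r * ((a / p) ^ n * (1 + 2 * (p * real n / a)) * V)"
      using p V pa1 by (intro mult_left_mono mult_right_mono up) auto
    also have "\<dots> = (1 + 2 * (p * real n / a)) * N0" by (simp add: N0_def mult_ac)
    also have "\<dots> \<le> (1 + \<epsilon>) * N0"
      by (rule mult_right_mono) (use pa \<epsilon> N0 in linarith)+
    finally have upper: "N \<le> (1 + \<epsilon>) * N0" .
    have "(1 - \<epsilon>) * N0 \<le> (1 - p * real n / a) * N0"
      by (rule mult_right_mono) (use pa \<epsilon> N0 in linarith)+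
    also have "\<dots> = p ^ r * ((a / p) ^ n * (1 - p * real n / a) * V)" by (simp add: N0_def mult_ac)
    also have "\<dots> \<le> p ^ r * (((a - p) / p) ^ n * V)"
      using p V ap by (intro mult_left_mono mult_right_mono lo) auto
    also have "\<dots> = (\<Sum>v\<in>S. (a / p - 1) ^ n * V)" using p by (simp add: cardS diff_divide_distrib)
    also have "\<dots> \<le> N"
      unfolding N_sum n_def V_def using ap p by (intro sum_mono fibre_count_bounds(2)[OF K]) auto
    finally show ?thesis using upper by simp
  next
    case False
    \<comment> \<open>With \<open>j\<close> the floor of \<open>a\<close>, the outer scale is
      \<open>j + 2\<close> and the inner one \<open>j - 1\<close>, each leaving room 1 for moving
      the centre to the grid. Comparing means with volumes costs one more unit, which leads to
      \<open>a + 3\<close> and \<open>a - 3\<close>; these shifts are harmless because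
      \<open>50 * n \<le> a * \<epsilon>\<close>.\<close>
    define j where "j = nat \<lfloor>a\<rfloor>"
    have j: "real j \<le> a" "a < real j + 1" using a50 by (auto simp: j_def)
    have j3: "j \<ge> 4" using j(2) a50 by simp
    have jJ: "j + 2 \<le> J" using j(1) False J by simp
    have mono_pow: "((s) / p) ^ n * V * p ^ r \<le> ((t) / p) ^ n * V * p ^ r" if "0 \<le> s" "s
      \<le> t" for s t
      using that p V by (intro mult_right_mono power_mono divide_right_mono) auto
    have na3: "3 * real n / a \<le> 3 * \<epsilon> / 50" using na by simp
    have three: "3 * real n / a \<le> 1" using na3 \<epsilon> by simp
    have low3: "(1 - 3 * \<epsilon> / 50) * N0 \<le> ((a - 3) / p) ^ n * V * p ^ r"
    proof -
      have "(1 - 3 * \<epsilon> / 50) * N0 \<le> (1 - 3 * real n / a) * N0"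
        by (rule mult_right_mono) (use na3 N0 in linarith)+
      also have "\<dots> = (a / p) ^ n * (1 - 3 * real n / a) * V * p ^ r" by (simp add: N0_def mult_ac)
      also have "\<dots> \<le> ((a - 3) / p) ^ n * V * p ^ r"
        using p V a50 by (intro mult_right_mono lo) auto
      finally show ?thesis .
    qed
    have p_cubed: "0 \<le> p ^ 3" using p by simp
    \<comment> \<open>The factor \<open>exp 1\<close>, used here as at least 2, leaves room to pass
      from \<open>a\<close> to the inner scale without falling below \<open>p ^ 3\<close>.\<close>
    have eN0: "2 * p ^ 3 \<le> N0" using a(2) mult_right_mono[OF e_ge p_cubed] by linarith
    have "p ^ 3 \<le> (1 - 3 * \<epsilon> / 50) * N0"
    proof -
      have "1 / 2 * N0 \<le> (1 - 3 * \<epsilon> / 50) * N0" using \<epsilon> N0 by (intro mult_right_mono) auto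
      then show ?thesis using eN0 by simp
    qed
    then have "p ^ 3 \<le> ((a - 3) / p) ^ n * V * p ^ r" using low3 by linarith
    also have "\<dots> \<le> ((real (j - 1) - 1) / p) ^ n * V * p ^ r"
      using j j3 a50 by (intro mono_pow) auto
    finally have bal1: "balanced K r (\<epsilon> / 4) (j - 1) S" using jJ j3 by (intro good) auto
    have "p ^ 3 \<le> N0" using eN0 p_cubed by linarith
    also have "N0 \<le> ((real (j + 2) - 1) / p) ^ n * V * p ^ r"
      unfolding N0_def using j a50 by (intro mono_pow) auto
    finally have bal2: "balanced K r (\<epsilon> / 4) (j + 2) S" using jJ j3 by (intro good) auto
    have shift: "(\<Sum>v\<in>S. real (fibre_count ((+) ((1 / p) *\<^sub>R of_int_vec g) ` (*\<^sub>R)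
      (real i / p) ` K) v))
        = (\<Sum>y\<in>S. scale_count K i (- reduce_mod g + y))" for g i
      unfolding p_def fibre_count_shift scale_count_def by simp
    have bal: "(\<Sum>y\<in>S. scale_count K i (b + y)) \<le> (1 + \<epsilon> / 4) * (mean_count TYPE('p) K i * p ^ r)"
      "(1 - \<epsilon> / 4) * (mean_count TYPE('p) K i * p ^ r) \<le> (\<Sum>y\<in>S. scale_count K i (b + y))"
      if "balanced K r (\<epsilon> / 4) i S" for i b
    proof -
      have "\<bar>(\<Sum>y\<in>S. scale_count K i (b + y)) - mean_count TYPE('p) K i * p ^ r\<bar>
          \<le> \<epsilon> / 4 * (mean_count TYPE('p) K i * p ^ r)"
        using that[unfolded balanced_def, THEN spec, of b] by (simp only: p_def mult.assoc)
      then show "(\<Sum>y\<in>S. scale_count K i (b + y)) \<le> (1 + \<epsilon> / 4) * (mean_count TYPE('p) K i * p ^ r)"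
        "(1 - \<epsilon> / 4) * (mean_count TYPE('p) K i * p ^ r) \<le> (\<Sum>y\<in>S. scale_count K i (b + y))"
        unfolding distrib_right left_diff_distrib by linarith+
    qed
    obtain g where g: "?A \<subseteq> (+) ((1 / p) *\<^sub>R of_int_vec g) ` (*\<^sub>R) (real (j + 2) / p) ` K"
      using grid_outer[OF K(2,3), of p a "real (j + 2)" x] p a50 j by auto
    have "N \<le> (\<Sum>v\<in>S. real (fibre_count ((+) ((1 / p) *\<^sub>R of_int_vec g) ` (*\<^sub>R) (real (j
      + 2) / p) ` K) v))"
      unfolding N_sum of_nat_le_iff
      by (intro sum_mono of_nat_mono fibre_count_mono g bounded_translation bounded_scaling K(1))
    also have "\<dots> = (\<Sum>y\<in>S. scale_count K (j + 2) (- reduce_mod g + y))" by (rule shift)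
    also have "\<dots> \<le> (1 + \<epsilon> / 4) * (mean_count TYPE('p) K (j + 2) * p ^ r)"
      by (rule bal(1)[OF bal2])
    also have "\<dots> \<le> (1 + \<epsilon> / 4) * (((a + 3) / p) ^ n * V * p ^ r)"
    proof -
      have "mean_count TYPE('p) K (j + 2) \<le> ((real (j + 2) + 1) / p) ^ n * V"
        using mean_count_bounds(1)[OF K, of "j + 2", where 'p = 'p]
          by (simp only: p_def n_def V_def)
      also have "\<dots> \<le> ((a + 3) / p) ^ n * V"
        using j p V by (intro mult_right_mono power_mono divide_right_mono) auto
      finally show ?thesis using p \<epsilon> by (intro mult_left_mono mult_right_mono) auto
    qed
    also have "\<dots> \<le> (1 + \<epsilon> / 4) * ((a / p) ^ n * (1 + 2 * (3 * real n / a)) * V * p ^ r)"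
      using p \<epsilon> V three by (intro mult_left_mono mult_right_mono up) auto
    also have "\<dots> = (1 + \<epsilon> / 4) * (1 + 2 * (3 * real n / a)) * N0" by (simp add: N0_def mult_ac)
    also have "\<dots> \<le> (1 + \<epsilon> / 4) * (1 + \<epsilon> / 8) * N0"
      by (rule mult_right_mono, rule mult_left_mono) (use na3 \<epsilon> N0 in linarith)+
    also have "\<dots> \<le> (1 + \<epsilon>) * N0"
    proof (rule mult_right_mono)
      have "\<epsilon> * \<epsilon> \<le> \<epsilon>" using \<epsilon> by (simp add: mult_left_le)
      then show "(1 + \<epsilon> / 4) * (1 + \<epsilon> / 8) \<le> 1 + \<epsilon>" using \<epsilon> by (simp add: field_simps)
    qed (use N0 in simp)
    finally have upper: "N \<le> (1 + \<epsilon>) * N0" .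
    obtain g' where g': "(+) ((1 / p) *\<^sub>R of_int_vec g') ` (*\<^sub>R) (real (j - 1) / p) ` K \<subseteq> ?A"
      using grid_inner[OF K(2,3), of p "real (j - 1)" a x] p a50 j j3 by auto
    have "(1 - \<epsilon>) * N0 \<le> (1 - \<epsilon> / 4) * (1 - 3 * \<epsilon> / 50) * N0"
    proof (rule mult_right_mono)
      have "0 \<le> \<epsilon> * \<epsilon>" by simp
      then show "1 - \<epsilon> \<le> (1 - \<epsilon> / 4) * (1 - 3 * \<epsilon> / 50)" using \<epsilon> by (simp add: field_simps)
    qed (use N0 in simp)
    also have "\<dots> = (1 - \<epsilon> / 4) * ((1 - 3 * \<epsilon> / 50) * N0)" by simp
    also have "\<dots> \<le> (1 - \<epsilon> / 4) * (((a - 3) / p) ^ n * V * p ^ r)"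
      using low3 \<epsilon> by (intro mult_left_mono) auto
    also have "\<dots> \<le> (1 - \<epsilon> / 4) * (mean_count TYPE('p) K (j - 1) * p ^ r)"
    proof -
      have "((a - 3) / p) ^ n * V \<le> ((real (j - 1) - 1) / p) ^ n * V"
        using j j3 a50 p V by (intro mult_right_mono power_mono divide_right_mono) auto
      also have "\<dots> \<le> mean_count TYPE('p) K (j - 1)"
        using mean_count_bounds(2)[OF K, of "j - 1", where 'p = 'p] j3
          by (simp only: p_def n_def V_def)
      finally show ?thesis using p \<epsilon> by (intro mult_left_mono mult_right_mono) auto
    qed
    also have "\<dots> \<le> (\<Sum>y\<in>S. scale_count K (j - 1) (- reduce_mod g' + y))"
      by (rule bal(2)[OF bal1])
    also have "\<dots>
      = (\<Sum>v\<in>S. real (fibre_count ((+) ((1 / p) *\<^sub>R of_int_vec g') ` (*\<^sub>R) (real (j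
        - 1) / p) ` K) v))"
      by (rule shift[symmetric])
    also have "\<dots> \<le> N"
      unfolding N_sum of_nat_le_iff by (intro sum_mono of_nat_mono fibre_count_mono g' bA)
    finally show ?thesis using upper by simp
  qed
  then have "N / N0 \<le> 1 + \<epsilon>" "1 - \<epsilon> \<le> N / N0" using N0 by (simp_all add: divide_simps)
  then show ?thesis by (simp add: N_def abs_le_iff)
qed

section \<open>Smoothness of the random lattice\<close>

text \<open>More than \<open>p ^ 3\<close> expected points force a scale well above the grid
  spacing. Otherwise \<open>V \<le> \<tau> ^ n\<close> and the bound on \<open>p ^ r\<close> give
  \<open>p ^ (n - 1) < B ^ n\<close>; but \<open>p\<close> is at least \<open>B * C\<close>, and the
  \<open>n - 1\<close> factors \<open>C\<close> outweigh the one missing factor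
  \<open>B\<close>.\<close>

lemma scaling_lower_bound:
  fixes N p \<tau> \<epsilon> a V \<rho> :: real and n r :: nat
  assumes n: "N = real n" "n > 25" and \<tau>: "\<tau> \<ge> 1" "\<tau>\<^sup>2 \<le> 2 ^ n" and \<epsilon>: "0 < \<epsilon>" "\<epsilon> < 1"
    and p: "2 ^ 18 * (N ^ 3 * \<tau>\<^sup>2) / \<epsilon> ^ 4 \<le> p" and r: "p ^ r \<le> p ^ 4 * (3 * \<tau>) ^ n"
    and V: "V \<ge> 1" "\<rho> ^ n * V \<le> 1" and \<rho>: "\<rho> > 0" "1 < \<tau> * \<rho>"
    and a: "a > 0" "p ^ 3 < (a / p) ^ n * V * p ^ r"
  shows "50 * N / \<epsilon> \<le> a"
proof (rule ccontr)
  assume "\<not> 50 * N / \<epsilon> \<le> a"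
  then have a_less: "a \<le> 50 * N / \<epsilon>" by simp
  have N: "N \<ge> 26" using n by simp
  have "0 < 2 ^ 18 * (N ^ 3 * \<tau>\<^sup>2) / \<epsilon> ^ 4" using N \<tau> \<epsilon> by simp
  then have p0: "p > 0" using p by linarith
  have V_le: "V \<le> \<tau> ^ n"
  proof -
    have "1 * V \<le> (\<tau> * \<rho>) ^ n * V" using \<rho> V by (intro mult_right_mono one_le_power) auto
    also have "\<dots> = \<tau> ^ n * (\<rho> ^ n * V)" by (simp add: power_mult_distrib)
    also have "\<dots> \<le> \<tau> ^ n * 1" using V \<tau> by (intro mult_left_mono) auto
    finally show ?thesis by simp
  qed
  \<comment> \<open>\<open>B\<close> is three times the assumed bound
    \<open>50 * N / \<epsilon>\<close>, times \<open>\<tau>\<^sup>2\<close>. The constant of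
    \<open>B * C\<close> is 153600, below the \<open>2 ^ 18\<close> in the lower bound on
    \<open>p\<close>. That \<open>B \<le> C ^ (n - 1)\<close> uses
    \<open>\<tau>\<^sup>2 \<le> 2 ^ n\<close>.\<close>
  define B C where "B = 150 * N * \<tau>\<^sup>2 / \<epsilon>" and "C = 2 ^ 10 * (N\<^sup>2 / \<epsilon> ^ 3)"
  have BC0: "B \<ge> 0" "C \<ge> 0" using N \<epsilon> by (auto simp: B_def C_def)
  have "p ^ 3 < (a / p) ^ n * \<tau> ^ n * (p ^ 4 * (3 * \<tau>) ^ n)"
    using a p0 \<tau> V_le V r by (intro less_le_trans[OF a(2)] mult_mono) auto
  also have "\<dots> = (3 * a * \<tau>\<^sup>2) ^ n * p ^ 4 / p ^ n"
    by (simp add: power_mult_distrib power_divide power2_eq_square)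
  also have "\<dots> \<le> B ^ n * p ^ 4 / p ^ n"
  proof (intro divide_right_mono mult_right_mono power_mono)
    have "3 * a * \<tau>\<^sup>2 \<le> 3 * (50 * N / \<epsilon>) * \<tau>\<^sup>2" using a_less
      by (intro mult_right_mono mult_left_mono) auto
    then show "3 * a * \<tau>\<^sup>2 \<le> B" by (simp add: B_def)
  qed (use a \<tau> p0 in auto)
  finally have "p ^ 3 * p ^ n < B ^ n * p ^ 4" using p0 by (simp add: pos_less_divide_eq)
  moreover have "p ^ n = p * p ^ (n - 1)" using n by (metis gr_implies_not0 power_eq_if)
  ultimately have "p ^ 4 * p ^ (n - 1) < p ^ 4 * B ^ n" by (simp add: power_numeral_reduce mult_ac)
  then have less: "p ^ (n - 1) < B ^ n" using p0 by simp
  have "B * C \<le> p"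
  proof -
    have "B * C = 153600 * (N ^ 3 * \<tau>\<^sup>2) / \<epsilon> ^ 4"
      by (simp add: B_def C_def power2_eq_square power3_eq_cube power4_eq_xxxx mult_ac)
    also have "\<dots> \<le> 2 ^ 18 * (N ^ 3 * \<tau>\<^sup>2) / \<epsilon> ^ 4"
      using N \<epsilon> by (intro divide_right_mono mult_right_mono) auto
    finally show ?thesis using p by simp
  qed
  then have "(B * C) ^ (n - 1) \<le> p ^ (n - 1)" using BC0 by (intro power_mono) auto
  moreover have "B \<le> C ^ (n - 1)"
  proof -
    have one: "1 \<le> N / \<epsilon>" using N \<epsilon> by (simp add: divide_simps)
    have "N / \<epsilon> * 1 \<le> N / \<epsilon> * (N / \<epsilon>\<^sup>2)"
    proof (rule mult_left_mono)
      have "\<epsilon>\<^sup>2 \<le> 1" using \<epsilon> by (simp add: power_le_one)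
      then show "1 \<le> N / \<epsilon>\<^sup>2" using N \<epsilon> by (simp add: divide_simps)
    qed (use one in simp)
    then have base: "N / \<epsilon> \<le> N\<^sup>2 / \<epsilon> ^ 3" by (simp add: power2_eq_square power3_eq_cube)
    have "B = 150 * \<tau>\<^sup>2 * (N / \<epsilon>)" by (simp add: B_def)
    also have "\<dots> \<le> 2 ^ 8 * 2 ^ n * (N / \<epsilon>)" using \<tau> one by (intro mult_right_mono mult_mono) auto
    also have "\<dots> = 2 ^ (8 + n) * (N / \<epsilon>)" by (simp only: power_add)
    also have "\<dots> \<le> 2 ^ (10 * (n - 1)) * (N\<^sup>2 / \<epsilon> ^ 3) ^ (n - 1)"
    proof (rule mult_mono)
      show "(2 :: real) ^ (8 + n) \<le> 2 ^ (10 * (n - 1))" using n by (intro power_increasing) auto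
      have "N\<^sup>2 / \<epsilon> ^ 3 \<ge> 1" using base one by linarith
      then have "(N\<^sup>2 / \<epsilon> ^ 3) ^ 1 \<le> (N\<^sup>2 / \<epsilon> ^ 3) ^ (n - 1)" using n
        by (intro power_increasing) auto
      then show "N / \<epsilon> \<le> (N\<^sup>2 / \<epsilon> ^ 3) ^ (n - 1)" using base by simp
    qed (use one in auto)
    also have "\<dots> = C ^ (n - 1)" unfolding C_def power_mult_distrib power_mult ..
    finally show ?thesis .
  qed
  then have "B ^ (n - 1) * B \<le> B ^ (n - 1) * C ^ (n - 1)" using BC0 by (intro mult_left_mono) auto
  moreover have "B ^ (n - 1) * B = B ^ n" using n
    by (metis gr_implies_not0 mult.commute power_eq_if)
  ultimately show False using less by (simp add: power_mult_distrib)
qed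

text \<open>The real number \<open>X\<close> solves \<open>p powr X = (3 * \<tau>) ^ n\<close>.
  Rounding it up costs at most one factor \<open>p\<close>, and the summand 3 in \<open>r\<close>
  supplies the \<open>p ^ 3\<close> that the failure bound needs.\<close>

lemma dimension_bounds:
  fixes N p \<tau> b :: real and n r :: nat
  assumes n: "N = real n" "n > 25" and b: "b > 0" and \<tau>: "\<tau> = N powr b"
    and p: "9 * \<tau>\<^sup>2 \<le> p" and r: "r = 3 + nat \<lceil>N / ln p * (b * ln N + ln 3)\<rceil>"
  shows "r \<le> n" "p ^ 3 * (3 * \<tau>) ^ n \<le> p ^ r" "p ^ r \<le> p ^ 4 * (3 * \<tau>) ^ n"
proof -
  have N: "N \<ge> 26" using n by simp
  have \<tau>1: "\<tau> \<ge> 1" unfolding \<tau> using N b by (intro ge_one_powr_ge_zero) auto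
  have p9: "p \<ge> 9" using p \<tau>1 one_le_power[of \<tau> 2] by linarith
  have lnp: "ln p > 0" using p9 by simp
  define X where "X = N / ln p * (b * ln N + ln 3)"
  define k where "k = nat \<lceil>X\<rceil>"
  have lnN: "ln N > 0" using N by simp
  have ln3: "ln (3 * \<tau>) = b * ln N + ln 3" using \<tau>1 N by (simp add: ln_mult \<tau> ln_powr)
  have X0: "X \<ge> 0" unfolding X_def using N lnp lnN b
    by (intro mult_nonneg_nonneg divide_nonneg_nonneg) auto
  have k: "X \<le> real k" "real k \<le> X + 1" using X0 unfolding k_def by linarith+
  have pX: "p powr X = (3 * \<tau>) ^ n"
  proof -
    have "p powr X = exp (N * ln (3 * \<tau>))" using p9 lnp by (simp add: powr_def X_def ln3)
    also have "\<dots> = (3 * \<tau>) powr N" using \<tau>1 by (simp add: powr_def)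
    finally show ?thesis using \<tau>1 n by (simp add: powr_realpow)
  qed
  have r_eq: "r = 3 + k" by (simp add: r k_def X_def)
  have pk: "p ^ k = p powr real k" using p9 by (simp add: powr_realpow)
  have "p powr X \<le> p ^ k" unfolding pk using k(1) p9 by (intro powr_mono) auto
  then have "(3 * \<tau>) ^ n \<le> p ^ k" by (simp only: pX)
  then show "p ^ 3 * (3 * \<tau>) ^ n \<le> p ^ r" using p9 by (simp add: r_eq power_add)
  have "p ^ k \<le> p powr (X + 1)" unfolding pk using k(2) p9 by (intro powr_mono) auto
  also have "\<dots> = (3 * \<tau>) ^ n * p" using p9 by (simp add: powr_add pX)
  finally have "p ^ 3 * p ^ k \<le> p ^ 3 * ((3 * \<tau>) ^ n * p)" using p9 by (intro mult_left_mono) auto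
  then show "p ^ r \<le> p ^ 4 * (3 * \<tau>) ^ n" by (simp add: r_eq power_add power_numeral_reduce mult_ac)
  \<comment> \<open>Since \<open>p \<ge> (3 * \<tau>)\<^sup>2\<close>, the dimension is at most
    \<open>N / 2 + 4\<close>, hence at most \<open>n\<close>.\<close>
  have "X \<le> N / 2"
  proof -
    have "ln ((3 * \<tau>)\<^sup>2) \<le> ln p" using p \<tau>1 p9
      by (subst ln_le_cancel_iff) (auto simp: power_mult_distrib)
    moreover have "ln ((3 * \<tau>)\<^sup>2) = 2 * ln (3 * \<tau>)" using \<tau>1 by (subst ln_realpow) auto
    ultimately have "2 * ln (3 * \<tau>) \<le> ln p" by simp
    then have "(b * ln N + ln 3) / ln p \<le> 1 / 2" using lnp
      by (simp add: ln3[symmetric] pos_divide_le_eq)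
    then have "N * ((b * ln N + ln 3) / ln p) \<le> N * (1 / 2)" using N by (intro mult_left_mono) auto
    then show ?thesis by (simp add: X_def)
  qed
  then have "real r \<le> N" using k(2) N by (simp add: r_eq)
  then show "r \<le> n" using n by simp
qed

lemma prob_construction_A_ensemble_le:
  fixes Bad :: "('p::prime_card mod_ring ^ 'n) set set"
  assumes "card (grassmannian r :: ('p mod_ring ^ 'n) set set) > 0"
    and "\<And>S :: ('p mod_ring ^ 'n) set. S \<in> grassmannian r \<Longrightarrow> construction_A S \<in> E \<Longrightarrow> S \<in> Bad"
    and "real (card Bad) \<le> \<delta> * real (card (grassmannian r :: ('p mod_ring ^ 'n) set set))"
  shows "measure_pmf.prob (construction_A_ensemble TYPE('p) r) E \<le> \<delta>"
proof -
  let ?G = "grassmannian r :: ('p mod_ring ^ 'n) set set"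
  have ne: "?G \<noteq> {}" using assms(1) by auto
  have "measure_pmf.prob (construction_A_ensemble TYPE('p) r) E
      = measure_pmf.prob (pmf_of_set ?G) (construction_A -` E)"
    by (simp add: construction_A_ensemble_def grassmannian_def)
  also have "\<dots> = real (card (?G \<inter> construction_A -` E)) / real (card ?G)"
    using ne by (simp add: measure_pmf_of_set)
  also have "\<dots> \<le> real (card Bad) / real (card ?G)"
    using assms(2) by (intro divide_right_mono of_nat_mono card_mono) auto
  also have "\<dots> \<le> \<delta>" using assms(1,3) by (simp add: pos_divide_le_eq)
  finally show ?thesis .
qed

theorem theorem1p6:
  fixes n p r :: nat
    and K :: "(real ^ 'n) set"
    and b \<delta> \<epsilon> c4 :: real
  assumes n: "n = CARD('n)" "n > 25"
    and K: "bounded K" "convex K" "interior K \<noteq> {}"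
    and b: "b > 0" "0 \<le> b" "b \<le> real n / (2 * log 2 (real n))"
    and rho: "rho K int_lattice < real n powr b"
    and \<delta>: "0 < \<delta>" "\<delta> < 1"
    and \<epsilon>: "0 < \<epsilon>" "\<epsilon> < 1"
    and c4: "c4 = exp 1 * 2 ^ 57"
    and p: "p = CARD('p::prime_card)"
      "2 ^ 18 / (\<epsilon>\<^sup>2 * \<delta>)\<^sup>2 * real n powr (3 + 2 * b) \<le> real p"
      "real p \<le> 2 ^ 19 / (\<epsilon>\<^sup>2 * \<delta>)\<^sup>2 * real n powr (3 + 2 * b)"
    and r: "r = 3 + nat \<lceil>real n / ln (real p) * (b * ln (real n) + ln 3)\<rceil>"
  shows "measure_pmf.prob (construction_A_ensemble TYPE('p) r)
      {L. Phi K L \<epsilon> > ereal (c4 * (1 / (\<epsilon>\<^sup>2 * \<delta>)) ^ 6 * real n powr (9 + 6 * b))} \<le> \<delta>"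
proof -
  define N P \<tau> where "N = real n" and "P = real p" and "\<tau> = N powr b"
  have N: "N \<ge> 26" using n by (simp add: N_def)
  have P: "P = real CARD('p)" by (simp add: P_def p(1))
  have \<tau>1: "\<tau> \<ge> 1" unfolding \<tau>_def using N b by (intro ge_one_powr_ge_zero) auto
  \<comment> \<open>The upper bound on \<open>b\<close> says exactly this.\<close>
  have \<tau>_sq: "\<tau>\<^sup>2 \<le> 2 ^ n"
  proof -
    have "\<tau>\<^sup>2 = N powr (2 * b)" using N by (simp add: \<tau>_def powr_power)
    also have "\<dots> = 2 powr (2 * b * log 2 N)" using N by (simp add: powr_def log_def)
    also have "\<dots> \<le> 2 powr N"
    proof (rule powr_mono)
      have "log 2 N > 0" using N by simp
      then show "2 * b * log 2 N \<le> N" using b(3) by (simp add: N_def pos_le_divide_eq mult_ac)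
    qed simp
    finally show ?thesis by (simp add: N_def powr_realpow)
  qed
  have pow3: "real n powr (3 + 2 * b) = N ^ 3 * \<tau>\<^sup>2"
    using N by (simp add: N_def[symmetric] \<tau>_def powr_add powr_power powr_numeral)
  have pow9: "real n powr (9 + 6 * b) = (N ^ 3 * \<tau>\<^sup>2) ^ 3"
  proof -
    have "real n powr (9 + 6 * b) = (N powr (3 + 2 * b)) ^ 3" using N
      by (simp add: N_def[symmetric] powr_power algebra_simps)
    then show ?thesis using pow3 by (simp add: N_def)
  qed
  define d where "d = \<epsilon>\<^sup>2 * \<delta>"
  have \<epsilon>_sq: "\<epsilon>\<^sup>2 < 1" using \<epsilon> by (simp add: power_less_one_iff)
  have d: "0 < d" "d \<le> \<epsilon>\<^sup>2" "d < 1" using \<epsilon> \<delta> \<epsilon>_sq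
    by (auto simp: d_def mult_le_cancel_left1) (smt (verit) mult_le_cancel_left1 zero_less_power)
  have Plow: "2 ^ 18 / d\<^sup>2 * (N ^ 3 * \<tau>\<^sup>2) \<le> P" using p(2) unfolding pow3 by (simp add: d_def P_def)
  have Pupp: "P \<le> 2 ^ 19 / d\<^sup>2 * (N ^ 3 * \<tau>\<^sup>2)" using p(3) unfolding pow3 by (simp add: d_def P_def)
  have N3\<tau>: "0 < N ^ 3 * \<tau>\<^sup>2" using N \<tau>1 by (intro mult_pos_pos zero_less_power) auto
  have Plow_\<epsilon>: "2 ^ 18 * (N ^ 3 * \<tau>\<^sup>2) / \<epsilon> ^ 4 \<le> P"
  proof -
    have "d\<^sup>2 \<le> (\<epsilon>\<^sup>2)\<^sup>2" using d by (intro power_mono) auto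
    then have "d\<^sup>2 \<le> \<epsilon> ^ 4" by (simp add: power_mult[symmetric])
    then have "2 ^ 18 * (N ^ 3 * \<tau>\<^sup>2) / \<epsilon> ^ 4 \<le> 2 ^ 18 * (N ^ 3 * \<tau>\<^sup>2) / d\<^sup>2"
      using d N3\<tau> \<epsilon> by (intro divide_left_mono mult_pos_pos) auto
    then show ?thesis using Plow by simp
  qed
  have Plow_\<tau>: "9 * \<tau>\<^sup>2 \<le> P"
  proof -
    have "1 \<le> N ^ 3" using N by (intro one_le_power) auto
    then have "9 \<le> 2 ^ 18 * N ^ 3" by simp
    then have "9 * \<tau>\<^sup>2 \<le> 2 ^ 18 * N ^ 3 * \<tau>\<^sup>2" by (intro mult_right_mono) auto
    also have "\<dots> \<le> 2 ^ 18 * (N ^ 3 * \<tau>\<^sup>2) / \<epsilon> ^ 4"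
    proof -
      have "\<epsilon> ^ 4 \<le> 1" using \<epsilon> by (simp add: power_le_one)
      then have "2 ^ 18 * (N ^ 3 * \<tau>\<^sup>2) / 1 \<le> 2 ^ 18 * (N ^ 3 * \<tau>\<^sup>2) / \<epsilon> ^ 4"
        using N3\<tau> \<epsilon> by (intro divide_left_mono) auto
      then show ?thesis by simp
    qed
    finally show ?thesis using Plow_\<epsilon> by linarith
  qed
  have P9: "P \<ge> 9" using Plow_\<tau> \<tau>1 one_le_power[of \<tau> 2] by linarith
  have p3: "CARD('p) \<ge> 3" using P9 unfolding P by linarith
  note dims = dimension_bounds[OF N_def n(2) b(1) \<tau>_def Plow_\<tau> r[folded N_def P_def]]
  define T where "T = c4 * (1 / (\<epsilon>\<^sup>2 * \<delta>)) ^ 6 * real n powr (9 + 6 * b)"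
  \<comment> \<open>\<open>c4\<close> is \<open>exp 1 * (2 ^ 19) ^ 3\<close>: the threshold
    dominates \<open>exp 1\<close> times the cube of the largest admissible prime.\<close>
  have T: "exp 1 * P ^ 3 \<le> T"
  proof -
    have "P ^ 3 \<le> (2 ^ 19 / d\<^sup>2 * (N ^ 3 * \<tau>\<^sup>2)) ^ 3" using Pupp P9 by (intro power_mono) auto
    also have "\<dots> = 2 ^ 57 * (1 / d) ^ 6 * (N ^ 3 * \<tau>\<^sup>2) ^ 3"
      by (simp add: power_mult_distrib power_divide power_mult[symmetric])
    finally have "exp 1 * P ^ 3 \<le> exp 1 * (2 ^ 57 * (1 / d) ^ 6 * (N ^ 3 * \<tau>\<^sup>2) ^ 3)"
      by (intro mult_left_mono) auto
    then show ?thesis unfolding T_def c4 pow9 d_def by (simp only: mult.assoc)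
  qed
  have \<tau>0: "\<tau> > 0" using \<tau>1 by linarith
  obtain c \<rho> where c: "0 < c" "0 < \<rho>" "c < \<tau> * \<rho>" "is_covering int_lattice ((*\<^sub>R) c ` K)"
    "is_packing int_lattice ((*\<^sub>R) \<rho> ` K)"
    using rho_less_obtain[OF K rho[folded N_def, folded \<tau>_def] \<tau>0] by blast
  \<comment> \<open>Rescaled so that the body itself covers; its packing scale
    \<open>\<rho> / c\<close> then exceeds \<open>1 / \<tau>\<close>.\<close>
  define K1 where "K1 = (*\<^sub>R) c ` K"
  define V where "V = measure lebesgue K1"
  have scaled: "(*\<^sub>R) (x / c) ` K1 = (*\<^sub>R) x ` K" for x using c(1) by (simp add: K1_def image_image)
  have K1: "bounded K1" "convex K1" "is_covering int_lattice K1"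
    using K c(4) by (auto simp: K1_def intro: bounded_scaling convex_scaling)
  have V1: "V \<ge> 1" unfolding V_def by (rule covering_measure_ge_1[OF K1])
  have pack: "\<rho> / c > 0" "is_packing int_lattice ((*\<^sub>R) (\<rho> / c) ` K1)" "1 < \<tau> * (\<rho> / c)"
    using c by (auto simp: scaled divide_simps)
  have packV: "(\<rho> / c) ^ n * V \<le> 1"
    using packing_measure_le_1[OF _ _ pack(2)] K1 c(1,2)
    by (simp add: measure_scaleR bounded_scaling convex_scaling V_def n(1))
  \<comment> \<open>From \<open>8 * N * P / \<epsilon>\<close> on no balance is required; the
    summand 2 makes room for the outer scale \<open>j + 2\<close>.\<close>
  define J where "J = nat \<lceil>8 * N * P / \<epsilon>\<rceil> + 2"
  have J: "8 * N * P / \<epsilon> + 2 \<le> real J" "real J \<le> 8 * N * P / \<epsilon> + 3"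
  proof -
    have "0 \<le> 8 * N * P / \<epsilon>" using N P9 \<epsilon> by simp
    then show "8 * N * P / \<epsilon> + 2 \<le> real J" "real J \<le> 8 * N * P / \<epsilon> + 3"
      unfolding J_def by linarith+
  qed
  \<comment> \<open>The union bound runs only over scales with enough expected points, measured by
    the lower bound for the mean count.\<close>
  define Sc where "Sc = {j \<in> {3..J}. P ^ 3 \<le> ((real j - 1) / P) ^ n * V * P ^ r}"
  define U where "U j
    = {S \<in> grassmannian r. \<not> balanced K1 r (\<epsilon> / 4) j (S :: ('p mod_ring ^ 'n) set)}" for j
  define Bad where "Bad = (\<Union>j\<in>Sc. U j)"
  let ?G = "real (card (grassmannian r :: ('p mod_ring ^ 'n) set set))"
  have U: "real (card (U j)) \<le> 64 * N / ((\<epsilon> / 4)\<^sup>2 * P\<^sup>2) * ?G" if "j \<in> Sc" for j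
    using unbalanced_bound[OF K1 pack(1,2) \<tau>1 pack(3), of r "\<epsilon> / 4" j, where 'p = 'p] dims p3 \<epsilon> that
    unfolding U_def Sc_def P N_def n(1) V_def by simp
  have "real (card Bad) \<le> (\<Sum>j\<in>Sc. real (card (U j)))"
    unfolding Bad_def of_nat_sum[symmetric] of_nat_le_iff by (rule card_UN_le) (simp add: Sc_def)
  also have "\<dots> \<le> (\<Sum>j\<in>Sc. 64 * N / ((\<epsilon> / 4)\<^sup>2 * P\<^sup>2) * ?G)" by (intro sum_mono U)
  also have "\<dots> = real (card Sc) * (64 * N / ((\<epsilon> / 4)\<^sup>2 * P\<^sup>2)) * ?G" by simp
  also have "\<dots> \<le> \<delta> * ?G"
  proof (rule mult_right_mono)
    have "card Sc \<le> card {3..J}" unfolding Sc_def by (intro card_mono) auto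
    then have "real (card Sc) \<le> real J" by simp
    also have "\<dots> \<le> 9 * N * P / \<epsilon>"
    proof -
      have "3 * 1 \<le> N * P" using N P9 by (intro mult_mono) auto
      then have "3 \<le> N * P / \<epsilon>" using \<epsilon> by (simp add: pos_le_divide_eq)
      then show ?thesis using J(2) by simp
    qed
    finally have "real (card Sc) * (64 * N / ((\<epsilon> / 4)\<^sup>2 * P\<^sup>2))
      \<le> 9 * N * P / \<epsilon> * (64 * N / ((\<epsilon> / 4)\<^sup>2 * P\<^sup>2))"
      using N by (intro mult_right_mono) auto
    \<comment> \<open>The constant is 9 * 64 * 16, where 16 comes from demanding balance within
      \<open>\<epsilon> / 4\<close>. The remaining factor \<open>1 / P\<close> is what the lower
      bound on \<open>P\<close> compensates.\<close>
    also have "\<dots> = 9216 * N\<^sup>2 / \<epsilon> ^ 3 / P"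
      using P9 \<epsilon> by (simp add: power2_eq_square power3_eq_cube field_simps)
    also have "\<dots> \<le> \<delta>"
    proof -
      have "9216 * N\<^sup>2 / \<epsilon> ^ 3 \<le> \<delta> * (2 ^ 18 / d\<^sup>2 * (N ^ 3 * \<tau>\<^sup>2))"
      proof -
        have N\<tau>: "1 * 1 \<le> N * \<tau>\<^sup>2" using N \<tau>1 by (intro mult_mono one_le_power) auto
        have \<epsilon>\<delta>: "\<epsilon> * \<delta> \<le> 1 * 1" using \<epsilon> \<delta> by (intro mult_mono) auto
        have "9216 * (\<epsilon> * \<delta>) \<le> 9216 * (1 * 1)" using \<epsilon>\<delta> by (rule mult_left_mono) simp
        also have "\<dots> \<le> 2 ^ 18 * (1 * 1)" by simp
        also have "\<dots> \<le> 2 ^ 18 * (N * \<tau>\<^sup>2)" using N\<tau> by (rule mult_left_mono) simp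
        finally have "9216 * (\<epsilon> * \<delta>) \<le> 2 ^ 18 * (N * \<tau>\<^sup>2)" .
        then have "(N\<^sup>2 / (\<epsilon> ^ 4 * \<delta>)) * (9216 * (\<epsilon> * \<delta>))
          \<le> (N\<^sup>2 / (\<epsilon> ^ 4 * \<delta>)) * (2 ^ 18 * (N * \<tau>\<^sup>2))"
          using \<epsilon> \<delta> by (intro mult_left_mono) auto
        moreover have "(N\<^sup>2 / (\<epsilon> ^ 4 * \<delta>)) * (9216 * (\<epsilon> * \<delta>)) = 9216 * N\<^sup>2 / \<epsilon> ^ 3"
          using \<epsilon> \<delta> by (simp add: power3_eq_cube power4_eq_xxxx mult_ac)
        moreover have "(N\<^sup>2 / (\<epsilon> ^ 4 * \<delta>)) * (2 ^ 18 * (N * \<tau>\<^sup>2))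
          = \<delta> * (2 ^ 18 / d\<^sup>2 * (N ^ 3 * \<tau>\<^sup>2))"
          using \<epsilon> \<delta> by (simp add: d_def power2_eq_square power3_eq_cube power4_eq_xxxx mult_ac)
        ultimately show ?thesis by linarith
      qed
      also have "\<dots> \<le> \<delta> * P" using Plow \<delta> by (intro mult_left_mono) auto
      finally show ?thesis using P9 by (subst pos_divide_le_eq) auto
    qed
    finally show "real (card Sc) * (64 * N / ((\<epsilon> / 4)\<^sup>2 * P\<^sup>2)) \<le> \<delta>" .
  qed simp
  finally have card_Bad: "real (card Bad) \<le> \<delta> * ?G" .
  have "S \<in> Bad" if S: "S \<in> grassmannian r" and Phi: "ereal T < Phi K (construction_A S) \<epsilon>"
    for S :: "('p mod_ring ^ 'n) set"
  proof (rule ccontr)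
    assume "S \<notin> Bad"
    then have good: "balanced K1 r (\<epsilon> / 4) j S"
      if "j \<in> {3..J}" "P ^ 3 \<le> ((real j - 1) / P) ^ n * V * P ^ r" for j
      using S that by (auto simp: Bad_def U_def Sc_def)
    from Phi obtain \<alpha> where \<alpha>: "\<alpha> > 0" "eta ((*\<^sub>R) \<alpha> ` K) (construction_A S) > ereal \<epsilon>"
      "T < measure lebesgue ((*\<^sub>R) \<alpha> ` K) / covol (construction_A S)"
      unfolding Phi_def less_Sup_iff by auto
    \<comment> \<open>The dilation factor in units where \<open>K1\<close> is the body and the grid
      spacing is one, so that scale \<open>a / P\<close> of \<open>K1\<close> is scale
      \<open>\<alpha>\<close> of \<open>K\<close>.\<close>
    define a where "a = \<alpha> * P / c"
    have a0: "a > 0" using \<alpha>(1) c(1) P9 by (simp add: a_def)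
    have aP: "a / P = \<alpha> / c" using P9 by (simp add: a_def)
    have body: "(*\<^sub>R) (a / P) ` K1 = (*\<^sub>R) \<alpha> ` K" unfolding aP by (rule scaled)
    have density: "measure lebesgue ((*\<^sub>R) \<alpha> ` K) / covol (construction_A S)
      = (a / P) ^ n * V * P ^ r"
      using covol_construction_A[of S] S a0 unfolding body[symmetric] measure_scaleR
      by (simp add: grassmannian_def P aP V_def n(1))
    have large: "exp 1 * P ^ 3 \<le> (a / P) ^ n * V * P ^ r" using \<alpha>(3) T unfolding density by linarith
    have "1 * P ^ 3 < exp 1 * P ^ 3" using P9 by (intro mult_strict_right_mono) auto
    then have "50 * N / \<epsilon> \<le> a"
      using large
      by (intro scaling_lower_bound[OF N_def n(2) \<tau>1 \<tau>_sq \<epsilon> Plow_\<epsilon> dims(3) V1 packV pack(1,3) a0])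
        linarith
    then have "\<bar>real (N_points (construction_A S) ((*\<^sub>R) (a / P) ` K1) x) / ((a / P) ^ n * V
      * P ^ r) - 1\<bar> \<le> \<epsilon>" for x
      using N_points_balanced[OF K1 S \<epsilon>, of a J x] large J(1) good unfolding P N_def n(1) V_def
        by simp
    then have "eta ((*\<^sub>R) \<alpha> ` K) (construction_A S) \<le> ereal \<epsilon>"
      unfolding eta_def density body by (intro SUP_least) simp
    with \<alpha>(2) show False by simp
  qed
  then show ?thesis
    unfolding T_def[symmetric]
    by (intro prob_construction_A_ensemble_le[OF grassmannian_proportion(2)[of r "{}"] _ card_Bad])
      (use p3 dims(1) n(1) in auto)
qed

end
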